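(* Let $V:\mathbb{R}^d\to\mathbb{R}$ be $\mathbb{Z}^d$-periodic of class $C^3$, $\omega\in\mathbb{R}^d$, $\mathcal{L}(x,v)=\frac{|v|^2}{2}-V(x)-\langle\omega,v\rangle$, and $t>0$. Let $x,y\in\mathbb{R}^d$ and let $\gamma$ be a critical point of the action $\mathcal{A}(\xi_{|[0,t]})=\int_0^t\mathcal{L}(\xi_s,\dot\xi_s)\,ds$ on the affine Hilbert space $H_{[0,t]}^{x,y}=\{\xi:[0,t]\to\mathbb{R}^d,\ \dot\xi\in L^2([0,t]),\ \xi_0=x,\ \xi_t=y\}$, whose tangent space $H_{[0,t]}^{0,0}$ is endowed with the scalar product $\langle\xi,\eta\rangle=\int_0^t\dot\xi_s\cdot\dot\eta_s\,ds$. Then the hessian $\mathcal{A}''(\gamma)$, a self-adjoint operator on $H_{[0,t]}^{0,0}$, has a well defined determinant, the infinite product of its eigenvalues. This determinant coincides with the determinant of the linear endomorphism of $\mathbb{R}^d$ which maps $Y'\in\mathbb{R}^d$ to $\frac{Y_t}{t}$, where $(Y_s)_{s\in[0,t]}$ is the solution of the linearized equation $$Y''_s+V''(\gamma_s)\cdot Y_s=0,\qquad Y_0=0,\quad Y'_0=Y'.$$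
   Context: The hessian $\mathcal{A}''(\gamma)$ is the self-adjoint operator on $H^{0,0}_{[0,t]}$ defined by $d^2\mathcal{A}(\gamma)\cdot\xi\cdot\xi=\langle\mathcal{A}''(\gamma)\xi,\xi\rangle$, where $d^2\mathcal{A}(\gamma)$ is the second derivative of $\mathcal{A}$ on $H^{x,y}_{[0,t]}$ at $\gamma$. It is of the form $I+f$ with $f$ self-adjoint; if $(\lambda_i)_{i\in\mathbb{N}}$ are the eigenvalues of $f$ counted with multiplicity, the determinant of $I+f$ is $\prod_{i}(1+\lambda_i)$, well defined meaning that $\sum_i|\lambda_i|<\infty$. $V''(\gamma_s)$ is the Hessian matrix of $V$ at $\gamma_s$. *)

theory Defs
  imports "HOL-Analysis.Analysis"
begin

primrec C_k :: "nat \<Rightarrow> ('a::euclidean_space \<Rightarrow> 'b::real_normed_vector) \<Rightarrow> bool" where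
  "C_k 0 f \<longleftrightarrow> continuous_on UNIV f"
| "C_k (Suc k) f \<longleftrightarrow>
     (\<forall>x. f differentiable (at x)) \<and> (\<forall>v. C_k k (\<lambda>x. frechet_derivative f (at x) v))"

definition Z_periodic :: "(real^'n \<Rightarrow> 'b) \<Rightarrow> bool" where
  "Z_periodic V \<longleftrightarrow> (\<forall>x (k::int^'n). V (x + (\<chi> i. real_of_int (k $ i))) = V x)"

definition hessian_matrix :: "(real^'n \<Rightarrow> real) \<Rightarrow> real^'n \<Rightarrow> real^'n^'n" where
  "hessian_matrix V x =
     (\<chi> i j. frechet_derivative (\<lambda>y. frechet_derivative V (at y) (axis j 1)) (at x) (axis i 1))"

definition lagrangian :: "(real^'n \<Rightarrow> real) \<Rightarrow> real^'n \<Rightarrow> real^'n \<Rightarrow> real^'n \<Rightarrow> real" where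
  "lagrangian V \<omega> x v = (norm v)\<^sup>2 / 2 - V x - \<omega> \<bullet> v"

text \<open>
  A path on \<open>[0,t]\<close> is represented by its extension by \<open>0\<close> to the whole real line, so that
  equality of paths is equality of functions. The derivative is the weak one: \<open>\<xi>\<close> has
  derivative \<open>v\<close> in \<open>L\<^sup>2([0,t])\<close> iff \<open>v\<close> is square integrable and \<open>\<xi>\<close> is a primitive of \<open>v\<close>.
\<close>

type_synonym 'n path = "real \<Rightarrow> real^'n"

definition has_L2_derivative :: "real \<Rightarrow> ('n::finite) path \<Rightarrow> 'n path \<Rightarrow> bool" where
  "has_L2_derivative t \<xi> v \<longleftrightarrow>
     v \<in> borel_measurable (lebesgue_on {0..t}) \<and>
     integrable (lebesgue_on {0..t}) (\<lambda>s. (norm (v s))\<^sup>2) \<and>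
     (\<forall>s\<in>{0..t}. \<xi> s = \<xi> 0 + (LINT r|lebesgue_on {0..s}. v r))"

text \<open>
  The derivative is determined only almost everywhere; a representative is chosen. It is only
  ever used under an integral over \<open>[0,t]\<close>.
\<close>

definition velocity :: "real \<Rightarrow> ('n::finite) path \<Rightarrow> 'n path" where
  "velocity t \<xi> = (SOME v. has_L2_derivative t \<xi> v)"

definition H_space :: "real \<Rightarrow> real^'n \<Rightarrow> real^'n \<Rightarrow> 'n path set" where
  "H_space t x y =
     {\<xi>. (\<exists>v. has_L2_derivative t \<xi> v) \<and> \<xi> 0 = x \<and> \<xi> t = y \<and> (\<forall>s. s \<notin> {0..t} \<longrightarrow> \<xi> s = 0)}"

abbreviation H0 :: "real \<Rightarrow> (('n::finite) path) set" where
  "H0 t \<equiv> H_space t 0 0"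

definition H_inner :: "real \<Rightarrow> ('n::finite) path \<Rightarrow> 'n path \<Rightarrow> real" where
  "H_inner t \<xi> \<eta> = (LINT s|lebesgue_on {0..t}. velocity t \<xi> s \<bullet> velocity t \<eta> s)"

definition H_norm :: "real \<Rightarrow> ('n::finite) path \<Rightarrow> real" where
  "H_norm t \<xi> = sqrt (H_inner t \<xi> \<xi>)"

definition action :: "(real^'n \<Rightarrow> real) \<Rightarrow> real^'n \<Rightarrow> real \<Rightarrow> 'n path \<Rightarrow> real" where
  "action V \<omega> t \<xi> = (LINT s|lebesgue_on {0..t}. lagrangian V \<omega> (\<xi> s) (velocity t \<xi> s))"

definition H_linear :: "real \<Rightarrow> (('n::finite) path \<Rightarrow> real) \<Rightarrow> bool" where
  "H_linear t l \<longleftrightarrow>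
     (\<forall>\<xi>\<in>H0 t. \<forall>\<eta>\<in>H0 t. l (\<lambda>s. \<xi> s + \<eta> s) = l \<xi> + l \<eta>) \<and>
     (\<forall>c. \<forall>\<xi>\<in>H0 t. l (\<lambda>s. c *\<^sub>R \<xi> s) = c * l \<xi>)"

text \<open>
  Frechet differentiability on an affine space with direction \<^term>\<open>H0 t\<close>: the first differential
  at \<open>\<gamma>\<close> is a bounded linear form, the second one is a bounded bilinear form, namely the
  differential of the map sending a point to its first differential, for the operator norm on the
  dual. Here \<open>D \<xi>\<close> is the first differential at the point \<open>\<gamma> + \<xi>\<close>.
\<close>

definition has_differential :: "real \<Rightarrow> (('n::finite) path \<Rightarrow> real) \<Rightarrow> 'n path \<Rightarrow> ('n path \<Rightarrow> real) \<Rightarrow> bool" where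
  "has_differential t F \<gamma> l \<longleftrightarrow>
     H_linear t l \<and> (\<exists>C. \<forall>\<xi>\<in>H0 t. \<bar>l \<xi>\<bar> \<le> C * H_norm t \<xi>) \<and>
     (\<forall>\<epsilon>>0. \<exists>\<delta>>0. \<forall>\<xi>\<in>H0 t. H_norm t \<xi> < \<delta> \<longrightarrow>
        \<bar>F (\<lambda>s. \<gamma> s + \<xi> s) - F \<gamma> - l \<xi>\<bar> \<le> \<epsilon> * H_norm t \<xi>)"

definition has_second_differential ::
    "real \<Rightarrow> (('n::finite) path \<Rightarrow> real) \<Rightarrow> 'n path \<Rightarrow> ('n path \<Rightarrow> 'n path \<Rightarrow> real) \<Rightarrow> bool" where
  "has_second_differential t F \<gamma> b \<longleftrightarrow>
     (\<forall>\<xi>\<in>H0 t. H_linear t (b \<xi>)) \<and> (\<forall>\<eta>\<in>H0 t. H_linear t (\<lambda>\<xi>. b \<xi> \<eta>)) \<and>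
     (\<exists>C. \<forall>\<xi>\<in>H0 t. \<forall>\<eta>\<in>H0 t. \<bar>b \<xi> \<eta>\<bar> \<le> C * H_norm t \<xi> * H_norm t \<eta>) \<and>
     (\<exists>D r. r > 0 \<and>
        (\<forall>\<xi>\<in>H0 t. H_norm t \<xi> < r \<longrightarrow> has_differential t F (\<lambda>s. \<gamma> s + \<xi> s) (D \<xi>)) \<and>
        (\<forall>\<epsilon>>0. \<exists>\<delta>>0. \<forall>\<xi>\<in>H0 t. H_norm t \<xi> < \<delta> \<longrightarrow>
           (\<forall>\<eta>\<in>H0 t. \<bar>D \<xi> \<eta> - D (\<lambda>_. 0) \<eta> - b \<xi> \<eta>\<bar> \<le> \<epsilon> * H_norm t \<xi> * H_norm t \<eta>)))"

definition critical_point ::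
    "(real^'n \<Rightarrow> real) \<Rightarrow> real^'n \<Rightarrow> real \<Rightarrow> real^'n \<Rightarrow> real^'n \<Rightarrow> 'n path \<Rightarrow> bool" where
  "critical_point V \<omega> t x y \<gamma> \<longleftrightarrow>
     \<gamma> \<in> H_space t x y \<and> has_differential t (action V \<omega> t) \<gamma> (\<lambda>_. 0)"

text \<open>
  Operators on \<^term>\<open>H0 t\<close> are extensional functions, so that equality of operators is equality of
  functions.
\<close>

definition H_operator :: "real \<Rightarrow> (('n::finite) path \<Rightarrow> 'n path) \<Rightarrow> bool" where
  "H_operator t T \<longleftrightarrow>
     T \<in> H0 t \<rightarrow>\<^sub>E H0 t \<and>
     (\<forall>\<xi>\<in>H0 t. \<forall>\<eta>\<in>H0 t. T (\<lambda>s. \<xi> s + \<eta> s) = (\<lambda>s. T \<xi> s + T \<eta> s)) \<and>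
     (\<forall>c. \<forall>\<xi>\<in>H0 t. T (\<lambda>s. c *\<^sub>R \<xi> s) = (\<lambda>s. c *\<^sub>R T \<xi> s)) \<and>
     (\<exists>C. \<forall>\<xi>\<in>H0 t. H_norm t (T \<xi>) \<le> C * H_norm t \<xi>)"

definition H_self_adjoint :: "real \<Rightarrow> (('n::finite) path \<Rightarrow> 'n path) \<Rightarrow> bool" where
  "H_self_adjoint t T \<longleftrightarrow>
     H_operator t T \<and> (\<forall>\<xi>\<in>H0 t. \<forall>\<eta>\<in>H0 t. H_inner t (T \<xi>) \<eta> = H_inner t \<xi> (T \<eta>))"

definition is_hessian_operator ::
    "real \<Rightarrow> (('n::finite) path \<Rightarrow> real) \<Rightarrow> 'n path \<Rightarrow> ('n path \<Rightarrow> 'n path) \<Rightarrow> bool" where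
  "is_hessian_operator t F \<gamma> T \<longleftrightarrow>
     H_self_adjoint t T \<and>
     (\<exists>b. has_second_differential t F \<gamma> b \<and> (\<forall>\<xi>\<in>H0 t. b \<xi> \<xi> = H_inner t (T \<xi>) \<xi>))"

definition hessian_operator ::
    "real \<Rightarrow> (('n::finite) path \<Rightarrow> real) \<Rightarrow> 'n path \<Rightarrow> ('n path \<Rightarrow> 'n path)" where
  "hessian_operator t F \<gamma> = (THE T. is_hessian_operator t F \<gamma> T)"

definition hilbert_basis :: "real \<Rightarrow> ('n::finite) path set \<Rightarrow> 'i set \<Rightarrow> ('i \<Rightarrow> 'n path) \<Rightarrow> bool" where
  "hilbert_basis t S I e \<longleftrightarrow>
     (\<forall>i\<in>I. e i \<in> S) \<and>
     (\<forall>i\<in>I. \<forall>j\<in>I. H_inner t (e i) (e j) = (if i = j then 1 else 0)) \<and>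
     (\<forall>\<xi>\<in>S. (\<forall>i\<in>I. H_inner t \<xi> (e i) = 0) \<longrightarrow> \<xi> = (\<lambda>_. 0))"

definition eigenspace :: "real \<Rightarrow> (('n::finite) path \<Rightarrow> 'n path) \<Rightarrow> real \<Rightarrow> 'n path set" where
  "eigenspace t f \<mu> = {\<xi> \<in> H0 t. f \<xi> = (\<lambda>s. \<mu> *\<^sub>R \<xi> s)}"

text \<open>
  The sequence \<open>\<nu>\<close> lists the eigenvalues of the self-adjoint operator \<open>f\<close> with multiplicity: each
  real \<open>\<mu>\<close> occurs as often as the (Hilbert) dimension of its eigenspace, possibly never or
  infinitely often. The eigenvectors are moreover required to span the whole space, so that
  an operator with continuous spectrum has no such listing.
\<close>

definition eigenvalues_with_multiplicity ::
    "real \<Rightarrow> (('n::finite) path \<Rightarrow> 'n path) \<Rightarrow> (nat \<Rightarrow> real) \<Rightarrow> bool" where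
  "eigenvalues_with_multiplicity t f \<nu> \<longleftrightarrow>
     (\<exists>e. hilbert_basis t (H0 t) UNIV e \<and>
          (\<forall>\<mu>. hilbert_basis t (eigenspace t f \<mu>) {i. \<nu> i = \<mu>} e))"

text \<open>
  \<open>T = I + f\<close> has a well-defined determinant, equal to \<open>D\<close>. The value must not depend on the order
  in which the eigenvalues of \<open>f\<close> are listed. Note that \<open>has_prod\<close> covers products with a
  vanishing factor.
\<close>

definition has_determinant :: "real \<Rightarrow> (('n::finite) path \<Rightarrow> 'n path) \<Rightarrow> real \<Rightarrow> bool" where
  "has_determinant t T D \<longleftrightarrow>
     (let f = (\<lambda>\<xi>\<in>H0 t. (\<lambda>s. T \<xi> s - \<xi> s)) in
        H_self_adjoint t f \<and>
        (\<exists>\<nu>. eigenvalues_with_multiplicity t f \<nu>) \<and>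
        (\<forall>\<nu>. eigenvalues_with_multiplicity t f \<nu> \<longrightarrow>
           summable (\<lambda>i. \<bar>\<nu> i\<bar>) \<and> (\<lambda>i. 1 + \<nu> i) has_prod D))"

definition linearized_solution ::
    "(real^'n \<Rightarrow> real) \<Rightarrow> real \<Rightarrow> 'n path \<Rightarrow> real^'n \<Rightarrow> 'n path \<Rightarrow> bool" where
  "linearized_solution V t \<gamma> w Y \<longleftrightarrow>
     (\<exists>Y'. (\<forall>s\<in>{0..t}.
              (Y has_vector_derivative Y' s) (at s within {0..t}) \<and>
              (Y' has_vector_derivative - (hessian_matrix V (\<gamma> s) *v Y s)) (at s within {0..t})) \<and>
           Y 0 = 0 \<and> Y' 0 = w) \<and>
     (\<forall>s. s \<notin> {0..t} \<longrightarrow> Y s = 0)"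

definition linearized_map ::
    "(real^'n \<Rightarrow> real) \<Rightarrow> real \<Rightarrow> 'n path \<Rightarrow> real^'n \<Rightarrow> real^'n" where
  "linearized_map V t \<gamma> w = (THE Y. linearized_solution V t \<gamma> w Y) t /\<^sub>R t"

end

theory Submission
  imports Defs "HOL-Complex_Analysis.Complex_Analysis" "HOL-Library.Function_Algebras"
begin

text \<open>
  The second differential of the action is \<open>\<langle>(I + f) \<xi>, \<xi>\<rangle>\<close> with \<open>\<langle>f \<xi>, \<eta>\<rangle> = - \<integral> V''(\<gamma>) \<xi> \<bullet> \<eta>\<close>. The operator
  \<open>f\<close> is compact and self-adjoint, and Bessel's inequality against the reproducing kernel of the path
  space bounds \<open>\<Sum> |\<nu>\<^sub>i|\<close>. Now replace \<open>V''\<close> by \<open>z V''\<close>: with \<open>Y\<^sup>z\<close> the fundamental solution of the linearized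
  equation, which is a power series in \<open>z\<close>, both \<open>D(z) = \<Prod> (1 + z \<nu>\<^sub>i)\<close> and \<open>E(z) = det (Y\<^sup>z(t) / t)\<close> are
  entire and equal to 1 at 0. For small real \<open>z\<close>, \<open>D'/D = tr ((I + z f)\<^sup>-\<^sup>1 f)\<close> is by Parseval an integral of
  \<open>V''\<close> against the diagonal of Green's function of \<open>- d\<^sup>2/ds\<^sup>2 - z V''\<close>; Green's function is explicit in
  terms of solutions, and the symmetry of \<open>V''\<close> (constant Wronskians) identifies the integral with
  \<open>E'/E\<close>. So \<open>D = E\<close> near 0, hence at \<open>z = 1\<close> by analytic continuation, and no zeros need be counted.
\<close>

section \<open>Inner product spaces on a carrier, and compact symmetric operators\<close>

text \<open>At \<open>z = 1\<close> a factor 1 + \<nu> i may vanish (the endpoints are then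
  conjugate along \<gamma>), and neither the resolvent nor the inverse of the fundamental matrix
  exists. The parameter moves the comparison to a neighbourhood of 0, where both exist; only an
  identity between entire functions is carried to 1. The trace can be taken pointwise in s because a
  \<bullet> e i s is a Fourier coefficient of a path depending on s and a. The resulting bound on
  the sum of the squares |e i s|^2 is uniform in s, so it also dominates the partial sums when sum
  and integral are exchanged. A determinant must have the same value for every listing of the
  eigenvalues. Therefore the computation starts from an arbitrary total orthonormal family of
  eigenvectors; the spectral theorem only shows that such a family exists. Since \<open>H0 t\<close>
  is a set of functions and not a type, the Hilbert space theory is developed relative to a
  carrier.\<close>

instantiation "fun" :: (type, real_vector) real_vector
begin

text \<open>With the pointwise operations a path space becomes a \<open>subspace\<close> of a type
  in \<open>real_vector\<close>, so the abstract lemmas on carriers apply to \<open>H0 t\<close>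
  directly.\<close>

definition "c *\<^sub>R f = (\<lambda>x. c *\<^sub>R f x)"

instance
  by standard (auto simp: scaleR_fun_def plus_fun_def scaleR_add_right scaleR_add_left)

end

text \<open>The axioms are relative to \<open>H\<close> because the form of interest behaves well
  only there: \<open>velocity\<close> is an arbitrary choice for functions without a weak
  derivative, and a constant path has velocity zero, so definiteness depends on the boundary
  conditions.\<close>

locale inner_space =
  fixes H :: "'a::real_vector set" and ip :: "'a \<Rightarrow> 'a \<Rightarrow> real"
  assumes subsp: "subspace H"
    and ip_add_left: "\<lbrakk>x \<in> H; y \<in> H; z \<in> H\<rbrakk> \<Longrightarrow> ip (x + y) z = ip x z + ip y z"
    and ip_scale_left: "\<lbrakk>x \<in> H; z \<in> H\<rbrakk> \<Longrightarrow> ip (c *\<^sub>R x) z = c * ip x z"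
    and ip_sym: "\<lbrakk>x \<in> H; y \<in> H\<rbrakk> \<Longrightarrow> ip x y = ip y x"
    and ip_nonneg: "x \<in> H \<Longrightarrow> ip x x \<ge> 0"
    and ip_definite: "\<lbrakk>x \<in> H; ip x x = 0\<rbrakk> \<Longrightarrow> x = 0"
begin

definition nrm :: "'a \<Rightarrow> real" where "nrm x = sqrt (ip x x)"

text \<open>Convergence is expressed through \<open>nrm\<close>, as the ambient vector space carries
  no topology that induces this norm.\<close>

definition tends :: "(nat \<Rightarrow> 'a) \<Rightarrow> 'a \<Rightarrow> bool" where
  "tends x g \<longleftrightarrow> (\<lambda>n. nrm (x n - g)) \<longlonglongrightarrow> 0"

lemma H_intros [simp, intro]:
  "0 \<in> H" "\<lbrakk>x \<in> H; y \<in> H\<rbrakk> \<Longrightarrow> x + y \<in> H" "\<lbrakk>x \<in> H; y \<in> H\<rbrakk> \<Longrightarrow> x - y \<in> H" "x \<in> H \<Longrightarrow> c *\<^sub>R x \<in> H"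
  using subsp by (auto simp: subspace_0 subspace_add subspace_diff subspace_scale)

lemma H_sum [simp, intro]: "(\<And>i. i \<in> A \<Longrightarrow> f i \<in> H) \<Longrightarrow> sum f A \<in> H"
  using subsp by (rule subspace_sum)

lemma ip_add_right: "\<lbrakk>x \<in> H; y \<in> H; z \<in> H\<rbrakk> \<Longrightarrow> ip z (x + y) = ip z x + ip z y"
  by (metis H_intros(2) ip_add_left ip_sym)

lemma ip_scale_right: "\<lbrakk>x \<in> H; z \<in> H\<rbrakk> \<Longrightarrow> ip z (c *\<^sub>R x) = c * ip z x"
  by (metis H_intros(4) ip_scale_left ip_sym)

lemma ip_diff_left: "\<lbrakk>x \<in> H; y \<in> H; z \<in> H\<rbrakk> \<Longrightarrow> ip (x - y) z = ip x z - ip y z"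
  by (metis H_intros(3) diff_add_cancel add_diff_cancel_right' ip_add_left)

lemma ip_diff_right: "\<lbrakk>x \<in> H; y \<in> H; z \<in> H\<rbrakk> \<Longrightarrow> ip z (x - y) = ip z x - ip z y"
  by (metis H_intros(3) ip_diff_left ip_sym)

lemma ip_zero [simp]: "z \<in> H \<Longrightarrow> ip 0 z = 0" "z \<in> H \<Longrightarrow> ip z 0 = 0"
  using ip_diff_left[of z z z] ip_diff_right[of z z z] by auto

lemmas ip_simps = ip_add_left ip_add_right ip_scale_left ip_scale_right ip_diff_left ip_diff_right

lemma ip_sum_left: "\<lbrakk>\<And>i. i \<in> A \<Longrightarrow> f i \<in> H; z \<in> H\<rbrakk> \<Longrightarrow> ip (sum f A) z = (\<Sum>i\<in>A. ip (f i) z)"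
  by (induction A rule: infinite_finite_induct) (auto simp: ip_add_left)

lemma ip_sum_right: "\<lbrakk>\<And>i. i \<in> A \<Longrightarrow> f i \<in> H; z \<in> H\<rbrakk> \<Longrightarrow> ip z (sum f A) = (\<Sum>i\<in>A. ip z (f i))"
  by (induction A rule: infinite_finite_induct) (auto simp: ip_add_right)

lemma nrm_nonneg [simp]: "x \<in> H \<Longrightarrow> nrm x \<ge> 0"
  by (simp add: nrm_def ip_nonneg)

lemma nrm_square: "x \<in> H \<Longrightarrow> (nrm x)\<^sup>2 = ip x x"
  by (simp add: nrm_def ip_nonneg)

lemma nrm_eq_0: "x \<in> H \<Longrightarrow> nrm x = 0 \<longleftrightarrow> x = 0"
  by (auto simp: nrm_def ip_definite)

lemma nrm_scale: "x \<in> H \<Longrightarrow> nrm (c *\<^sub>R x) = \<bar>c\<bar> * nrm x"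
  by (simp add: nrm_def ip_simps real_sqrt_mult flip: mult.assoc)

lemma nrm_minus_commute: "\<lbrakk>x \<in> H; y \<in> H\<rbrakk> \<Longrightarrow> nrm (x - y) = nrm (y - x)"
  using nrm_scale[of "y - x" "-1"] by simp

lemma cauchy_schwarz: 
  assumes "x \<in> H" "y \<in> H" shows "\<bar>ip x y\<bar> \<le> nrm x * nrm y"
proof (cases "y = 0")
  case True
  then show ?thesis using assms by simp
next
  case False
  then have pos: "ip y y > 0"
    using assms ip_definite ip_nonneg by fastforce
  \<comment> \<open>This choice makes \<open>x - c *\<^sub>R y\<close> orthogonal to
    \<open>y\<close>.\<close>
  define c where "c = ip x y / ip y y"
  have "0 \<le> ip (x - c *\<^sub>R y) (x - c *\<^sub>R y)"
    using assms by (intro ip_nonneg) auto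
  also have "\<dots> = ip x x - (ip x y)\<^sup>2 / ip y y"
    using assms pos by (simp add: ip_simps ip_sym[of y x] c_def power2_eq_square)
  finally have "(ip x y)\<^sup>2 \<le> ip x x * ip y y"
    using pos by (simp add: field_simps)
  then show ?thesis
    unfolding nrm_def real_sqrt_mult[symmetric] by (intro real_le_rsqrt) auto
qed

lemma nrm_triangle:
  assumes "x \<in> H" "y \<in> H" shows "nrm (x + y) \<le> nrm x + nrm y"
proof (rule power2_le_imp_le)
  have "(nrm (x + y))\<^sup>2 = (nrm x)\<^sup>2 + 2 * ip x y + (nrm y)\<^sup>2"
    using assms by (simp add: nrm_square ip_simps ip_sym[of y x])
  also have "\<dots> \<le> (nrm x + nrm y)\<^sup>2"
    using cauchy_schwarz[OF assms] by (simp add: power2_sum)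
  finally show "(nrm (x + y))\<^sup>2 \<le> (nrm x + nrm y)\<^sup>2" .
qed (use assms in auto)

lemma nrm_triangle_diff:
  assumes "x \<in> H" "y \<in> H" "z \<in> H" shows "nrm (x - z) \<le> nrm (x - y) + nrm (y - z)"
  using nrm_triangle[of "x - y" "y - z"] assms by simp

lemma nrm_reverse_triangle:
  assumes "x \<in> H" "y \<in> H" shows "\<bar>nrm x - nrm y\<bar> \<le> nrm (x - y)"
  using nrm_triangle[of "x - y" y] nrm_triangle[of "y - x" x] assms nrm_minus_commute[of x y] by simp

lemma tends_unique:
  assumes "\<And>n. x n \<in> H" "g \<in> H" "h \<in> H" "tends x g" "tends x h" shows "g = h"
proof -
  have "(\<lambda>n. nrm (x n - g) + nrm (x n - h)) \<longlonglongrightarrow> 0 + 0"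
    using assms unfolding tends_def by (intro tendsto_add)
  moreover have "nrm (g - h) \<le> nrm (x n - g) + nrm (x n - h)" for n
    using nrm_triangle_diff[of g "x n" h] nrm_minus_commute[of g "x n"] assms by simp
  ultimately have "nrm (g - h) \<le> 0"
    by (intro LIMSEQ_le_const[of "\<lambda>n. nrm (x n - g) + nrm (x n - h)"]) auto
  moreover have "g - h \<in> H" using assms by auto
  ultimately have "nrm (g - h) = 0" using nrm_nonneg by (metis order_antisym)
  then show ?thesis
    using nrm_eq_0[OF \<open>g - h \<in> H\<close>] by simp
qed

lemma tends_scale:
  assumes "\<And>n. x n \<in> H" "g \<in> H" "tends x g" shows "tends (\<lambda>n. c *\<^sub>R x n) (c *\<^sub>R g)"
proof -
  have "(\<lambda>n. \<bar>c\<bar> * nrm (x n - g)) \<longlonglongrightarrow> \<bar>c\<bar> * 0"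
    using assms unfolding tends_def by (intro tendsto_intros)
  then show ?thesis
    unfolding tends_def using assms by (simp add: nrm_scale flip: scaleR_diff_right)
qed

lemma tends_ip:
  assumes "\<And>n. x n \<in> H" "g \<in> H" "y \<in> H" "tends x g" shows "(\<lambda>n. ip (x n) y) \<longlonglongrightarrow> ip g y"
proof (rule LIM_zero_cancel)
  have "(\<lambda>n. nrm (x n - g) * nrm y) \<longlonglongrightarrow> 0 * nrm y"
    using assms unfolding tends_def by (intro tendsto_intros)
  then have lim: "(\<lambda>n. nrm (x n - g) * nrm y) \<longlonglongrightarrow> 0" by simp
  show "(\<lambda>n. ip (x n) y - ip g y) \<longlonglongrightarrow> 0"
  proof (rule Lim_null_comparison[OF always_eventually lim], rule allI)
    show "norm (ip (x n) y - ip g y) \<le> nrm (x n - g) * nrm y" for n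
      using cauchy_schwarz[of "x n - g" y] assms by (simp add: ip_simps)
  qed
qed

lemma tends_nrm:
  assumes "\<And>n. x n \<in> H" "g \<in> H" "tends x g" shows "(\<lambda>n. nrm (x n)) \<longlonglongrightarrow> nrm g"
proof (rule LIM_zero_cancel)
  show "(\<lambda>n. nrm (x n) - nrm g) \<longlonglongrightarrow> 0"
  proof (rule Lim_null_comparison[OF _ assms(3)[unfolded tends_def]])
    have "norm (nrm (x n) - nrm g) \<le> nrm (x n - g)" for n
      using nrm_reverse_triangle[of "x n" g] assms by simp
    then show "\<forall>\<^sub>F n in sequentially. norm (nrm (x n) - nrm g) \<le> nrm (x n - g)" by simp
  qed
qed

definition orthonormal :: "'a set \<Rightarrow> bool" where
  "orthonormal B \<longleftrightarrow> B \<subseteq> H \<and> (\<forall>b\<in>B. \<forall>c\<in>B. ip b c = (if b = c then 1 else 0))"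

text \<open>The residual \<open>x - p\<close> is orthogonal to every \<open>e j\<close>, by the
  third claim; the first two claims are Pythagoras for the decomposition of \<open>x\<close> into
  \<open>p\<close> and the residual.\<close>

lemma orthonormal_residual:
  assumes "\<And>i. i \<in> F \<Longrightarrow> e i \<in> H" "finite F" "x \<in> H"
    and "\<And>i j. \<lbrakk>i \<in> F; j \<in> F\<rbrakk> \<Longrightarrow> ip (e i) (e j) = (if i = j then 1 else 0)"
  defines "p \<equiv> \<Sum>i\<in>F. ip x (e i) *\<^sub>R e i"
  shows "ip (x - p) (x - p) = ip x x - (\<Sum>i\<in>F. (ip x (e i))\<^sup>2)"
    and "ip p p = (\<Sum>i\<in>F. (ip x (e i))\<^sup>2)"
    and "j \<in> F \<Longrightarrow> ip p (e j) = ip x (e j)"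
proof -
  have pH: "p \<in> H" using assms by auto
  have pe: "ip p (e j) = ip x (e j)" if "j \<in> F" for j
  proof -
    have "ip p (e j) = (\<Sum>i\<in>F. ip x (e i) * ip (e i) (e j))"
      unfolding p_def using assms that by (subst ip_sum_left) (auto simp: ip_simps)
    also have "\<dots> = (\<Sum>i\<in>F. if i = j then ip x (e i) else 0)"
      using assms that by (intro sum.cong) auto
    finally show ?thesis using assms that by simp
  qed
  have xp: "ip x p = (\<Sum>i\<in>F. (ip x (e i))\<^sup>2)"
    unfolding p_def using assms by (subst ip_sum_right) (auto simp: ip_simps power2_eq_square)
  have pp: "ip p p = (\<Sum>i\<in>F. (ip x (e i))\<^sup>2)"
  proof -
    have "ip p p = (\<Sum>i\<in>F. ip p (ip x (e i) *\<^sub>R e i))"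
      by (subst (2) p_def, subst ip_sum_right) (use assms pH in auto)
    also have "\<dots> = (\<Sum>i\<in>F. (ip x (e i))\<^sup>2)"
      using assms pH pe by (intro sum.cong) (auto simp: ip_simps power2_eq_square)
    finally show ?thesis .
  qed
  show "ip p p = (\<Sum>i\<in>F. (ip x (e i))\<^sup>2)" by (fact pp)
  show "ip (x - p) (x - p) = ip x x - (\<Sum>i\<in>F. (ip x (e i))\<^sup>2)"
    using pH assms(3) pp xp by (simp add: ip_simps ip_sym[of p x])
  show "j \<in> F \<Longrightarrow> ip p (e j) = ip x (e j)" by (fact pe)
qed

lemma bessel:
  assumes "\<And>i. i \<in> F \<Longrightarrow> e i \<in> H" "finite F" "x \<in> H"
    and "\<And>i j. \<lbrakk>i \<in> F; j \<in> F\<rbrakk> \<Longrightarrow> ip (e i) (e j) = (if i = j then 1 else 0)"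
  shows "(\<Sum>i\<in>F. (ip x (e i))\<^sup>2) \<le> ip x x"
  using orthonormal_residual(1)[OF assms] ip_nonneg[of "x - (\<Sum>i\<in>F. ip x (e i) *\<^sub>R e i)"] assms
  by simp

end

section \<open>Completeness and Parseval's identity\<close>

locale hilbert_space = inner_space +
  assumes complete: "\<lbrakk>\<And>n. x n \<in> H; \<And>\<epsilon>. \<epsilon> > 0 \<Longrightarrow> \<exists>N. \<forall>m\<ge>N. \<forall>n\<ge>N. nrm (x m - x n) < \<epsilon>\<rbrakk> \<Longrightarrow> \<exists>g\<in>H. tends x g"
begin

text \<open>By Bessel the partial Fourier sums of \<open>x\<close> are Cauchy. Their limit has the
  same coefficients as \<open>x\<close>, so totality of the family identifies it with
  \<open>x\<close>, and continuity of \<open>ip\<close> in its first argument gives the bilinear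
  identity.\<close>

lemma parseval:
  fixes e :: "nat \<Rightarrow> 'a"
  assumes e: "\<And>i. e i \<in> H" and on: "\<And>i j. ip (e i) (e j) = (if i = j then 1 else 0)"
    and max: "\<And>x. \<lbrakk>x \<in> H; \<And>i. ip x (e i) = 0\<rbrakk> \<Longrightarrow> x = 0"
    and x: "x \<in> H" and y: "y \<in> H"
  shows "(\<lambda>i. ip x (e i) * ip y (e i)) sums ip x y"
proof -
  define p where "p n = (\<Sum>i<n. ip x (e i) *\<^sub>R e i)" for n
  have pH: "p n \<in> H" for n
    unfolding p_def using e by auto
  have p_e: "ip (p n) (e j) = (if j < n then ip x (e j) else 0)" for n j
  proof -
    have "ip (p n) (e j) = (\<Sum>i<n. ip x (e i) * ip (e i) (e j))"
      unfolding p_def using e by (subst ip_sum_left) (auto simp: ip_simps)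
    also have "\<dots> = (\<Sum>i<n. if i = j then ip x (e i) else 0)"
      using on by (intro sum.cong) auto
    finally show ?thesis by simp
  qed
  have summ: "summable (\<lambda>i. (ip x (e i))\<^sup>2)"
    by (rule summableI_nonneg_bounded[of _ "ip x x"]) (auto intro!: bessel e x on)
  have diff: "(nrm (p n - p m))\<^sup>2 = (\<Sum>i=m..<n. (ip x (e i))\<^sup>2)" if "m \<le> n" for m n
  proof -
    have eq: "p n - p m = (\<Sum>i=m..<n. ip x (e i) *\<^sub>R e i)"
      unfolding p_def using that by (simp add: sum_diff_nat_ivl lessThan_atLeast0)
    have "ip (p n - p m) (p n - p m) = (\<Sum>i=m..<n. (ip x (e i))\<^sup>2)"
      unfolding eq by (rule orthonormal_residual(2)) (use e x on in auto)
    then show ?thesis using pH by (simp add: nrm_square)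
  qed
  have "\<exists>N. \<forall>m\<ge>N. \<forall>n\<ge>N. nrm (p m - p n) < \<epsilon>" if "\<epsilon> > 0" for \<epsilon>
  proof -
    have "\<epsilon>\<^sup>2 > 0" using that by simp
    then obtain N where N: "\<And>m n. m \<ge> N \<Longrightarrow> norm (\<Sum>i=m..<n. (ip x (e i))\<^sup>2) < \<epsilon>\<^sup>2"
      using summ unfolding summable_Cauchy by blast
    have *: "nrm (p n - p m) < \<epsilon>" if "m \<ge> N" "m \<le> n" for m n
    proof -
      have "(nrm (p n - p m))\<^sup>2 < \<epsilon>\<^sup>2"
        using N[OF that(1), of n] diff[OF that(2)] by simp
      then show ?thesis using \<open>\<epsilon> > 0\<close> by (simp add: power2_less_imp_less)
    qed
    have "nrm (p m - p n) < \<epsilon>" if "m \<ge> N" "n \<ge> N" for m n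
      using *[of m n] *[of n m] that nrm_minus_commute[OF pH pH, of m n] by (cases "m \<le> n") auto
    then show ?thesis by blast
  qed
  from complete[OF pH this] obtain g where g: "g \<in> H" "tends p g" by blast
  have "ip g (e j) = ip x (e j)" for j
  proof (rule LIMSEQ_unique)
    show "(\<lambda>n. ip (p n) (e j)) \<longlonglongrightarrow> ip g (e j)"
      by (rule tends_ip) (use g pH e in auto)
    show "(\<lambda>n. ip (p n) (e j)) \<longlonglongrightarrow> ip x (e j)"
      unfolding p_e by (rule tendsto_eventually) (auto simp: eventually_at_top_linorder intro!: exI[of _ "Suc j"])
  qed
  then have "x - g = 0"
    using max[of "x - g"] g x e by (auto simp: ip_simps)
  then have "tends p x" using g by simp
  then have "(\<lambda>n. ip (p n) y) \<longlonglongrightarrow> ip x y"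
    by (intro tends_ip) (use pH x y in auto)
  moreover have "ip (p n) y = (\<Sum>i<n. ip x (e i) * ip y (e i))" for n
    unfolding p_def using e y by (subst ip_sum_left) (auto simp: ip_simps ip_sym[of _ y])
  ultimately show ?thesis
    by (simp add: sums_def)
qed

end

text \<open>Compactness is stated sequentially, on unit vectors, with a limit in the carrier. All
  limits in the spectral argument come from \<open>f_compact\<close>, which is why this extends
  \<open>inner_space\<close> rather than \<open>hilbert_space\<close>.\<close>

locale compact_symmetric = inner_space +
  fixes f :: "'a \<Rightarrow> 'a" and C :: real
  assumes f_closed [simp]: "x \<in> H \<Longrightarrow> f x \<in> H"
    and f_add: "\<lbrakk>x \<in> H; y \<in> H\<rbrakk> \<Longrightarrow> f (x + y) = f x + f y"
    and f_scale: "x \<in> H \<Longrightarrow> f (c *\<^sub>R x) = c *\<^sub>R f x"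
    and f_sym: "\<lbrakk>x \<in> H; y \<in> H\<rbrakk> \<Longrightarrow> ip (f x) y = ip x (f y)"
    and f_bound: "x \<in> H \<Longrightarrow> nrm (f x) \<le> C * nrm x"
    and f_compact: "\<lbrakk>\<And>n. u n \<in> H; \<And>n. ip (u n) (u n) = 1\<rbrakk> \<Longrightarrow>
      \<exists>g\<in>H. \<exists>k. strict_mono (k::nat\<Rightarrow>nat) \<and> tends (\<lambda>n. f (u (k n))) g"
begin

lemma f_diff: "\<lbrakk>x \<in> H; y \<in> H\<rbrakk> \<Longrightarrow> f (x - y) = f x - f y"
  using f_add[of "x - y" y] by simp

lemma tends_f:
  assumes "\<And>n. x n \<in> H" "g \<in> H" "tends x g" shows "tends (\<lambda>n. f (x n)) (f g)"
  unfolding tends_def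
proof (rule Lim_null_comparison)
  show "(\<lambda>n. C * nrm (x n - g)) \<longlonglongrightarrow> 0"
    using tendsto_mult_right_zero assms(3) unfolding tends_def by blast
  show "\<forall>\<^sub>F n in sequentially. norm (nrm (f (x n) - f g)) \<le> C * nrm (x n - g)"
    using f_bound[of "x _ - g"] assms by (auto simp flip: f_diff)
qed

lemma polarization:
  assumes "x \<in> H" "y \<in> H"
  shows "4 * ip (f x) y = ip (f (x + y)) (x + y) - ip (f (x - y)) (x - y)"
proof -
  have "ip (f y) x = ip (f x) y"
    using assms by (metis f_closed f_sym ip_sym)
  then show ?thesis
    using assms by (simp add: f_add f_diff ip_simps)
qed

text \<open>For a symmetric operator the quadratic form controls the operator norm. Polarise at
  \<open>x\<close> and y = f x / m, where the weight 1/m balances the two terms, and apply the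
  parallelogram law.\<close>

lemma norm_on_invariant:
  assumes S: "subspace S" "S \<subseteq> H" "\<And>x. x \<in> S \<Longrightarrow> f x \<in> S" and "m > 0"
    and q: "\<And>x. x \<in> S \<Longrightarrow> \<bar>ip (f x) x\<bar> \<le> m * ip x x"
    and x: "x \<in> S"
  shows "ip (f x) (f x) \<le> m\<^sup>2 * ip x x"
proof -
  let ?y = "(1/m) *\<^sub>R f x"
  have H: "x \<in> H" "f x \<in> H" using assms by auto
  have mem: "?y \<in> S" "x + ?y \<in> S" "x - ?y \<in> S"
    using assms by (auto intro!: subspace_add subspace_diff subspace_scale)
  have "4 * ip (f x) ?y \<le> m * ip (x + ?y) (x + ?y) + m * ip (x - ?y) (x - ?y)"
    using polarization[of x ?y] q[OF mem(2)] q[OF mem(3)] H by fastforce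
  also have "\<dots> = 2 * m * ip x x + 2 / m * ip (f x) (f x)"
    using H \<open>m > 0\<close> by (simp add: ip_simps field_simps)
  finally have "2 / m * ip (f x) (f x) \<le> 2 * m * ip x x"
    using H by (simp add: ip_simps)
  then show ?thesis
    using \<open>m > 0\<close> by (simp add: field_simps power2_eq_square)
qed

text \<open>Let m be the supremum of |ip (f x) x| over the unit vectors of \<open>S\<close>. Along a
  maximising sequence z n, whose values converge to some \<mu> with |\<mu>| = m, the residual f (z
  n) - \<mu> z n tends to 0. Since f (z n) converges along a subsequence, so does z n when m > 0,
  and its limit is a unit eigenvector in \<open>S\<close>.\<close>

lemma eigenvector_in_invariant:
  assumes S: "subspace S" "S \<subseteq> H" "\<And>x. x \<in> S \<Longrightarrow> f x \<in> S"
    and cl: "\<And>x g. \<lbrakk>\<And>n. x n \<in> S; g \<in> H; tends x g\<rbrakk> \<Longrightarrow> g \<in> S"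
    and ne: "\<exists>x\<in>S. x \<noteq> 0"
  shows "\<exists>x\<in>S. ip x x = 1 \<and> (\<exists>\<mu>. f x = \<mu> *\<^sub>R x)"
proof -
  have SH: "x \<in> H" if "x \<in> S" for x using that S by auto
  have normalize: "\<exists>c. ip (c *\<^sub>R x) (c *\<^sub>R x) = 1" if "x \<in> S" "x \<noteq> 0" for x
  proof -
    have "nrm x > 0"
      using that SH nrm_eq_0[of x] nrm_nonneg[of x] by fastforce
    then have "ip ((1 / nrm x) *\<^sub>R x) ((1 / nrm x) *\<^sub>R x) = 1"
      using SH[OF that(1)] nrm_square[of x, symmetric] by (simp add: ip_simps power2_eq_square)
    then show ?thesis by blast
  qed
  define Q where "Q = (\<lambda>x. \<bar>ip (f x) x\<bar>) ` {x\<in>S. ip x x = 1}"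
  have QC: "q \<le> C" if "q \<in> Q" for q
  proof -
    from that obtain x where x: "x \<in> S" "ip x x = 1" "q = \<bar>ip (f x) x\<bar>" by (auto simp: Q_def)
    have "q \<le> nrm (f x) * nrm x"
      using cauchy_schwarz[of "f x" x] x SH by simp
    also have "\<dots> \<le> C" using f_bound[of x] x SH by (simp add: nrm_def)
    finally show ?thesis .
  qed
  then have bdd: "bdd_above Q" by (rule bdd_aboveI)
  obtain x0 where x0: "x0 \<in> S" "ip x0 x0 = 1"
    using ne normalize subspace_scale[OF S(1)] by meson
  then have Qne: "Q \<noteq> {}" by (auto simp: Q_def)
  define m where "m = Sup Q"
  have m_ge: "\<bar>ip (f x) x\<bar> \<le> m" if "x \<in> S" "ip x x = 1" for x
    unfolding m_def using that by (intro cSup_upper bdd) (auto simp: Q_def)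
  have m0: "m \<ge> 0" using m_ge[OF x0] by linarith
  have q: "\<bar>ip (f x) x\<bar> \<le> m * ip x x" if x: "x \<in> S" for x
  proof (cases "x = 0")
    case False
    obtain c where c: "ip (c *\<^sub>R x) (c *\<^sub>R x) = 1" using normalize[OF x False] by blast
    have "\<bar>ip (f (c *\<^sub>R x)) (c *\<^sub>R x)\<bar> \<le> m"
      using c x S by (intro m_ge) (auto intro: subspace_scale)
    then have "c\<^sup>2 * \<bar>ip (f x) x\<bar> \<le> m"
      using SH[OF x] by (simp add: f_scale ip_simps abs_mult power2_eq_square mult.assoc)
    also have "m = c\<^sup>2 * (m * ip x x)"
      using c SH[OF x] by (simp add: ip_simps power2_eq_square algebra_simps)
    finally show ?thesis
      using c SH[OF x] by (cases "c = 0") auto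
  qed (use SH[OF x] in auto)
  show ?thesis
  proof (cases "m = 0")
    \<comment> \<open>Here the quadratic form vanishes on \<open>S\<close>, so polarisation makes f
      x0 orthogonal to itself: every unit vector is an eigenvector for 0.\<close>
    case True
    have "ip (f x0) (f x0) = 0"
    proof -
      have "x0 + f x0 \<in> S" "x0 - f x0 \<in> S" using S x0 by (auto intro: subspace_add subspace_diff)
      then show ?thesis
        using polarization[of x0 "f x0"] q[of "x0 + f x0"] q[of "x0 - f x0"] x0 SH True by auto
    qed
    then have "f x0 = 0 *\<^sub>R x0" using x0 SH by (auto intro: ip_definite)
    then show ?thesis using x0 by blast
  next
    case False
    then have "m > 0" using m0 by simp
    have "\<exists>x. x \<in> S \<and> ip x x = 1 \<and> \<bar>ip (f x) x\<bar> > m - 1 / Suc n" for n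
    proof -
      have "m - 1 / Suc n < Sup Q" by (simp add: m_def)
      then obtain a where "a \<in> Q" "m - 1 / Suc n < a" using less_cSupE[OF _ Qne] by blast
      then show ?thesis by (auto simp: Q_def)
    qed
    then have "\<exists>x. \<forall>n. x n \<in> S \<and> ip (x n) (x n) = 1 \<and> \<bar>ip (f (x n)) (x n)\<bar> > m - 1 / Suc n"
      by (intro choice allI)
    then obtain x where x: "\<And>n. x n \<in> S" "\<And>n. ip (x n) (x n) = 1"
      and xm: "\<And>n. \<bar>ip (f (x n)) (x n)\<bar> > m - 1 / Suc n" by auto
    obtain g k where k: "g \<in> H" "strict_mono k" "tends (\<lambda>n. f (x (k n))) g"
      using f_compact[of x, OF SH[OF x(1)] x(2)] by auto
    define r where "r n = ip (f (x (k n))) (x (k n))" for n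
    have "\<bar>r n\<bar> \<le> m" for n
      unfolding r_def using m_ge[OF x(1,2)] .
    then have "bounded (range r)"
      unfolding bounded_iff by auto
    from bounded_imp_convergent_subsequence[OF this] obtain \<mu> l
      where l: "strict_mono l" "(r \<circ> l) \<longlonglongrightarrow> \<mu>" by metis
    define z where "z n = x (k (l n))" for n
    have z: "z n \<in> S" "z n \<in> H" "ip (z n) (z n) = 1" for n using x SH by (auto simp: z_def)
    have lim: "(\<lambda>n. ip (f (z n)) (z n)) \<longlonglongrightarrow> \<mu>" using l(2) by (simp add: z_def r_def o_def)
    have fz: "tends (\<lambda>n. f (z n)) g"
      using LIMSEQ_subseq_LIMSEQ[OF k(3)[unfolded tends_def] l(1)] by (simp add: tends_def z_def o_def)
    have "\<bar>\<mu>\<bar> = m"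
    proof (rule LIMSEQ_unique)
      show "(\<lambda>n. \<bar>ip (f (z n)) (z n)\<bar>) \<longlonglongrightarrow> \<bar>\<mu>\<bar>" by (intro tendsto_intros lim)
      have "(\<lambda>n. m - 1 / Suc n) \<longlonglongrightarrow> m - 0"
        by (intro tendsto_intros LIMSEQ_Suc[OF lim_1_over_n])
      then have "(\<lambda>n. m - 1 / Suc n) \<longlonglongrightarrow> m" by simp
      from LIMSEQ_subseq_LIMSEQ[OF this strict_mono_o[OF k(2) l(1)]]
      have lm: "(\<lambda>n. m - 1 / Suc (k (l n))) \<longlonglongrightarrow> m" by (simp add: o_def)
      have lb: "\<forall>n. m - 1 / Suc (k (l n)) \<le> \<bar>ip (f (z n)) (z n)\<bar>"
        using xm by (auto simp: z_def less_imp_le)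
      have ub: "\<forall>n. \<bar>ip (f (z n)) (z n)\<bar> \<le> m"
        using m_ge[OF z(1,3)] by blast
      show "(\<lambda>n. \<bar>ip (f (z n)) (z n)\<bar>) \<longlonglongrightarrow> m"
        by (rule real_tendsto_sandwich[OF always_eventually[OF lb] always_eventually[OF ub] lm tendsto_const])
    qed
    then have \<mu>: "\<mu>\<^sup>2 = m\<^sup>2" "\<mu> \<noteq> 0" using \<open>m > 0\<close> by (auto simp: power2_eq_iff)
    \<comment> \<open>Expanding the square, the norm of f (z n) is at most m by
      \<open>norm_on_invariant\<close>, and the resulting upper bound tends to m^2 - 2 \<mu>^2 +
      \<mu>^2 = 0.\<close>
    have "(\<lambda>n. (nrm (f (z n) - \<mu> *\<^sub>R z n))\<^sup>2) \<longlonglongrightarrow> 0"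
    proof (rule Lim_null_comparison)
      have "(\<lambda>n. m\<^sup>2 - 2 * \<mu> * ip (f (z n)) (z n) + \<mu>\<^sup>2) \<longlonglongrightarrow> m\<^sup>2 - 2 * \<mu> * \<mu> + \<mu>\<^sup>2"
        by (intro tendsto_intros lim)
      also have "m\<^sup>2 - 2 * \<mu> * \<mu> + \<mu>\<^sup>2 = 0" using \<mu>(1) by (simp add: power2_eq_square)
      finally show "(\<lambda>n. m\<^sup>2 - 2 * \<mu> * ip (f (z n)) (z n) + \<mu>\<^sup>2) \<longlonglongrightarrow> 0" .
      have "(nrm (f (z n) - \<mu> *\<^sub>R z n))\<^sup>2 \<le> m\<^sup>2 - 2 * \<mu> * ip (f (z n)) (z n) + \<mu>\<^sup>2" for n
      proof -
        have "ip (f (z n)) (f (z n)) \<le> m\<^sup>2"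
          using norm_on_invariant[OF S \<open>m > 0\<close> q z(1)] z by simp
        then show ?thesis
          using z by (subst nrm_square) (auto simp: ip_simps ip_sym[of "z n" "f (z n)"] power2_eq_square algebra_simps)
      qed
      then show "\<forall>\<^sub>F n in sequentially. norm ((nrm (f (z n) - \<mu> *\<^sub>R z n))\<^sup>2) \<le> m\<^sup>2 - 2 * \<mu> * ip (f (z n)) (z n) + \<mu>\<^sup>2"
        by simp
    qed
    then have "(\<lambda>n. sqrt ((nrm (f (z n) - \<mu> *\<^sub>R z n))\<^sup>2)) \<longlonglongrightarrow> sqrt 0"
      by (intro tendsto_intros)
    then have res: "(\<lambda>n. nrm (f (z n) - \<mu> *\<^sub>R z n)) \<longlonglongrightarrow> 0"
      using z by simp
    have "tends (\<lambda>n. \<mu> *\<^sub>R z n) g"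
      unfolding tends_def
    proof (rule Lim_null_comparison)
      have "nrm (\<mu> *\<^sub>R z n - g) \<le> nrm (f (z n) - \<mu> *\<^sub>R z n) + nrm (f (z n) - g)" for n
        using nrm_triangle_diff[of "\<mu> *\<^sub>R z n" "f (z n)" g] nrm_minus_commute[of "\<mu> *\<^sub>R z n" "f (z n)"] z k(1)
        by auto
      then show "\<forall>\<^sub>F n in sequentially. norm (nrm (\<mu> *\<^sub>R z n - g)) \<le> nrm (f (z n) - \<mu> *\<^sub>R z n) + nrm (f (z n) - g)"
        using z k(1) by simp
      show "(\<lambda>n. nrm (f (z n) - \<mu> *\<^sub>R z n) + nrm (f (z n) - g)) \<longlonglongrightarrow> 0"
        using tendsto_add[OF res fz[unfolded tends_def]] by simp
    qed
    from tends_scale[OF _ _ this, of "1 / \<mu>"] have zg: "tends z ((1 / \<mu>) *\<^sub>R g)"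
      using z k(1) \<mu> by simp
    define y where "y = (1 / \<mu>) *\<^sub>R g"
    have yH: "y \<in> H" using k(1) by (auto simp: y_def)
    have yS: "y \<in> S" using cl[of z y] z yH zg by (simp add: y_def)
    have "f y = g"
      using tends_unique[OF _ _ _ tends_f[OF z(2) yH] fz] z yH k(1) zg by (simp add: y_def)
    then have "f y = \<mu> *\<^sub>R y" using \<mu> by (simp add: y_def)
    moreover have "nrm y = 1"
    proof (rule LIMSEQ_unique)
      show "(\<lambda>n. nrm (z n)) \<longlonglongrightarrow> nrm y" using tends_nrm[OF z(2) yH] zg by (simp add: y_def)
      show "(\<lambda>n. nrm (z n)) \<longlonglongrightarrow> 1" using z by (simp add: nrm_def)
    qed
    then have "ip y y = 1" by (simp add: nrm_def)
    ultimately show ?thesis using yS by blast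
  qed
qed

text \<open>Zorn's lemma gives a maximal orthonormal set of eigenvectors. Its orthogonal complement
  is closed, and invariant because \<open>f\<close> is symmetric; a nonzero vector there would
  produce one more eigenvector.\<close>

theorem spectral_theorem:
  "\<exists>B. orthonormal B \<and> (\<forall>b\<in>B. \<exists>\<mu>. f b = \<mu> *\<^sub>R b) \<and> (\<forall>x\<in>H. (\<forall>b\<in>B. ip x b = 0) \<longrightarrow> x = 0)"
proof -
  define \<A> where "\<A> = {B. orthonormal B \<and> (\<forall>b\<in>B. \<exists>\<mu>. f b = \<mu> *\<^sub>R b)}"
  have "\<exists>M\<in>\<A>. \<forall>X\<in>\<A>. M \<subseteq> X \<longrightarrow> X = M"
  proof (rule subset_Zorn_nonempty)
    have "{} \<in> \<A>" by (simp add: \<A>_def orthonormal_def)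
    then show "\<A> \<noteq> {}" by blast
    fix \<C> assume \<C>: "\<C> \<noteq> {}" "subset.chain \<A> \<C>"
    have \<C>A: "orthonormal X" "\<forall>b\<in>X. \<exists>\<mu>. f b = \<mu> *\<^sub>R b" if "X \<in> \<C>" for X
      using \<C>(2) that by (auto simp: subset_chain_def \<A>_def)
    have "ip b c = (if b = c then 1 else 0)" if "b \<in> \<Union>\<C>" "c \<in> \<Union>\<C>" for b c
    proof -
      obtain X Y where XY: "X \<in> \<C>" "Y \<in> \<C>" "b \<in> X" "c \<in> Y" using \<open>b \<in> \<Union>\<C>\<close> \<open>c \<in> \<Union>\<C>\<close> by auto
      then have "X \<subseteq> Y \<or> Y \<subseteq> X" using \<C>(2) by (auto simp: subset_chain_def)
      then obtain Z where "Z \<in> \<C>" "b \<in> Z" "c \<in> Z" using XY by auto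
      then show ?thesis using \<C>A(1)[of Z] by (simp add: orthonormal_def)
    qed
    moreover have "\<Union>\<C> \<subseteq> H"
      using \<C>A(1) by (auto simp: orthonormal_def)
    ultimately have "orthonormal (\<Union>\<C>)" by (simp add: orthonormal_def)
    then show "\<Union>\<C> \<in> \<A>"
      using \<C>A(2) by (auto simp: \<A>_def)
  qed
  then obtain B where B: "orthonormal B" "\<And>b. b \<in> B \<Longrightarrow> \<exists>\<mu>. f b = \<mu> *\<^sub>R b"
    and mx: "\<And>X. X \<in> \<A> \<Longrightarrow> B \<subseteq> X \<Longrightarrow> X = B" by (auto simp: \<A>_def)
  define S where "S = {x\<in>H. \<forall>b\<in>B. ip x b = 0}"
  have BH: "b \<in> H" if "b \<in> B" for b using B(1) that by (auto simp: orthonormal_def)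
  have "x = 0" if "x \<in> S" for x
  proof (rule ccontr)
    assume "x \<noteq> 0"
    have "\<exists>x\<in>S. ip x x = 1 \<and> (\<exists>\<mu>. f x = \<mu> *\<^sub>R x)"
    proof (rule eigenvector_in_invariant)
      show "subspace S"
        unfolding subspace_def S_def using BH by (simp add: ip_add_left ip_scale_left)
      show "S \<subseteq> H" by (auto simp: S_def)
      show "f y \<in> S" if "y \<in> S" for y
      proof -
        have y: "y \<in> H" using that by (simp add: S_def)
        have "ip (f y) b = 0" if b: "b \<in> B" for b
        proof -
          obtain \<mu> where "f b = \<mu> *\<^sub>R b" using B(2)[OF b] by blast
          then show ?thesis using f_sym[OF y BH[OF b]] ip_scale_right[OF BH[OF b] y] b \<open>y \<in> S\<close> by (simp add: S_def)
        qed
        then show ?thesis using y by (simp add: S_def)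
      qed
      show "g \<in> S" if "\<And>n. y n \<in> S" "g \<in> H" "tends y g" for y g
      proof -
        have "ip g b = 0" if b: "b \<in> B" for b
        proof (rule LIMSEQ_unique)
          show "(\<lambda>n. ip (y n) b) \<longlonglongrightarrow> ip g b"
            by (rule tends_ip) (use \<open>\<And>n. y n \<in> S\<close> that BH[OF b] \<open>g \<in> H\<close> \<open>tends y g\<close> in \<open>auto simp: S_def\<close>)
          show "(\<lambda>n. ip (y n) b) \<longlonglongrightarrow> 0"
            using \<open>\<And>n. y n \<in> S\<close> b by (simp add: S_def)
        qed
        then show ?thesis using that by (auto simp: S_def)
      qed
      show "\<exists>x\<in>S. x \<noteq> 0" using \<open>x \<in> S\<close> \<open>x \<noteq> 0\<close> by blast
    qed
    then obtain y \<mu> where y: "y \<in> S" "ip y y = 1" "f y = \<mu> *\<^sub>R y" by blast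
    have yn: "y \<notin> B" using y by (auto simp: S_def)
    have yB: "ip y b = 0 \<and> ip b y = 0" if "b \<in> B" for b
      using y(1) that ip_sym[OF BH[OF that], of y] by (simp add: S_def)
    have "orthonormal (insert y B)"
      unfolding orthonormal_def
    proof (intro conjI ballI)
      show "insert y B \<subseteq> H" using y(1) BH by (auto simp: S_def)
      fix b c assume bc: "b \<in> insert y B" "c \<in> insert y B"
      consider "b = y" "c = y" | "b = y" "c \<in> B" "c \<noteq> y" | "c = y" "b \<in> B" "b \<noteq> y" | "b \<in> B" "c \<in> B"
        using bc yn by auto
      then show "ip b c = (if b = c then 1 else 0)"
      proof cases
        case 4
        then show ?thesis using B(1) by (simp add: orthonormal_def)
      qed (use y(2) yB in auto)
    qed
    then have "insert y B \<in> \<A>"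
      using B(2) y(3) unfolding \<A>_def by blast
    from mx[OF this subset_insertI] show False using yn by blast
  qed
  then have "\<forall>x\<in>H. (\<forall>b\<in>B. ip x b = 0) \<longrightarrow> x = 0" by (simp add: S_def)
  moreover have "\<forall>b\<in>B. \<exists>\<mu>. f b = \<mu> *\<^sub>R b" using B(2) by simp
  ultimately show ?thesis using B(1) by (intro exI[of _ B] conjI)
qed

end

section \<open>Square integrable functions on an interval\<close>

definition L2 :: "real \<Rightarrow> (real \<Rightarrow> 'b::euclidean_space) \<Rightarrow> bool" where
  "L2 t v \<longleftrightarrow> v \<in> borel_measurable (lebesgue_on {0..t}) \<and>
     integrable (lebesgue_on {0..t}) (\<lambda>s. (norm (v s))\<^sup>2)"

lemma L2_measurable: "L2 t v \<Longrightarrow> v \<in> borel_measurable (lebesgue_on {0..t})"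
  by (simp add: L2_def)

lemma L2_inner_integrable:
  assumes "L2 t v" "L2 t w" shows "integrable (lebesgue_on {0..t}) (\<lambda>s. v s \<bullet> w s)"
proof (rule Bochner_Integration.integrable_bound)
  show "integrable (lebesgue_on {0..t}) (\<lambda>s. (norm (v s))\<^sup>2 + (norm (w s))\<^sup>2)"
    using assms by (intro Bochner_Integration.integrable_add) (auto simp: L2_def)
  show "(\<lambda>s. v s \<bullet> w s) \<in> borel_measurable (lebesgue_on {0..t})"
    using assms by (intro borel_measurable_inner) (auto simp: L2_def)
  have "\<bar>v s \<bullet> w s\<bar> \<le> (norm (v s))\<^sup>2 + (norm (w s))\<^sup>2" for s
  proof -
    have "\<bar>v s \<bullet> w s\<bar> \<le> norm (v s) * norm (w s)" by (rule Cauchy_Schwarz_ineq2)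
    also have "\<dots> \<le> 2 * (norm (v s) * norm (w s))" by simp
    also have "\<dots> \<le> (norm (v s))\<^sup>2 + (norm (w s))\<^sup>2"
      using sum_squares_bound[of "norm (v s)" "norm (w s)"] by (simp add: mult.assoc)
    finally show ?thesis .
  qed
  then show "AE s in lebesgue_on {0..t}. norm (v s \<bullet> w s) \<le> norm ((norm (v s))\<^sup>2 + (norm (w s))\<^sup>2)"
    by (intro AE_I2) (auto simp: abs_of_nonneg)
qed

lemma L2_iff_inner: 
  "L2 t v \<longleftrightarrow> v \<in> borel_measurable (lebesgue_on {0..t}) \<and> integrable (lebesgue_on {0..t}) (\<lambda>s. v s \<bullet> v s)"
  by (simp add: L2_def power2_norm_eq_inner)

lemma L2_add: assumes "L2 t v" "L2 t w" shows "L2 t (\<lambda>s. v s + w s)"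
proof -
  have "integrable (lebesgue_on {0..t}) (\<lambda>s. v s \<bullet> v s + 2 * (v s \<bullet> w s) + w s \<bullet> w s)"
    using assms by (intro Bochner_Integration.integrable_add integrable_mult_right L2_inner_integrable)
  moreover have "(\<lambda>s. v s \<bullet> v s + 2 * (v s \<bullet> w s) + w s \<bullet> w s) = (\<lambda>s. (v s + w s) \<bullet> (v s + w s))"
    by (auto simp: inner_add inner_commute)
  ultimately show ?thesis
    using assms by (auto simp: L2_iff_inner)
qed

lemma L2_scale: assumes "L2 t v" shows "L2 t (\<lambda>s. c *\<^sub>R v s)"
  using assms unfolding L2_iff_inner by auto

lemma L2_diff: assumes "L2 t v" "L2 t w" shows "L2 t (\<lambda>s. v s - w s)"
  using L2_add[OF assms(1) L2_scale[OF assms(2), of "-1"]] by simp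

lemma L2_continuous: assumes "continuous_on {0..t} v" shows "L2 t v"
  unfolding L2_def
  using assms by (auto intro!: continuous_imp_integrable_real continuous_intros
      continuous_imp_measurable_on_sets_lebesgue)

lemma L2_const: "L2 t (\<lambda>_. c)"
  by (rule L2_continuous) simp

lemma L2_integrable: assumes "L2 t v" shows "integrable (lebesgue_on {0..t}) v"
proof (rule Bochner_Integration.integrable_bound)
  show "integrable (lebesgue_on {0..t}) (\<lambda>s. 1 + (norm (v s))\<^sup>2)"
    using assms by (intro Bochner_Integration.integrable_add) (auto simp: L2_def)
  have "norm (v s) \<le> 1 + (norm (v s))\<^sup>2" for s
    using sum_squares_bound[of "norm (v s)" 1] by (smt (verit) norm_ge_zero power2_eq_square mult_nonneg_nonneg one_power2)
  then show "AE s in lebesgue_on {0..t}. norm (v s) \<le> norm (1 + (norm (v s))\<^sup>2)"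
    by (intro AE_I2) (auto simp: abs_of_nonneg)
qed (use assms in \<open>simp add: L2_def\<close>)

text \<open>Young's inequality with a free weight \<open>c\<close>. Taking c = (1/2)^k turns fast L2
  decay into summable L1 norms; letting c tend to 0 shows that L2 convergence carries integrals to
  the limit.\<close>

lemma L1_le_L2:
  assumes v: "L2 t v" and c: "c > 0" and t: "t \<ge> 0"
  shows "(LINT s|lebesgue_on {0..t}. norm (v s)) \<le> c * t + (LINT s|lebesgue_on {0..t}. (norm (v s))\<^sup>2) / c"
proof -
  have ptw: "norm (v s) \<le> c + (norm (v s))\<^sup>2 / c" for s
  proof -
    have "2 * norm (v s) * c \<le> (norm (v s))\<^sup>2 + c\<^sup>2" by (rule sum_squares_bound)
    moreover have "0 \<le> norm (v s) * c" using c by simp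
    ultimately have "norm (v s) * c \<le> c * c + (norm (v s))\<^sup>2"
      unfolding power2_eq_square by linarith
    then show ?thesis
      using c by (simp add: field_simps)
  qed
  have int: "integrable (lebesgue_on {0..t}) (\<lambda>s. (norm (v s))\<^sup>2 / c)"
    using v by (auto simp: L2_def)
  have "(LINT s|lebesgue_on {0..t}. norm (v s)) \<le> (LINT s|lebesgue_on {0..t}. c + (norm (v s))\<^sup>2 / c)"
    using L2_integrable[OF v] int ptw by (intro integral_mono Bochner_Integration.integrable_add) auto
  also have "\<dots> = c * t + (LINT s|lebesgue_on {0..t}. (norm (v s))\<^sup>2) / c"
    using int t by (subst Bochner_Integration.integral_add) (auto simp: measure_restrict_space)
  finally show ?thesis .
qed

text \<open>The sum of the norms has finite integral by monotone convergence, hence is finite almost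
  everywhere, and absolute convergence follows pointwise.\<close>

lemma fast_cauchy_AE_convergent:
  fixes w :: "nat \<Rightarrow> real \<Rightarrow> 'b::euclidean_space"
  assumes meas: "\<And>k. integrable (lebesgue_on {0..t}) (w k)"
    and bd: "\<And>k. (LINT s|lebesgue_on {0..t}. norm (w k s)) \<le> b k" and b: "summable b"
  shows "AE s in lebesgue_on {0..t}. summable (\<lambda>k. w k s)"
proof -
  let ?M = "lebesgue_on {0..t}"
  note [measurable] = borel_measurable_integrable[OF meas]
  have b0: "b k \<ge> 0" for k
  proof -
    have "0 \<le> (LINT s|?M. norm (w k s))" by (intro integral_nonneg_AE) auto
    with bd[of k] show ?thesis by linarith
  qed
  have "(\<integral>\<^sup>+s. (\<Sum>k. ennreal (norm (w k s))) \<partial>?M) = (\<Sum>k. \<integral>\<^sup>+s. ennreal (norm (w k s)) \<partial>?M)"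
    by (rule nn_integral_suminf) measurable
  also have "\<dots> = (\<Sum>k. ennreal (LINT s|?M. norm (w k s)))"
    using meas by (intro suminf_cong nn_integral_eq_integral) auto
  also have "\<dots> \<le> (\<Sum>k. ennreal (b k))"
    using bd b0 by (intro suminf_le) (auto intro!: ennreal_leI)
  also have "\<dots> < \<infinity>"
    using b b0 by (simp add: suminf_ennreal2)
  finally have "(\<integral>\<^sup>+s. (\<Sum>k. ennreal (norm (w k s))) \<partial>?M) \<noteq> \<infinity>" by simp
  then have "AE s in ?M. (\<Sum>k. ennreal (norm (w k s))) \<noteq> \<infinity>"
    by (intro nn_integral_PInf_AE) measurable
  then show ?thesis
  proof eventually_elim
    case (elim s)
    then have "summable (\<lambda>k. norm (w k s))"
      by (intro summable_suminf_not_top) auto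
    then show ?case by (rule summable_norm_cancel)
  qed
qed

text \<open>A subsequence with geometrically small increments converges almost everywhere. Fatou's
  lemma along this subsequence transfers the Cauchy estimate of the whole sequence to the
  limit.\<close>

theorem riesz_fischer:
  fixes v :: "nat \<Rightarrow> real \<Rightarrow> 'b::euclidean_space"
  assumes v: "\<And>n. L2 t (v n)" and t: "t \<ge> 0"
    and cauchy: "\<And>\<epsilon>. \<epsilon> > 0 \<Longrightarrow> \<exists>N. \<forall>m\<ge>N. \<forall>n\<ge>N. (LINT s|lebesgue_on {0..t}. (norm (v m s - v n s))\<^sup>2) < \<epsilon>"
  shows "\<exists>g. L2 t g \<and> (\<lambda>n. LINT s|lebesgue_on {0..t}. (norm (v n s - g s))\<^sup>2) \<longlonglongrightarrow> 0"
proof -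
  let ?M = "lebesgue_on {0..t}"
  have "\<forall>k. \<exists>N. \<forall>m\<ge>N. \<forall>n\<ge>N. (LINT s|?M. (norm (v m s - v n s))\<^sup>2) < (1/4)^k"
    using cauchy by simp
  then obtain N where N: "\<And>k m n. \<lbrakk>m \<ge> N k; n \<ge> N k\<rbrakk> \<Longrightarrow> (LINT s|?M. (norm (v m s - v n s))\<^sup>2) < (1/4)^k"
    by metis
  \<comment> \<open>The sum dominates N k and is monotone; the summand k forces r to
    infinity.\<close>
  define r where "r k = (\<Sum>i\<le>k. N i) + k" for k
  have rN: "r k \<ge> N k" for k
    unfolding r_def using member_le_sum[of k "{..k}" N] by simp
  have r_mono: "r k \<le> r (Suc k)" for k by (simp add: r_def)
  have r_ge: "r k \<ge> k" for k by (simp add: r_def)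
  define w where "w k s = v (r (Suc k)) s - v (r k) s" for k s
  have wL2: "L2 t (w k)" for k
    unfolding w_def using v by (intro L2_diff)
  have "AE s in ?M. summable (\<lambda>k. w k s)"
  proof (rule fast_cauchy_AE_convergent)
    show "integrable ?M (w k)" for k by (rule L2_integrable[OF wL2])
    show "(LINT s|?M. norm (w k s)) \<le> (1/2)^k * t + (1/2)^k" for k
    proof -
      have "(LINT s|?M. (norm (w k s))\<^sup>2) \<le> (1/4)^k"
        unfolding w_def using N[of k "r (Suc k)" "r k"] rN[of k] r_mono[of k] by simp
      moreover have "(LINT s|?M. norm (w k s)) \<le> (1/2)^k * t + (LINT s|?M. (norm (w k s))\<^sup>2) / (1/2)^k"
        by (rule L1_le_L2[OF wL2 _ t]) simp
      moreover have "(1/4)^k / (1/2)^k = ((1/2)^k :: real)"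
        by (simp flip: power_divide)
      ultimately show ?thesis
        using divide_right_mono[of "LINT s|?M. (norm (w k s))\<^sup>2" "(1/4)^k" "(1/2)^k"] by fastforce
    qed
    show "summable (\<lambda>k. (1/2)^k * t + (1/2)^k)"
      by (intro summable_add summable_mult2 summable_geometric) auto
  qed
  then have lim: "AE s in ?M. (\<lambda>k. v (r k) s) \<longlonglongrightarrow> lim (\<lambda>k. v (r k) s)"
  proof eventually_elim
    case (elim s)
    have "(\<lambda>n. \<Sum>k<n. w k s) = (\<lambda>n. v (r n) s - v (r 0) s)"
      unfolding w_def by (intro ext sum_lessThan_telescope)
    then have "convergent (\<lambda>n. v (r n) s - v (r 0) s)"
      using elim by (simp add: summable_iff_convergent)
    from convergent_add[OF this convergent_const[of "v (r 0) s"]] have "convergent (\<lambda>k. v (r k) s)"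
      by simp
    then show ?case by (simp add: convergent_LIMSEQ_iff)
  qed
  define g where "g s = lim (\<lambda>k. v (r k) s)" for s
  have vm [measurable]: "v n \<in> borel_measurable ?M" for n by (rule L2_measurable[OF v])
  have gm [measurable]: "g \<in> borel_measurable ?M"
    unfolding g_def by (rule borel_measurable_lim_metric) (rule vm)
  have fatou: "(\<integral>\<^sup>+s. ennreal ((norm (v m s - g s))\<^sup>2) \<partial>?M) \<le> ennreal \<epsilon>"
    if "\<And>n. n \<ge> K \<Longrightarrow> (LINT s|?M. (norm (v m s - v n s))\<^sup>2) \<le> \<epsilon>" for m K \<epsilon>
  proof -
    have "(\<integral>\<^sup>+s. ennreal ((norm (v m s - g s))\<^sup>2) \<partial>?M) 
        = (\<integral>\<^sup>+s. liminf (\<lambda>k. ennreal ((norm (v m s - v (r k) s))\<^sup>2)) \<partial>?M)"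
    proof (rule nn_integral_cong_AE)
      show "AE s in ?M. ennreal ((norm (v m s - g s))\<^sup>2) = liminf (\<lambda>k. ennreal ((norm (v m s - v (r k) s))\<^sup>2))"
        using lim
      proof eventually_elim
        case (elim s)
        have "(\<lambda>k. ennreal ((norm (v m s - v (r k) s))\<^sup>2)) \<longlonglongrightarrow> ennreal ((norm (v m s - g s))\<^sup>2)"
          unfolding g_def by (intro tendsto_intros elim)
        then show ?case by (intro lim_imp_Liminf[symmetric]) auto
      qed
    qed
    also have "\<dots> \<le> liminf (\<lambda>k. \<integral>\<^sup>+s. ennreal ((norm (v m s - v (r k) s))\<^sup>2) \<partial>?M)"
      by (rule nn_integral_liminf) measurable
    also have "\<dots> \<le> ennreal \<epsilon>"
    proof -
      have "(\<integral>\<^sup>+s. ennreal ((norm (v m s - v (r k) s))\<^sup>2) \<partial>?M) \<le> ennreal \<epsilon>" if "k \<ge> K" for k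
      proof -
        have "(\<integral>\<^sup>+s. ennreal ((norm (v m s - v (r k) s))\<^sup>2) \<partial>?M) = ennreal (LINT s|?M. (norm (v m s - v (r k) s))\<^sup>2)"
          using L2_diff[OF v v, of m "r k"] by (intro nn_integral_eq_integral) (auto simp: L2_def)
        also have "\<dots> \<le> ennreal \<epsilon>"
          using that r_ge[of k] by (intro ennreal_leI \<open>\<And>n. n \<ge> K \<Longrightarrow> _\<close>) simp
        finally show ?thesis .
      qed
      then have "\<forall>\<^sub>F k in sequentially. (\<integral>\<^sup>+s. ennreal ((norm (v m s - v (r k) s))\<^sup>2) \<partial>?M) \<le> ennreal \<epsilon>"
        by (auto simp: eventually_at_top_linorder)
      then show ?thesis
        by (intro Liminf_le sequentially_bot)
    qed
    finally show ?thesis .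
  qed
  \<comment> \<open>Fatou against the single function v (N 0) makes the difference square
    integrable, and \<open>g\<close> is then a difference of two such functions.\<close>
  have diffL2: "L2 t (\<lambda>s. v (N 0) s - g s)"
    unfolding L2_def
  proof
    show "(\<lambda>s. v (N 0) s - g s) \<in> borel_measurable ?M" by measurable
    have "(\<integral>\<^sup>+s. ennreal ((norm (v (N 0) s - g s))\<^sup>2) \<partial>?M) \<le> ennreal 1"
      by (rule fatou[of "N 0"]) (use N[of 0 "N 0"] in \<open>simp add: less_imp_le\<close>)
    also have "\<dots> < \<infinity>" by simp
    finally show "integrable ?M (\<lambda>s. (norm (v (N 0) s - g s))\<^sup>2)"
      by (intro integrableI_bounded) auto
  qed
  have gL2: "L2 t g"
    using L2_diff[OF v[of "N 0"] diffL2] by simp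
  have "(\<lambda>n. LINT s|?M. (norm (v n s - g s))\<^sup>2) \<longlonglongrightarrow> 0"
  proof (rule LIMSEQ_I)
    fix \<epsilon> :: real assume "\<epsilon> > 0"
    then obtain K where K: "\<And>m n. \<lbrakk>m \<ge> K; n \<ge> K\<rbrakk> \<Longrightarrow> (LINT s|?M. (norm (v m s - v n s))\<^sup>2) < \<epsilon>/2"
      using cauchy[of "\<epsilon>/2"] by auto
    have "norm ((LINT s|?M. (norm (v n s - g s))\<^sup>2) - 0) < \<epsilon>" if "n \<ge> K" for n
    proof -
      have "ennreal (LINT s|?M. (norm (v n s - g s))\<^sup>2) = (\<integral>\<^sup>+s. ennreal ((norm (v n s - g s))\<^sup>2) \<partial>?M)"
        using L2_diff[OF v gL2, of n] by (intro nn_integral_eq_integral[symmetric]) (auto simp: L2_def)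
      also have "\<dots> \<le> ennreal (\<epsilon>/2)"
        by (rule fatou[of K]) (use K that in \<open>simp add: less_imp_le\<close>)
      finally have "(LINT s|?M. (norm (v n s - g s))\<^sup>2) \<le> \<epsilon>/2"
        using \<open>\<epsilon> > 0\<close> by (subst (asm) ennreal_le_iff) auto
      moreover have "(LINT s|?M. (norm (v n s - g s))\<^sup>2) \<ge> 0" by (intro integral_nonneg_AE) auto
      ultimately show ?thesis using \<open>\<epsilon> > 0\<close> by simp
    qed
    then show "\<exists>no. \<forall>n\<ge>no. norm ((LINT s|?M. (norm (v n s - g s))\<^sup>2) - 0) < \<epsilon>" by blast
  qed
  then show ?thesis using gL2 by blast
qed

text \<open>A dictionary between the Bochner integral of the definitions and the gauge integral, in
  which the fundamental theorem of calculus is applied.\<close>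

lemma integral_ivl_eq:
  fixes v :: "real \<Rightarrow> 'b::euclidean_space"
  assumes "integrable (lebesgue_on {0..t}) v" "s \<le> t"
  shows "integrable (lebesgue_on {0..s}) v" "(LINT r|lebesgue_on {0..s}. v r) = integral {0..s} v"
    "v absolutely_integrable_on {0..s}"
proof -
  have "v absolutely_integrable_on {0..t}"
    using assms(1) by (simp add: set_integrable_def integrable_restrict_space)
  then show abs: "v absolutely_integrable_on {0..s}"
    by (rule set_integrable_subset) (use assms(2) in auto)
  then show int: "integrable (lebesgue_on {0..s}) v"
    by (simp add: set_integrable_def integrable_restrict_space)
  then show "(LINT r|lebesgue_on {0..s}. v r) = integral {0..s} v"
    by (intro lebesgue_integral_eq_integral) auto
qed

text \<open>Half-lines are stable under intersection and generate the Borel sets, so by Dynkin's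
  lemma the integral of \<open>u\<close> vanishes over every Borel set, and then over every Lebesgue
  set.\<close>

lemma integrable_zero_primitive_imp_AE_zero:
  fixes u :: "real \<Rightarrow> 'b::euclidean_space"
  assumes u: "integrable lebesgue u" and zero: "\<And>a. (LINT s:{..a}|lebesgue. u s) = 0"
  shows "AE s in lebesgue. u s = 0"
proof (rule sigma_finite_measure.density_zero[OF _ u])
  have set_int: "set_integrable lebesgue A u" if "A \<in> sets lebesgue" for A
    unfolding set_integrable_def using that u by (rule integrable_mult_indicator)
  have total: "(LINT s|lebesgue. u s) = 0"
  proof (rule LIMSEQ_unique)
    have "(\<lambda>n::nat. LINT s:{..real n}|lebesgue. u s) \<longlonglongrightarrow> (LINT s:(\<Union>n::nat. {..real n})|lebesgue. u s)"
      by (rule set_integral_cont_up) (auto simp: incseq_def intro!: set_int)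
    also have "(\<Union>n::nat. {..real n}) = UNIV" using real_arch_simple by auto
    finally show "(\<lambda>n::nat. LINT s:{..real n}|lebesgue. u s) \<longlonglongrightarrow> (LINT s|lebesgue. u s)"
      by (simp add: set_lebesgue_integral_def)
    show "(\<lambda>n::nat. LINT s:{..real n}|lebesgue. u s) \<longlonglongrightarrow> 0" by (simp add: zero)
  qed
  have bor: "(LINT s:A|lebesgue. u s) = 0" if A: "A \<in> sets borel" for A
  proof -
    have leb: "A \<in> sets lebesgue" if "A \<in> sets borel" for A :: "real set" using that by auto
    have eq: "sets borel = sigma_sets UNIV (range (\<lambda>a::real. {..a}))"
      by (subst borel_eq_atMost) simp
    have sig: "A \<in> sigma_sets UNIV (range (\<lambda>a::real. {..a}))" using A eq by simp
    have stable: "Int_stable (range (\<lambda>a::real. {..a}))"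
      by (auto simp: Int_stable_def intro!: image_eqI[of _ _ "min _ _"])
    show ?thesis
    proof (rule sigma_sets_induct_disjoint[OF stable _ sig, where P = "\<lambda>A. (LINT s:A|lebesgue. u s) = 0"])
      fix A assume "A \<in> sigma_sets UNIV (range (\<lambda>a::real. {..a}))" and 0: "(LINT s:A|lebesgue. u s) = 0"
      then have "A \<in> sets lebesgue" using leb eq by simp
      then have "(LINT s:UNIV - A|lebesgue. u s) + (LINT s:A|lebesgue. u s) = (LINT s:(UNIV - A) \<union> A|lebesgue. u s)"
        by (intro set_integral_Un[symmetric] set_int) auto
      also have "\<dots> = 0" using total by (simp add: set_lebesgue_integral_def)
      finally show "(LINT s:UNIV - A|lebesgue. u s) = 0" using 0 by simp
    next
      fix A :: "nat \<Rightarrow> real set"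
      assume A: "disjoint_family A" "range A \<subseteq> sigma_sets UNIV (range (\<lambda>a::real. {..a}))"
        and 0: "\<And>i. (LINT s:A i|lebesgue. u s) = 0"
      have Al: "A i \<in> sets lebesgue" for i using A(2) leb eq by blast
      then have "(LINT s:(\<Union>i. A i)|lebesgue. u s) = (\<Sum>i. LINT s:A i|lebesgue. u s)"
        using A(1) by (intro lebesgue_integral_countable_add set_int) (auto simp: disjoint_family_on_def)
      then show "(LINT s:(\<Union>i. A i)|lebesgue. u s) = 0" using 0 by simp
    qed (auto simp: zero, simp add: set_lebesgue_integral_def)
  qed
  \<comment> \<open>A Lebesgue set differs from a Borel set by a null set, which does not change the
    integral.\<close>
  fix A :: "real set" assume "A \<in> sets lebesgue"
  then obtain S N N' where *: "A = S \<union> N" "N \<subseteq> N'" "N' \<in> null_sets lborel" "S \<in> sets lborel"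
    by (rule sets_completionE)
  have "(A - S) \<union> (S - A) \<subseteq> N'" using * by auto
  then have "(A - S) \<union> (S - A) \<in> null_sets lebesgue"
    using *(3) by (metis negligible_iff_null_sets negligible_subset null_sets_completionI)
  then have "(LINT s:A|lebesgue. u s) = (LINT s:S|lebesgue. u s)"
    using * \<open>A \<in> sets lebesgue\<close> by (intro set_integral_null_delta u) auto
  then show "(LINT s:A|lebesgue. u s) = 0" using bor * by simp
next
  show "sigma_finite_measure (lebesgue :: real measure)"
  proof
    define A where "A = range (\<lambda>n::nat. cball (0::real) (real n))"
    have "countable A" by (simp add: A_def)
    moreover have "A \<subseteq> sets lebesgue" by (auto simp: A_def)
    moreover have "\<Union>A = space lebesgue"
      unfolding A_def using real_arch_simple by (auto simp: dist_real_def)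
    moreover have "\<forall>a\<in>A. emeasure lebesgue a \<noteq> \<infinity>"
      using emeasure_lborel_cball_finite[of "0::real"] by (auto simp: A_def less_top[symmetric])
    ultimately show "\<exists>A::real set set. countable A \<and> A \<subseteq> sets lebesgue \<and> \<Union>A = space lebesgue \<and> (\<forall>a\<in>A. emeasure lebesgue a \<noteq> \<infinity>)"
      by blast
  qed
qed

text \<open>This makes the weak derivative unique almost everywhere. Extending the difference by 0
  outside the interval reduces every half-line to some interval starting at 0.\<close>

lemma AE_eq_of_primitive_eq:
  fixes v w :: "real \<Rightarrow> 'b::euclidean_space"
  assumes v: "integrable (lebesgue_on {0..t}) v" and w: "integrable (lebesgue_on {0..t}) w"
    and eq: "\<And>s. s \<in> {0..t} \<Longrightarrow> (LINT r|lebesgue_on {0..s}. v r) = (LINT r|lebesgue_on {0..s}. w r)"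
  shows "AE s in lebesgue_on {0..t}. v s = w s"
proof -
  define u where "u s = indicat_real {0..t} s *\<^sub>R (v s - w s)" for s
  have int: "integrable (lebesgue_on {0..t}) (\<lambda>s. v s - w s)"
    using v w by simp
  have "AE s in lebesgue. u s = 0"
  proof (rule integrable_zero_primitive_imp_AE_zero)
    show "integrable lebesgue u"
      using int unfolding u_def by (simp add: integrable_restrict_space)
    fix a
    have "(LINT s:{..a}|lebesgue. u s) = (LINT s|lebesgue. indicat_real {0..min a t} s *\<^sub>R (v s - w s))"
      unfolding set_lebesgue_integral_def u_def
      by (intro Bochner_Integration.integral_cong) (auto simp: indicator_def)
    also have "\<dots> = (LINT s|lebesgue_on {0..min a t}. v s - w s)"
      by (simp add: integral_restrict_space)
    also have "\<dots> = 0"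
    proof (cases "min a t \<ge> 0")
      case True
      then have "(LINT s|lebesgue_on {0..min a t}. v s) = (LINT s|lebesgue_on {0..min a t}. w s)"
        by (intro eq) auto
      then show ?thesis
        using integral_ivl_eq(1)[OF v, of "min a t"] integral_ivl_eq(1)[OF w, of "min a t"] by simp
    next
      case False
      then have e: "{0..min a t} = {}" by simp
      show ?thesis unfolding e by simp
    qed
    finally show "(LINT s:{..a}|lebesgue. u s) = 0" .
  qed
  then have "AE s in lebesgue. s \<in> {0..t} \<longrightarrow> v s = w s"
    by eventually_elim (auto simp: u_def indicator_def split: if_splits)
  then show ?thesis by (simp add: AE_restrict_space_iff)
qed

section \<open>Primitives and integration by parts\<close>

lemma integral_ivl_diff:
  fixes f :: "real \<Rightarrow> 'b::banach"
  assumes "f integrable_on {0..t}" "0 \<le> a" "a \<le> b" "b \<le> t"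
  shows "integral {0..b} f - integral {0..a} f = integral {a..b} f"
  using Henstock_Kurzweil_Integration.integral_combine[of 0 a b f] assms
    integrable_subinterval_real[OF assms(1), of 0 b] by (simp add: algebra_simps)

text \<open>The defect \<open>\<Phi>\<close> of the formula satisfies \<open>|\<Phi> y - \<Phi> x| \<le> C |y - x| |m y - m x|\<close> with \<open>m\<close> the continuous
  primitive of \<open>|v|\<close>, so its derivative vanishes.\<close>

lemma integration_by_parts_L1:
  fixes v g g' \<eta> :: "real \<Rightarrow> 'b::euclidean_space"
  assumes v: "v absolutely_integrable_on {0..t}"
    and \<eta>: "\<And>s. s \<in> {0..t} \<Longrightarrow> \<eta> s = \<eta> 0 + integral {0..s} v"
    and g: "\<And>s. s \<in> {0..t} \<Longrightarrow> (g has_vector_derivative g' s) (at s within {0..t})"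
    and g': "continuous_on {0..t} g'" and b: "b \<in> {0..t}"
  shows "integral {0..b} (\<lambda>s. g s \<bullet> v s) = g b \<bullet> \<eta> b - g 0 \<bullet> \<eta> 0 - integral {0..b} (\<lambda>s. g' s \<bullet> \<eta> s)"
proof -
  have t: "t \<ge> 0" using b by simp
  have vi: "v integrable_on {0..t}" and nvi: "(\<lambda>s. norm (v s)) integrable_on {0..t}"
    using v by (auto simp: absolutely_integrable_on_def)
  have gc: "continuous_on {0..t} g"
    using g by (meson has_vector_derivative_continuous continuous_on_eq_continuous_within)
  have \<eta>c: "continuous_on {0..t} \<eta>"
  proof (rule continuous_on_eq)
    show "continuous_on {0..t} (\<lambda>s. \<eta> 0 + integral {0..s} v)"
      by (rule continuous_on_add[OF continuous_on_const indefinite_integral_continuous_1[OF vi]])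
  qed (rule \<eta>[symmetric])
  obtain K0 where K0: "\<And>s. s \<in> {0..t} \<Longrightarrow> norm (g' s) \<le> K0"
    using compact_imp_bounded[OF compact_continuous_image[OF g' compact_Icc]]
    unfolding bounded_iff by (metis imageI)
  define K where "K = \<bar>K0\<bar>"
  have K: "K \<ge> 0" "\<And>s. s \<in> {0..t} \<Longrightarrow> norm (g' s) \<le> K"
    using K0 by (force simp: K_def)+
  have gv: "(\<lambda>s. g s \<bullet> v s) integrable_on {0..t}"
  proof -
    have "(\<lambda>s. g s \<bullet> v s) absolutely_integrable_on {0..t}"
      by (rule absolutely_integrable_bounded_measurable_product[OF bilinear_conv_bounded_bilinear[THEN iffD2, OF bounded_bilinear_inner] _ _ _ v])
         (auto intro!: continuous_imp_measurable_on_sets_lebesgue gc compact_imp_bounded compact_continuous_image)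
    then show ?thesis by (simp add: absolutely_integrable_on_def)
  qed
  have g\<eta>: "(\<lambda>s. g' s \<bullet> \<eta> s) integrable_on {0..t}"
    by (intro integrable_continuous_real continuous_intros g' \<eta>c)
  define m where "m s = integral {0..s} (\<lambda>s. norm (v s))" for s
  define \<Phi> where "\<Phi> s = integral {0..s} (\<lambda>s. g s \<bullet> v s) + integral {0..s} (\<lambda>s. g' s \<bullet> \<eta> s) - g s \<bullet> \<eta> s" for s
  have est: "norm (\<Phi> d - \<Phi> a) \<le> 2 * K * (d - a) * (m d - m a)" if ad: "0 \<le> a" "a \<le> d" "d \<le> t" for a d
  proof -
    have sub: "{a..d} \<subseteq> {0..t}" using ad by auto
    have vi': "v integrable_on {a..d}" and nvi': "(\<lambda>s. norm (v s)) integrable_on {a..d}"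
      and gv': "(\<lambda>s. g s \<bullet> v s) integrable_on {a..d}" and g\<eta>': "(\<lambda>s. g' s \<bullet> \<eta> s) integrable_on {a..d}"
      using sub integrable_subinterval_real vi nvi gv g\<eta> by blast+
    have g'i: "g' integrable_on {a..d}"
      by (intro integrable_continuous_real continuous_on_subset[OF g' sub])
    have \<eta>diff: "\<eta> r - \<eta> a = integral {a..r} v" if "r \<in> {a..d}" for r
      using \<eta>[of r] \<eta>[of a] integral_ivl_diff[OF vi, of a r] that ad by simp
    have gdiff: "g y - g x = integral {x..y} g'" if "a \<le> x" "x \<le> y" "y \<le> d" for x y
    proof (rule integral_unique[symmetric], rule fundamental_theorem_of_calculus)
      show "(g has_vector_derivative g' s) (at s within {x..y})" if "s \<in> {x..y}" for s
        by (rule has_vector_derivative_within_subset[OF g]) (use that \<open>a \<le> x\<close> \<open>y \<le> d\<close> ad in auto)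
    qed (use that in auto)
    have glip: "norm (g y - g x) \<le> K * (y - x)" if "a \<le> x" "x \<le> y" "y \<le> d" for x y
    proof -
      have "norm (integral {x..y} g') \<le> integral {x..y} (\<lambda>_. K)"
        using that ad by (intro Henstock_Kurzweil_Integration.integral_norm_bound_integral
            integrable_continuous_real continuous_on_subset[OF g'] K) auto
      then show ?thesis using gdiff[OF that] that by (simp add: mult.commute)
    qed
    have \<eta>lip: "norm (\<eta> r - \<eta> a) \<le> m d - m a" if r: "r \<in> {a..d}" for r
    proof -
      have "norm (integral {a..r} v) \<le> integral {a..r} (\<lambda>s. norm (v s))"
        using r ad by (intro Henstock_Kurzweil_Integration.integral_norm_bound_integral
            integrable_subinterval_real[OF vi] integrable_subinterval_real[OF nvi]) auto
      also have "\<dots> \<le> integral {a..d} (\<lambda>s. norm (v s))"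
        using r ad by (intro integral_subset_le integrable_subinterval_real[OF nvi]) auto
      also have "\<dots> = m d - m a"
        unfolding m_def using integral_ivl_diff[OF nvi, of a d] ad by simp
      finally show ?thesis using \<eta>diff[OF r] by simp
    qed
    \<comment> \<open>A discrete product rule, with \<open>g\<close> frozen at d and \<eta> frozen
      at a. Both increments are integrals, so \<Phi> d - \<Phi> a retains only the errors of
      freezing, each a product of two small quantities.\<close>
    have "g d \<bullet> \<eta> d - g a \<bullet> \<eta> a = g d \<bullet> (\<eta> d - \<eta> a) + (g d - g a) \<bullet> \<eta> a"
      by (simp add: inner_diff)
    also have "\<dots> = integral {a..d} (\<lambda>s. g d \<bullet> v s) + integral {a..d} (\<lambda>s. g' s \<bullet> \<eta> a)"
      using \<eta>diff[of d] gdiff[of a d] ad vi' g'i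
      by (simp add: integral_linear[OF vi' bounded_linear_inner_right, unfolded o_def]
          integral_linear[OF g'i bounded_linear_inner_left, unfolded o_def])
    finally have e1: "g d \<bullet> \<eta> d - g a \<bullet> \<eta> a = integral {a..d} (\<lambda>s. g d \<bullet> v s) + integral {a..d} (\<lambda>s. g' s \<bullet> \<eta> a)" .
    have gdi: "(\<lambda>s. g d \<bullet> v s) integrable_on {a..d}" "(\<lambda>s. g' s \<bullet> \<eta> a) integrable_on {a..d}"
      using integrable_linear[OF vi' bounded_linear_inner_right] integrable_linear[OF g'i bounded_linear_inner_left]
      by (auto simp: o_def)
    have "\<Phi> d - \<Phi> a = (integral {a..d} (\<lambda>s. g s \<bullet> v s) - integral {a..d} (\<lambda>s. g d \<bullet> v s))
        + (integral {a..d} (\<lambda>s. g' s \<bullet> \<eta> s) - integral {a..d} (\<lambda>s. g' s \<bullet> \<eta> a))"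
      unfolding \<Phi>_def using e1 integral_ivl_diff[OF gv, of a d] integral_ivl_diff[OF g\<eta>, of a d] ad by simp
    also have "\<dots> = integral {a..d} (\<lambda>s. (g s - g d) \<bullet> v s) + integral {a..d} (\<lambda>s. g' s \<bullet> (\<eta> s - \<eta> a))"
      using gv' gdi g\<eta>' by (simp add: inner_diff Henstock_Kurzweil_Integration.integral_diff)
    finally have e2: "\<Phi> d - \<Phi> a = integral {a..d} (\<lambda>s. (g s - g d) \<bullet> v s) + integral {a..d} (\<lambda>s. g' s \<bullet> (\<eta> s - \<eta> a))" .
    have "norm (integral {a..d} (\<lambda>s. (g s - g d) \<bullet> v s)) \<le> integral {a..d} (\<lambda>s. K * (d - a) * norm (v s))"
    proof (rule Henstock_Kurzweil_Integration.integral_norm_bound_integral)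
      show "(\<lambda>s. (g s - g d) \<bullet> v s) integrable_on {a..d}"
        using integrable_diff[OF gv' gdi(1)] by (simp add: inner_diff)
      show "(\<lambda>s. K * (d - a) * norm (v s)) integrable_on {a..d}"
        using integrable_on_mult_right[OF nvi'] by simp
      fix s assume s: "s \<in> {a..d}"
      have "norm ((g s - g d) \<bullet> v s) \<le> norm (g s - g d) * norm (v s)"
        using Cauchy_Schwarz_ineq2 by simp
      also have "\<dots> \<le> (K * (d - s)) * norm (v s)"
        using glip[of s d] s by (intro mult_right_mono) (auto simp: norm_minus_commute)
      also have "\<dots> \<le> (K * (d - a)) * norm (v s)"
        using s K by (intro mult_right_mono mult_left_mono) auto
      finally show "norm ((g s - g d) \<bullet> v s) \<le> K * (d - a) * norm (v s)" .
    qed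
    also have "\<dots> = K * (d - a) * (m d - m a)"
      unfolding m_def using integral_ivl_diff[OF nvi, of a d] ad by simp
    finally have b1: "norm (integral {a..d} (\<lambda>s. (g s - g d) \<bullet> v s)) \<le> K * (d - a) * (m d - m a)" .
    have "norm (integral {a..d} (\<lambda>s. g' s \<bullet> (\<eta> s - \<eta> a))) \<le> integral {a..d} (\<lambda>s. K * (m d - m a))"
    proof (rule Henstock_Kurzweil_Integration.integral_norm_bound_integral)
      show "(\<lambda>s. g' s \<bullet> (\<eta> s - \<eta> a)) integrable_on {a..d}"
        using integrable_diff[OF g\<eta>' gdi(2)] by (simp add: inner_diff)
      fix s assume s: "s \<in> {a..d}"
      have "norm (g' s \<bullet> (\<eta> s - \<eta> a)) \<le> norm (g' s) * norm (\<eta> s - \<eta> a)"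
        using Cauchy_Schwarz_ineq2 by simp
      also have "\<dots> \<le> K * (m d - m a)"
        using \<eta>lip[OF s] K s sub by (intro mult_mono) auto
      finally show "norm (g' s \<bullet> (\<eta> s - \<eta> a)) \<le> K * (m d - m a)" .
    qed (rule integrable_continuous_real, simp)
    then have b2: "norm (integral {a..d} (\<lambda>s. g' s \<bullet> (\<eta> s - \<eta> a))) \<le> K * (d - a) * (m d - m a)"
      using ad by (simp add: algebra_simps)
    show ?thesis
      unfolding e2 by (rule norm_triangle_le) (use b1 b2 in linarith)
  qed
  have est': "norm (\<Phi> y - \<Phi> x) \<le> 2 * K * \<bar>y - x\<bar> * \<bar>m y - m x\<bar>" if "x \<in> {0..t}" "y \<in> {0..t}" for x y
  proof (cases "x \<le> y")
    case True
    have "norm (\<Phi> y - \<Phi> x) \<le> 2 * K * (y - x) * (m y - m x)" using est[of x y] True that by auto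
    also have "\<dots> \<le> 2 * K * \<bar>y - x\<bar> * \<bar>m y - m x\<bar>"
      using mult_left_mono[of "m y - m x" "\<bar>m y - m x\<bar>" "2 * K * (y - x)"] True K by simp
    finally show ?thesis .
  next
    case False
    have "norm (\<Phi> x - \<Phi> y) \<le> 2 * K * (x - y) * (m x - m y)" using est[of y x] False that by auto
    also have "\<dots> \<le> 2 * K * \<bar>y - x\<bar> * \<bar>m y - m x\<bar>"
      using mult_left_mono[of "m x - m y" "\<bar>m y - m x\<bar>" "2 * K * (x - y)"] False K by simp
    finally show ?thesis by (simp add: norm_minus_commute)
  qed
  have mc: "continuous_on {0..t} m"
    unfolding m_def by (intro indefinite_integral_continuous_1 nvi)
  have "(\<Phi> has_derivative (\<lambda>h. 0)) (at x within {0..t})" if x: "x \<in> {0..t}" for x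
    unfolding has_derivative_within
  proof (intro conjI, simp, rule Lim_null_comparison)
    show "\<forall>\<^sub>F y in at x within {0..t}. norm ((1 / norm (y - x)) *\<^sub>R (\<Phi> y - (\<Phi> x + 0))) \<le> 2 * K * \<bar>m y - m x\<bar>"
      unfolding eventually_at_filter
    proof (intro always_eventually allI impI)
      fix y assume y: "y \<noteq> x" "y \<in> {0..t}"
      then show "norm ((1 / norm (y - x)) *\<^sub>R (\<Phi> y - (\<Phi> x + 0))) \<le> 2 * K * \<bar>m y - m x\<bar>"
        using est'[OF x y(2)] by (simp add: divide_simps mult_ac)
    qed
    have "(m \<longlongrightarrow> m x) (at x within {0..t})"
      using mc x by (auto simp: continuous_on_def)
    then have "((\<lambda>y. 2 * K * \<bar>m y - m x\<bar>) \<longlongrightarrow> 2 * K * \<bar>m x - m x\<bar>) (at x within {0..t})"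
      by (intro tendsto_intros)
    then show "((\<lambda>y. 2 * K * \<bar>m y - m x\<bar>) \<longlongrightarrow> 0) (at x within {0..t})" by simp
  qed
  from has_derivative_zero_constant[OF _ this] obtain c where "\<And>x. x \<in> {0..t} \<Longrightarrow> \<Phi> x = c" by auto
  then have "\<Phi> b = \<Phi> 0" using b t by auto
  then show ?thesis by (simp add: \<Phi>_def)
qed

text \<open>The primitive from 0 in both directions. Working on the whole line keeps derivatives
  two-sided and allows the coefficient of an equation to be shifted and reflected.\<close>

definition prim :: "(real \<Rightarrow> 'b::euclidean_space) \<Rightarrow> real \<Rightarrow> 'b" where
  "prim p s = (if 0 \<le> s then integral {0..s} p else - integral {s..0} p)"

lemma prim_eq:
  assumes "continuous_on UNIV p" "0 \<le> R" "\<bar>s\<bar> \<le> R"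
  shows "prim p s = integral {-R..s} p - integral {-R..0} p"
proof -
  have int: "p integrable_on {a..b}" for a b
    by (intro integrable_continuous_real continuous_on_subset[OF assms(1)]) auto
  show ?thesis
    using Henstock_Kurzweil_Integration.integral_combine[OF _ _ int[of "-R" s], of 0] Henstock_Kurzweil_Integration.integral_combine[OF _ _ int[of "-R" 0], of s] assms
    by (auto simp: prim_def algebra_simps)
qed

lemma prim_0 [simp]: "prim p 0 = 0"
  by (simp add: prim_def)

lemma has_vector_derivative_prim:
  assumes "continuous_on UNIV p"
  shows "(prim p has_vector_derivative p s) (at s)"
proof -
  define R where "R = \<bar>s\<bar> + 1"
  have "((\<lambda>u. integral {-R..u} p - integral {-R..0} p) has_vector_derivative p s) (at s within {-R..R})"
    by (rule derivative_eq_intros integral_has_vector_derivative continuous_on_subset[OF assms])+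
       (auto simp: R_def)
  then have "((\<lambda>u. integral {-R..u} p - integral {-R..0} p) has_vector_derivative p s) (at s)"
    by (subst (asm) at_within_interior) (auto simp: R_def)
  then show ?thesis
  proof (rule has_vector_derivative_transform_within_open[of _ _ _ "{-R<..<R}"])
    show "integral {-R..u} p - integral {-R..0} p = prim p u" if "u \<in> {-R<..<R}" for u
      using that by (intro prim_eq[OF assms, symmetric]) (auto simp: R_def)
  qed (auto simp: R_def)
qed

lemma continuous_on_prim: "continuous_on UNIV p \<Longrightarrow> continuous_on S (prim p)"
  by (meson continuous_at_imp_continuous_on has_vector_derivative_continuous has_vector_derivative_prim)

lemma norm_prim_le_pos:
  fixes p :: "real \<Rightarrow> 'b::euclidean_space"
  assumes p: "continuous_on UNIV p" and R: "0 \<le> s" "s \<le> R"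
    and bd: "\<And>r. \<bar>r\<bar> \<le> R \<Longrightarrow> norm (p r) \<le> c * \<bar>r\<bar> ^ k"
  shows "norm (integral {0..s} p) \<le> c * s ^ Suc k / Suc k"
proof -
  have int: "p integrable_on {0..s}"
    by (intro integrable_continuous_real continuous_on_subset[OF p]) auto
  have "((\<lambda>r. c * r ^ Suc k / Suc k) has_real_derivative c * r ^ k) (at r within {0..s})" for r
    by (rule derivative_eq_intros refl | simp del: power_Suc)+
  then have "((\<lambda>r. c * r ^ k) has_integral (c * s ^ Suc k / Suc k - c * 0 ^ Suc k / Suc k)) {0..s}"
    using R by (intro fundamental_theorem_of_calculus)
      (auto simp: has_real_derivative_iff_has_vector_derivative simp del: power_Suc)
  then have i: "((\<lambda>r. c * r ^ k) has_integral (c * s ^ Suc k / Suc k)) {0..s}" by simp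
  have "norm (integral {0..s} p) \<le> integral {0..s} (\<lambda>r. c * r ^ k)"
    using i bd R by (intro Henstock_Kurzweil_Integration.integral_norm_bound_integral int)
      (auto simp: abs_of_nonneg intro!: order_trans[OF bd])
  then show ?thesis using integral_unique[OF i] by simp
qed

text \<open>Each primitive gains a factor |s| / (k + 1); iterated, this is the origin of the
  factorial in \<open>pic_bound\<close>. Negative arguments are reduced to positive ones by
  reflection.\<close>

lemma norm_prim_le:
  assumes p: "continuous_on UNIV p" and R: "\<bar>s\<bar> \<le> R"
    and bd: "\<And>r. \<bar>r\<bar> \<le> R \<Longrightarrow> norm (p r) \<le> c * \<bar>r\<bar> ^ k"
  shows "norm (prim p s) \<le> c * \<bar>s\<bar> ^ Suc k / Suc k"
proof (cases "s \<ge> 0")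
  case True
  then show ?thesis
    using norm_prim_le_pos[OF p _ _ bd, of s R] R by (simp add: prim_def)
next
  case False
  have "continuous_on UNIV (\<lambda>r. p (- r))"
    by (intro continuous_on_compose2[OF p] continuous_intros) auto
  then have "norm (integral {0..-s} (\<lambda>r. p (- r))) \<le> c * (-s) ^ Suc k / Suc k"
    by (rule norm_prim_le_pos[of _ _ R]) (use False R bd[of "- _"] in auto)
  moreover have "integral {s..0} p = integral {0..-s} (\<lambda>r. p (- r))"
    using Henstock_Kurzweil_Integration.integral_reflect_real[of 0 s p, symmetric] unfolding minus_zero .
  ultimately show ?thesis using False by (simp add: prim_def)
qed

section \<open>The path space as a Hilbert space\<close>

lemma has_L2_derivative_iff:
  "has_L2_derivative t \<xi> v \<longleftrightarrow> L2 t v \<and> (\<forall>s\<in>{0..t}. \<xi> s = \<xi> 0 + integral {0..s} v)"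
proof (cases "L2 t v")
  case True
  have eq: "(LINT r|lebesgue_on {0..s}. v r) = integral {0..s} v" if "s \<in> {0..t}" for s
    using integral_ivl_eq(2)[OF L2_integrable[OF True]] that by simp
  have "(\<forall>s\<in>{0..t}. \<xi> s = \<xi> 0 + (LINT r|lebesgue_on {0..s}. v r)) \<longleftrightarrow> (\<forall>s\<in>{0..t}. \<xi> s = \<xi> 0 + integral {0..s} v)"
    by (rule ball_cong[OF refl]) (simp only: eq)
  then show ?thesis
    using True unfolding has_L2_derivative_def L2_def by simp
qed (auto simp: has_L2_derivative_def L2_def)

lemma has_L2_derivativeD:
  assumes "has_L2_derivative t \<xi> v"
  shows "L2 t v" "s \<in> {0..t} \<Longrightarrow> \<xi> s = \<xi> 0 + integral {0..s} v"
    "s \<in> {0..t} \<Longrightarrow> \<xi> s = \<xi> 0 + (LINT r|lebesgue_on {0..s}. v r)"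
  using assms unfolding has_L2_derivative_iff apply blast
  using assms unfolding has_L2_derivative_iff apply blast
  using assms unfolding has_L2_derivative_def by blast

lemma continuous_on_of_derivative:
  assumes "\<And>x. x \<in> S \<Longrightarrow> (f has_vector_derivative f' x) (at x within S)"
  shows "continuous_on S f"
  unfolding continuous_on_eq_continuous_within
  by (intro ballI) (rule has_vector_derivative_continuous[OF assms])

lemma L2_integrable_on:
  assumes "L2 t v" "s \<le> t" shows "v integrable_on {0..s}" "v absolutely_integrable_on {0..s}"
proof -
  show "v absolutely_integrable_on {0..s}"
    by (rule integral_ivl_eq(3)[OF L2_integrable[OF assms(1)] assms(2)])
  then show "v integrable_on {0..s}"
    unfolding absolutely_integrable_on_def by (rule conjunct1)
qed

lemma LINT_eq_integral:
  fixes f :: "real \<Rightarrow> 'b::euclidean_space"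
  assumes "integrable (lebesgue_on {0..t}) f" shows "(LINT s|lebesgue_on {0..t}. f s) = integral {0..t} f"
  using integral_ivl_eq(2)[OF assms order_refl] .

lemma has_L2_derivative_AE_unique:
  assumes "has_L2_derivative t \<xi> v" "has_L2_derivative t \<xi> w"
  shows "AE s in lebesgue_on {0..t}. v s = w s"
proof (rule AE_eq_of_primitive_eq)
  show "integrable (lebesgue_on {0..t}) v" "integrable (lebesgue_on {0..t}) w"
    by (rule L2_integrable[OF has_L2_derivativeD(1)[OF assms(1)]], rule L2_integrable[OF has_L2_derivativeD(1)[OF assms(2)]])
  show "(LINT r|lebesgue_on {0..s}. v r) = (LINT r|lebesgue_on {0..s}. w r)" if "s \<in> {0..t}" for s
    by (rule add_left_imp_eq[OF trans[OF sym[OF has_L2_derivativeD(3)[OF assms(1) that]] has_L2_derivativeD(3)[OF assms(2) that]]])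
qed

lemma has_L2_derivative_velocity:
  "has_L2_derivative t \<xi> v \<Longrightarrow> has_L2_derivative t \<xi> (velocity t \<xi>)"
  unfolding velocity_def by (rule someI[where P = "has_L2_derivative t \<xi>"])

lemma velocity_AE:
  "has_L2_derivative t \<xi> v \<Longrightarrow> AE s in lebesgue_on {0..t}. velocity t \<xi> s = v s"
  using has_L2_derivative_AE_unique has_L2_derivative_velocity by blast

lemma has_L2_derivative_add:
  assumes "has_L2_derivative t \<xi> v" "has_L2_derivative t \<eta> w"
  shows "has_L2_derivative t (\<lambda>s. \<xi> s + \<eta> s) (\<lambda>s. v s + w s)"
  unfolding has_L2_derivative_iff
proof (intro conjI ballI)
  show "L2 t (\<lambda>s. v s + w s)" using assms by (simp add: has_L2_derivative_iff L2_add)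
  fix s assume s: "s \<in> {0..t}"
  note eqs = has_L2_derivativeD(2)[OF assms(1) s] has_L2_derivativeD(2)[OF assms(2) s]
  have *: "integral {0..s} (\<lambda>s. v s + w s) = integral {0..s} v + integral {0..s} w"
    using assms s by (intro Henstock_Kurzweil_Integration.integral_add L2_integrable_on) (auto simp: has_L2_derivative_iff)
  show "\<xi> s + \<eta> s = \<xi> 0 + \<eta> 0 + integral {0..s} (\<lambda>s. v s + w s)"
    by (subst eqs(1), subst eqs(2), subst *) (simp only: ac_simps)
qed

lemma has_L2_derivative_scale:
  assumes "has_L2_derivative t \<xi> v"
  shows "has_L2_derivative t (\<lambda>s. c *\<^sub>R \<xi> s) (\<lambda>s. c *\<^sub>R v s)"
  unfolding has_L2_derivative_iff
proof (intro conjI ballI)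
  show "L2 t (\<lambda>s. c *\<^sub>R v s)" using assms by (simp add: has_L2_derivative_iff L2_scale)
  fix s assume s: "s \<in> {0..t}"
  from has_L2_derivativeD(2)[OF assms s] have "c *\<^sub>R \<xi> s = c *\<^sub>R (\<xi> 0 + integral {0..s} v)" by (rule arg_cong)
  then show "c *\<^sub>R \<xi> s = c *\<^sub>R \<xi> 0 + integral {0..s} (\<lambda>s. c *\<^sub>R v s)"
    by (simp only: scaleR_add_right Henstock_Kurzweil_Integration.integral_cmul)
qed

lemma has_L2_derivative_continuous:
  assumes "has_L2_derivative t \<xi> v" shows "continuous_on {0..t} \<xi>"
proof (rule continuous_on_eq)
  show "continuous_on {0..t} (\<lambda>s. \<xi> 0 + integral {0..s} v)"
    using assms by (intro continuous_on_add[OF continuous_on_const indefinite_integral_continuous_1] L2_integrable_on)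
      (auto simp: has_L2_derivative_iff)
  show "\<xi> 0 + integral {0..s} v = \<xi> s" if "s \<in> {0..t}" for s
    by (rule has_L2_derivativeD(2)[OF assms that, symmetric])
qed

text \<open>Frees \<open>H_inner\<close> from the choice made in \<open>velocity\<close>: any weak
  derivatives of the two paths compute it, since representatives agree almost everywhere.\<close>

lemma velocity_inner_eq:
  assumes "has_L2_derivative t \<xi> v" "has_L2_derivative t \<eta> w"
  shows "H_inner t \<xi> \<eta> = (LINT s|lebesgue_on {0..t}. v s \<bullet> w s)"
  unfolding H_inner_def
proof (rule integral_cong_AE)
  have vel: "L2 t (velocity t \<xi>)" "L2 t (velocity t \<eta>)" "L2 t v" "L2 t w"
    using assms has_L2_derivative_velocity by (auto simp: has_L2_derivative_iff)
  show "(\<lambda>s. velocity t \<xi> s \<bullet> velocity t \<eta> s) \<in> borel_measurable (lebesgue_on {0..t})"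
    "(\<lambda>s. v s \<bullet> w s) \<in> borel_measurable (lebesgue_on {0..t})"
    by (intro borel_measurable_inner L2_measurable vel)+
  show "AE s in lebesgue_on {0..t}. velocity t \<xi> s \<bullet> velocity t \<eta> s = v s \<bullet> w s"
    using velocity_AE[OF assms(1)] velocity_AE[OF assms(2)] by eventually_elim simp
qed

lemma H0_I:
  assumes "has_L2_derivative t \<xi> v" "\<xi> 0 = 0" "\<xi> t = 0" "\<And>s. s \<notin> {0..t} \<Longrightarrow> \<xi> s = 0"
  shows "\<xi> \<in> H0 t"
  using assms unfolding H_space_def by auto

lemma H0_velocity: "\<xi> \<in> H_space t x y \<Longrightarrow> has_L2_derivative t \<xi> (velocity t \<xi>)"
  unfolding H_space_def by (auto intro: has_L2_derivative_velocity)

lemma H0_D: "\<xi> \<in> H0 t \<Longrightarrow> \<xi> 0 = 0" "\<xi> \<in> H0 t \<Longrightarrow> \<xi> t = 0" "\<xi> \<in> H0 t \<Longrightarrow> s \<notin> {0..t} \<Longrightarrow> \<xi> s = 0"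
  unfolding H_space_def by auto

lemma H0_continuous: "\<xi> \<in> H_space t x y \<Longrightarrow> continuous_on {0..t} \<xi>"
  using H0_velocity has_L2_derivative_continuous by blast

lemma subspace_H0: "subspace (H0 t :: 'n::finite path set)"
  unfolding subspace_def
proof (intro conjI ballI allI)
  show "0 \<in> (H0 t :: 'n path set)"
    by (rule H0_I[of _ _ "\<lambda>_. 0"]) (auto simp: has_L2_derivative_iff L2_const)
next
  fix \<xi> \<eta> :: "'n path" assume *: "\<xi> \<in> H0 t" "\<eta> \<in> H0 t"
  show "\<xi> + \<eta> \<in> H0 t"
    unfolding plus_fun_def
    by (rule H0_I[OF has_L2_derivative_add[OF * [THEN H0_velocity]]]) (use * [THEN H0_D(1)] * [THEN H0_D(2)] * [THEN H0_D(3)] in auto)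
next
  fix c and \<xi> :: "'n path" assume *: "\<xi> \<in> H0 t"
  show "c *\<^sub>R \<xi> \<in> H0 t"
    unfolding scaleR_fun_def
    by (rule H0_I[OF has_L2_derivative_scale[OF * [THEN H0_velocity]]]) (use H0_D[OF *] in auto)
qed

text \<open>The parameter of type \<open>itself\<close> fixes the dimension, which \<open>t\<close>
  alone does not mention.\<close>

locale path_space =
  fixes t :: real and dim :: "'n::finite itself"
  assumes t_pos: "0 < t"
begin

lemma inner_space_H0: "inner_space (H0 t :: 'n path set) (H_inner t)"
proof
  show "subspace (H0 t :: 'n path set)" by (rule subspace_H0)
  fix \<xi> \<eta> \<zeta> :: "'n path" assume *: "\<xi> \<in> H0 t" "\<eta> \<in> H0 t" 
  note vel = * [THEN H0_velocity]
  have L: "L2 t (velocity t \<xi>)" "L2 t (velocity t \<eta>)"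
    using vel by (auto simp: has_L2_derivative_iff)
  show "H_inner t \<xi> \<eta> = H_inner t \<eta> \<xi>"
    unfolding H_inner_def by (simp add: inner_commute)
  show "H_inner t (c *\<^sub>R \<xi>) \<eta> = c * H_inner t \<xi> \<eta>" for c
    unfolding scaleR_fun_def
    by (subst velocity_inner_eq[OF has_L2_derivative_scale[OF vel(1)] vel(2)]) (simp add: H_inner_def)
  show "0 \<le> H_inner t \<xi> \<xi>"
    unfolding H_inner_def by (intro integral_nonneg_AE) auto
  show "H_inner t (\<xi> + \<eta>) \<zeta> = H_inner t \<xi> \<zeta> + H_inner t \<eta> \<zeta>" if z: "\<zeta> \<in> H0 t"
  proof -
    have Lz: "L2 t (velocity t \<zeta>)" using H0_velocity[OF z] by (simp add: has_L2_derivative_iff)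
    show ?thesis
      unfolding plus_fun_def
      by (subst velocity_inner_eq[OF has_L2_derivative_add[OF vel] H0_velocity[OF z]])
        (simp add: H_inner_def inner_add_left L2_inner_integrable[OF L(1) Lz] L2_inner_integrable[OF L(2) Lz])
  qed
  assume 0: "H_inner t \<xi> \<xi> = 0"
  have "AE s in lebesgue_on {0..t}. velocity t \<xi> s \<bullet> velocity t \<xi> s = 0"
    using 0 L2_inner_integrable[OF L(1) L(1)] unfolding H_inner_def
    by (subst (asm) integral_nonneg_eq_0_iff_AE) auto
  then have ae: "AE s in lebesgue_on {0..t}. velocity t \<xi> s = 0" by simp
  show "\<xi> = 0"
  proof
    fix s show "\<xi> s = 0 s"
    proof (cases "s \<in> {0..t}")
      case True
      have "AE r in lebesgue. r \<in> {0..t} \<longrightarrow> velocity t \<xi> r = 0"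
        using ae by (simp add: AE_restrict_space_iff)
      then have "AE r in lebesgue_on {0..s}. velocity t \<xi> r = 0"
        using True by (auto simp: AE_restrict_space_iff elim!: eventually_mono)
      then have "(LINT r|lebesgue_on {0..s}. velocity t \<xi> r) = 0"
        by (rule integral_eq_zero_AE)
      then show ?thesis
        using has_L2_derivativeD(3)[OF vel(1) True] H0_D(1)[OF *(1)] by simp
    qed (use H0_D(3)[OF *(1)] in auto)
  qed
qed

sublocale inner_space "H0 t :: 'n path set" "H_inner t"
  by (rule inner_space_H0)

lemma nrm_eq_H_norm: "nrm = H_norm t"
  by (simp add: fun_eq_iff nrm_def H_norm_def)

lemma H_inner_velocity_diff:
  fixes \<xi> \<eta> :: "'n path"
  assumes "has_L2_derivative t \<xi> v" "has_L2_derivative t \<eta> w"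
  shows "H_inner t (\<xi> - \<eta>) (\<xi> - \<eta>) = (LINT s|lebesgue_on {0..t}. (norm (v s - w s))\<^sup>2)"
proof -
  have "has_L2_derivative t (\<lambda>s. \<xi> s + (-1) *\<^sub>R \<eta> s) (\<lambda>s. v s + (-1) *\<^sub>R w s)"
    by (intro has_L2_derivative_add has_L2_derivative_scale assms)
  then have d: "has_L2_derivative t (\<xi> - \<eta>) (\<lambda>s. v s - w s)"
    by (simp add: fun_diff_def)
  show ?thesis
    by (subst velocity_inner_eq[OF d d]) (simp add: power2_norm_eq_inner)
qed

text \<open>The velocities of a Cauchy sequence converge in L2, and the primitive of the limit is
  the candidate. What remains is its boundary value at \<open>t\<close>: the velocities have
  integral 0, and this must survive the limit.\<close>

sublocale hilbert_space "H0 t :: 'n path set" "H_inner t"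
proof
  fix x :: "nat \<Rightarrow> 'n path"
  assume x: "\<And>n. x n \<in> H0 t"
    and cauchy: "\<And>\<epsilon>. \<epsilon> > 0 \<Longrightarrow> \<exists>N. \<forall>m\<ge>N. \<forall>n\<ge>N. nrm (x m - x n) < \<epsilon>"
  let ?M = "lebesgue_on {0..t}"
  define v where "v n = velocity t (x n)" for n
  have v: "has_L2_derivative t (x n) (v n)" for n unfolding v_def by (rule H0_velocity[OF x])
  then have vL: "L2 t (v n)" for n by (simp add: has_L2_derivative_iff)
  have "\<exists>N. \<forall>m\<ge>N. \<forall>n\<ge>N. (LINT s|?M. (norm (v m s - v n s))\<^sup>2) < \<epsilon>" if "\<epsilon> > 0" for \<epsilon>
  proof -
    have "sqrt \<epsilon> > 0" using that by simp
    from cauchy[OF this] obtain N where N: "\<forall>m\<ge>N. \<forall>n\<ge>N. nrm (x m - x n) < sqrt \<epsilon>" ..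
    have "(LINT s|?M. (norm (v m s - v n s))\<^sup>2) < \<epsilon>" if "m \<ge> N" "n \<ge> N" for m n
      using N that by (simp add: nrm_def H_inner_velocity_diff[OF v v])
    then show ?thesis by blast
  qed
  from riesz_fischer[OF vL _ this] obtain g where g: "L2 t g"
    and lim: "(\<lambda>n. LINT s|?M. (norm (v n s - g s))\<^sup>2) \<longlonglongrightarrow> 0"
    using t_pos by auto
  define \<xi> where "\<xi> s = (if s \<in> {0..t} then integral {0..s} g else 0)" for s
  have d: "has_L2_derivative t \<xi> g"
    using g t_pos by (auto simp: has_L2_derivative_iff \<xi>_def)
  have int0: "integral {0..t} (v n) = 0" for n
    using has_L2_derivativeD(2)[OF v[of n], of t] H0_D(1,2)[OF x[of n]] t_pos by simp
  \<comment> \<open>The limit in n is taken for a fixed weight c; afterwards c is arbitrary, which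
    forces the integral to be 0.\<close>
  have "norm (integral {0..t} g) \<le> c * t" if c: "c > 0" for c
  proof (rule LIMSEQ_le_const)
    show "(\<lambda>n. c * t + (LINT s|?M. (norm (v n s - g s))\<^sup>2) / c) \<longlonglongrightarrow> c * t"
      using tendsto_add[OF tendsto_const tendsto_divide[OF lim tendsto_const], of c "c * t"] c by simp
    have "norm (integral {0..t} g) \<le> c * t + (LINT s|?M. (norm (v n s - g s))\<^sup>2) / c" for n
    proof -
      have dL: "L2 t (\<lambda>s. v n s - g s)" by (rule L2_diff[OF vL g])
      have "norm (integral {0..t} g) = norm (integral {0..t} (\<lambda>s. v n s - g s))"
        using L2_integrable_on(1)[OF vL order_refl, of n] L2_integrable_on(1)[OF g order_refl]
        by (simp add: Henstock_Kurzweil_Integration.integral_diff int0)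
      also have "\<dots> = norm (LINT s|?M. v n s - g s)"
        using LINT_eq_integral[OF L2_integrable[OF dL]] by simp
      also have "\<dots> \<le> (LINT s|?M. norm (v n s - g s))"
        by (rule integral_norm_bound)
      also have "\<dots> \<le> c * t + (LINT s|?M. (norm (v n s - g s))\<^sup>2) / c"
        by (rule L1_le_L2[OF dL c]) (use t_pos in simp)
      finally show ?thesis .
    qed
    then show "\<exists>N. \<forall>n\<ge>N. norm (integral {0..t} g) \<le> c * t + (LINT s|?M. (norm (v n s - g s))\<^sup>2) / c" by blast
  qed
  then have "norm (integral {0..t} g) \<le> e" if "e > 0" for e
    using that t_pos by (metis divide_pos_pos nonzero_eq_divide_eq less_irrefl)
  then have "norm (integral {0..t} g) \<le> 0" by (rule field_le_epsilon[of _ 0, simplified])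
  then have "\<xi> t = 0" by (simp add: \<xi>_def)
  then have "\<xi> \<in> H0 t"
    by (intro H0_I[OF d]) (auto simp: \<xi>_def)
  moreover have "tends x \<xi>"
    unfolding tends_def nrm_def H_inner_velocity_diff[OF v d]
    using tendsto_real_sqrt[OF lim] by simp
  ultimately show "\<exists>g\<in>H0 t. tends x g" by blast
qed

end

section \<open>Paths with one corner, and the reproducing kernel\<close>

lemma has_integral_if_le:
  fixes a b :: "real \<Rightarrow> 'b::banach"
  assumes "(a has_integral A) {0..s}" "(b has_integral B) {s..u}" "0 \<le> s" "s \<le> u"
  shows "((\<lambda>r. if r \<le> s then a r else b r) has_integral A + B) {0..u}"
proof (rule has_integral_combine[OF assms(3,4)])
  show "((\<lambda>r. if r \<le> s then a r else b r) has_integral A) {0..s}"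
    by (rule has_integral_eq[OF _ assms(1)]) simp
  show "((\<lambda>r. if r \<le> s then a r else b r) has_integral B) {s..u}"
    by (rule has_integral_spike_finite[of "{s}", OF _ _ assms(2)]) auto
qed

text \<open>Green's functions are smooth on both sides of \<open>s\<close> with a jump of the
  derivative there. Continuity at \<open>s\<close> is enough for the piecewise derivative to be a
  weak one.\<close>

lemma glued_has_L2_derivative:
  fixes p q h :: "real \<Rightarrow> real^'n::finite"
  assumes s: "s \<in> {0..t}"
    and p: "\<And>r. r \<in> {0..t} \<Longrightarrow> (p has_vector_derivative p' r) (at r within {0..t})"
    and q: "\<And>r. r \<in> {0..t} \<Longrightarrow> (q has_vector_derivative q' r) (at r within {0..t})"
    and p': "continuous_on {0..t} p'" and q': "continuous_on {0..t} q'"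
    and pq: "p s = q s"
    and h: "\<And>r. r \<in> {0..t} \<Longrightarrow> h r = (if r \<le> s then p r else q r)"
  shows "has_L2_derivative t h (\<lambda>r. if r \<le> s then p' r else q' r)"
  unfolding has_L2_derivative_iff
proof (intro conjI ballI)
  let ?v = "\<lambda>r. if r \<le> s then p' r else q' r" and ?M = "lebesgue_on {0..t}"
  have L: "L2 t p'" "L2 t q'" using p' q' by (auto intro: L2_continuous)
  have [measurable]: "p' \<in> borel_measurable ?M" "q' \<in> borel_measurable ?M"
    using L by (auto intro: L2_measurable)
  have set: "{r \<in> space ?M. r \<le> s} \<in> sets ?M"
  proof -
    have "{r \<in> space ?M. r \<le> s} = {..s} \<inter> {0..t}" by auto
    then show ?thesis by (auto simp: sets_restrict_space)
  qed
  show "L2 t ?v"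
    unfolding L2_def
  proof
    show m: "?v \<in> borel_measurable ?M"
      by (rule measurable_If[OF _ _ set]) measurable
    show "integrable ?M (\<lambda>r. (norm (?v r))\<^sup>2)"
    proof (rule Bochner_Integration.integrable_bound)
      show "integrable ?M (\<lambda>r. (norm (p' r))\<^sup>2 + (norm (q' r))\<^sup>2)"
        using L by (intro Bochner_Integration.integrable_add) (auto simp: L2_def)
      show "(\<lambda>r. (norm (?v r))\<^sup>2) \<in> borel_measurable ?M" using m by measurable
    qed (auto intro!: AE_I2)
  qed
  fix u assume u: "u \<in> {0..t}"
  have ftc: "(f' has_integral f b - f a) {a..b}" if "0 \<le> a" "a \<le> b" "b \<le> t"
    "\<And>r. r \<in> {0..t} \<Longrightarrow> (f has_vector_derivative f' r) (at r within {0..t})" for a b and f f' :: "real \<Rightarrow> real^'n"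
    using that by (intro fundamental_theorem_of_calculus has_vector_derivative_within_subset[OF that(4)]) auto
  show "h u = h 0 + integral {0..u} ?v"
  proof (cases "u \<le> s")
    case True
    have "integral {0..u} ?v = integral {0..u} p'"
      using True by (intro Henstock_Kurzweil_Integration.integral_cong) auto
    also have "\<dots> = p u - p 0" using ftc[OF _ _ _ p] u by (intro integral_unique) auto
    finally show ?thesis using h[of u] h[of 0] u s True by simp
  next
    case False
    have "(?v has_integral (p s - p 0) + (q u - q s)) {0..u}"
      using s u False by (intro has_integral_if_le ftc p q) auto
    then have "integral {0..u} ?v = (p s - p 0) + (q u - q s)" by (rule integral_unique)
    moreover have "h u = q u" "h 0 = p 0" using h[of u] h[of 0] u s False by auto
    ultimately show ?thesis using pq by simp
  qed
qed

text \<open>Integration by parts on each side of \<open>s\<close>. The endpoint terms vanish with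
  \<eta>, and the jump p' s - q' s acts on \<eta> like a Dirac mass at \<open>s\<close>.\<close>

lemma glued_inner:
  fixes p q \<eta> :: "real \<Rightarrow> real^'n::finite"
  assumes s: "s \<in> {0..t}"
    and p: "\<And>r. r \<in> {0..t} \<Longrightarrow> (p' has_vector_derivative p'' r) (at r within {0..t})"
    and q: "\<And>r. r \<in> {0..t} \<Longrightarrow> (q' has_vector_derivative q'' r) (at r within {0..t})"
    and p'': "continuous_on {0..t} p''" and q'': "continuous_on {0..t} q''"
    and L: "L2 t (\<lambda>r. if r \<le> s then p' r else q' r)"
    and \<eta>: "has_L2_derivative t \<eta> w" "\<eta> 0 = 0" "\<eta> t = 0"
  shows "(LINT r|lebesgue_on {0..t}. (if r \<le> s then p' r else q' r) \<bullet> w r)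
    = (p' s - q' s) \<bullet> \<eta> s - integral {0..t} (\<lambda>r. (if r \<le> s then p'' r else q'' r) \<bullet> \<eta> r)"
proof -
  have t: "t \<in> {0..t}" using s by auto
  have w: "L2 t w" using \<eta> by (simp add: has_L2_derivative_iff)
  have ww: "w absolutely_integrable_on {0..t}" by (rule L2_integrable_on(2)[OF w order_refl])
  have \<eta>w: "\<And>s. s \<in> {0..t} \<Longrightarrow> \<eta> s = \<eta> 0 + integral {0..s} w"
    by (rule has_L2_derivativeD(2)[OF \<eta>(1)])
  have \<eta>c: "continuous_on {0..t} \<eta>" by (rule has_L2_derivative_continuous[OF \<eta>(1)])
  have p'c: "continuous_on {0..t} p'" and q'c: "continuous_on {0..t} q'"
    by (rule continuous_on_of_derivative, rule p, assumption, rule continuous_on_of_derivative, rule q, assumption)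
  have ibp: "integral {0..b} (\<lambda>r. f r \<bullet> w r) = f b \<bullet> \<eta> b - f 0 \<bullet> \<eta> 0 - integral {0..b} (\<lambda>r. f' r \<bullet> \<eta> r)"
    if "\<And>s. s \<in> {0..t} \<Longrightarrow> (f has_vector_derivative f' s) (at s within {0..t})" "continuous_on {0..t} f'" "b \<in> {0..t}"
    for f f' :: "real \<Rightarrow> real^'n" and b
    by (rule integration_by_parts_L1[OF ww \<eta>w that])
  have split: "integral {0..t} (\<lambda>r. if r \<le> s then a r else b r) = integral {0..s} a + (integral {0..t} b - integral {0..s} b)"
    if "a integrable_on {0..t}" "b integrable_on {0..t}" for a b :: "real \<Rightarrow> real"
  proof (rule integral_unique)
    have "((\<lambda>r. if r \<le> s then a r else b r) has_integral integral {0..s} a + integral {s..t} b) {0..t}"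
      using s by (intro has_integral_if_le integrable_integral integrable_subinterval_real[OF that(1)] integrable_subinterval_real[OF that(2)]) auto
    then show "((\<lambda>r. if r \<le> s then a r else b r) has_integral integral {0..s} a + (integral {0..t} b - integral {0..s} b)) {0..t}"
      using integral_ivl_diff[OF that(2), of s t] s by simp
  qed
  have ri: "(\<lambda>r. f r \<bullet> w r) integrable_on {0..t}" if "continuous_on {0..t} f" for f :: "real \<Rightarrow> real^'n"
    using integral_ivl_eq(3)[OF L2_inner_integrable[OF L2_continuous[OF that] w] order_refl]
    by (simp add: absolutely_integrable_on_def)
  have rj: "(\<lambda>r. f r \<bullet> \<eta> r) integrable_on {0..t}" if "continuous_on {0..t} f" for f :: "real \<Rightarrow> real^'n"
    by (intro integrable_continuous_real continuous_on_inner that \<eta>c)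
  have "(LINT r|lebesgue_on {0..t}. (if r \<le> s then p' r else q' r) \<bullet> w r)
      = integral {0..t} (\<lambda>r. (if r \<le> s then p' r else q' r) \<bullet> w r)"
    by (rule LINT_eq_integral[OF L2_inner_integrable[OF L w]])
  also have "\<dots> = integral {0..t} (\<lambda>r. if r \<le> s then p' r \<bullet> w r else q' r \<bullet> w r)"
    by (intro Henstock_Kurzweil_Integration.integral_cong) simp
  also have "\<dots> = integral {0..s} (\<lambda>r. p' r \<bullet> w r) + (integral {0..t} (\<lambda>r. q' r \<bullet> w r) - integral {0..s} (\<lambda>r. q' r \<bullet> w r))"
    by (rule split[OF ri[OF p'c] ri[OF q'c]])
  also have "\<dots> = (p' s - q' s) \<bullet> \<eta> s - (integral {0..s} (\<lambda>r. p'' r \<bullet> \<eta> r) + (integral {0..t} (\<lambda>r. q'' r \<bullet> \<eta> r) - integral {0..s} (\<lambda>r. q'' r \<bullet> \<eta> r)))"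
    using ibp[OF p p'' s] ibp[OF q q'' s] ibp[OF q q'' t] \<eta>(2,3) by (simp add: inner_diff_left)
  also have "integral {0..s} (\<lambda>r. p'' r \<bullet> \<eta> r) + (integral {0..t} (\<lambda>r. q'' r \<bullet> \<eta> r) - integral {0..s} (\<lambda>r. q'' r \<bullet> \<eta> r))
      = integral {0..t} (\<lambda>r. if r \<le> s then p'' r \<bullet> \<eta> r else q'' r \<bullet> \<eta> r)"
    by (rule split[OF rj[OF p''] rj[OF q''], symmetric])
  also have "\<dots> = integral {0..t} (\<lambda>r. (if r \<le> s then p'' r else q'' r) \<bullet> \<eta> r)"
    by (intro Henstock_Kurzweil_Integration.integral_cong) simp
  finally show ?thesis .
qed

context path_space
begin

lemma glued_in_H0:
  fixes p q h :: "'n path"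
  assumes s: "s \<in> {0..t}"
    and p: "\<And>r. r \<in> {0..t} \<Longrightarrow> (p has_vector_derivative p' r) (at r within {0..t})"
      "\<And>r. r \<in> {0..t} \<Longrightarrow> (p' has_vector_derivative p'' r) (at r within {0..t})"
    and q: "\<And>r. r \<in> {0..t} \<Longrightarrow> (q has_vector_derivative q' r) (at r within {0..t})"
      "\<And>r. r \<in> {0..t} \<Longrightarrow> (q' has_vector_derivative q'' r) (at r within {0..t})"
    and p'': "continuous_on {0..t} p''" and q'': "continuous_on {0..t} q''"
    and pq: "p s = q s" "p 0 = 0" "q t = 0"
    and h: "h = (\<lambda>r. if r \<in> {0..t} then (if r \<le> s then p r else q r) else 0)"
  shows "h \<in> H0 t"
    and "\<eta> \<in> H0 t \<Longrightarrow> H_inner t h \<eta> = (p' s - q' s) \<bullet> \<eta> s - integral {0..t} (\<lambda>r. (if r \<le> s then p'' r else q'' r) \<bullet> \<eta> r)"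
proof -
  have p'c: "continuous_on {0..t} p'" and q'c: "continuous_on {0..t} q'"
    by (rule continuous_on_of_derivative, rule p(2), assumption, rule continuous_on_of_derivative, rule q(2), assumption)
  have d: "has_L2_derivative t h (\<lambda>r. if r \<le> s then p' r else q' r)"
    unfolding h by (rule glued_has_L2_derivative[OF s p(1) q(1) p'c q'c pq(1)]) auto
  show "h \<in> H0 t"
    by (rule H0_I[OF d]) (use pq s in \<open>auto simp: h\<close>)
  assume \<eta>: "\<eta> \<in> H0 t"
  have "H_inner t h \<eta> = (LINT r|lebesgue_on {0..t}. (if r \<le> s then p' r else q' r) \<bullet> velocity t \<eta> r)"
    by (rule velocity_inner_eq[OF d H0_velocity[OF \<eta>]])
  also have "\<dots> = (p' s - q' s) \<bullet> \<eta> s - integral {0..t} (\<lambda>r. (if r \<le> s then p'' r else q'' r) \<bullet> \<eta> r)"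
    using d by (intro glued_inner[OF s p(2) q(2) p'' q'' _ H0_velocity[OF \<eta>] H0_D(1)[OF \<eta>] H0_D(2)[OF \<eta>]])
      (auto simp: has_L2_derivative_iff)
  finally show "H_inner t h \<eta> = (p' s - q' s) \<bullet> \<eta> s - integral {0..t} (\<lambda>r. (if r \<le> s then p'' r else q'' r) \<bullet> \<eta> r)" .
qed

text \<open>The reproducing kernel of the space, that is Green's function of \<open>- d\<^sup>2/ds\<^sup>2\<close>.\<close>

definition kern :: "real \<Rightarrow> real^'n \<Rightarrow> 'n path" where
  "kern s a = (\<lambda>r. if r \<in> {0..t} then (if r \<le> s then (r * (t - s) / t) *\<^sub>R a else (s * (t - r) / t) *\<^sub>R a) else 0)"

lemma kern:
  assumes s: "s \<in> {0..t}"
  shows kern_in_H0: "kern s a \<in> H0 t" and kern_reproducing: "\<eta> \<in> H0 t \<Longrightarrow> H_inner t (kern s a) \<eta> = a \<bullet> \<eta> s"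
proof -
  have d: "((\<lambda>r. (r * (t - s) / t) *\<^sub>R a) has_vector_derivative ((t - s) / t) *\<^sub>R a) (at r within {0..t})"
    "((\<lambda>r. (s * (t - r) / t) *\<^sub>R a) has_vector_derivative (- s / t) *\<^sub>R a) (at r within {0..t})" for r
    using t_pos by (auto intro!: derivative_eq_intros simp: has_vector_derivative_def)
  have z: "((\<lambda>r. c *\<^sub>R a) has_vector_derivative 0) (at r within {0..t})" for r c
    by (rule has_vector_derivative_const)
  note * = glued_in_H0[OF s d(1) z d(2) z _ _ _ _ _ kern_def]
  show "kern s a \<in> H0 t" by (rule *) (use t_pos in auto)
  assume "\<eta> \<in> H0 t"
  \<comment> \<open>The slopes (t - s) / t and - s / t differ by 1, so the jump at \<open>s\<close>
    is exactly \<open>a\<close>, while both second derivatives vanish.\<close>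
  then have "H_inner t (kern s a) \<eta> = (((t - s) / t) *\<^sub>R a - (- s / t) *\<^sub>R a) \<bullet> \<eta> s - integral {0..t} (\<lambda>r. (if r \<le> s then 0 else 0) \<bullet> \<eta> r)"
    by (intro *) (use t_pos in auto)
  then show "H_inner t (kern s a) \<eta> = a \<bullet> \<eta> s"
    using t_pos by (simp add: field_simps flip: scaleR_diff_left scaleR_add_left)
qed

lemma kern_inner_kern:
  assumes "s \<in> {0..t}" "r \<in> {0..t}" "r \<le> s"
  shows "H_inner t (kern s a) (kern r a) = r * (t - s) / t * (norm a)\<^sup>2" "H_inner t (kern r a) (kern s a) = r * (t - s) / t * (norm a)\<^sup>2"
proof -
  have k: "kern r a s = (r * (t - s) / t) *\<^sub>R a"
    using assms by (auto simp: kern_def)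
  show *: "H_inner t (kern s a) (kern r a) = r * (t - s) / t * (norm a)\<^sup>2"
    using kern_reproducing[OF assms(1) kern_in_H0[OF assms(2)], of a a] k by (simp add: power2_norm_eq_inner)
  show "H_inner t (kern r a) (kern s a) = r * (t - s) / t * (norm a)\<^sup>2"
    using * ip_sym[OF kern_in_H0[OF assms(1)] kern_in_H0[OF assms(2)], of a a] by simp
qed

text \<open>Pair \<xi> with the difference of the kernels at the two times, in the direction \<xi> s
  - \<xi> r. For r \<le> s the squared norm of that difference is ((s - r) - (s - r)^2 / t) times
  the square of the direction. The Hoelder bound supplies equicontinuity for the compactness of
  \<open>opf\<close>.\<close>

lemma norm_diff_le_H_norm:
  fixes \<xi> :: "'n path"
  assumes \<xi>: "\<xi> \<in> H0 t" and sr: "s \<in> {0..t}" "r \<in> {0..t}"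
  shows "norm (\<xi> s - \<xi> r) \<le> sqrt \<bar>s - r\<bar> * H_norm t \<xi>"
proof -
  have *: "norm (\<xi> s - \<xi> r) \<le> sqrt (s - r) * H_norm t \<xi>" if sr: "s \<in> {0..t}" "r \<in> {0..t}" "r \<le> s" for s r
  proof -
    define a where "a = \<xi> s - \<xi> r"
    have k: "kern s a \<in> H0 t" "kern r a \<in> H0 t" using sr by (auto intro: kern_in_H0)
    have "(norm a)\<^sup>2 = H_inner t (kern s a - kern r a) \<xi>"
      using k \<xi> sr by (simp add: ip_simps kern_reproducing power2_norm_eq_inner a_def inner_diff_left inner_diff_right inner_commute)
    also have "\<dots> \<le> nrm (kern s a - kern r a) * nrm \<xi>"
      using cauchy_schwarz[of "kern s a - kern r a" \<xi>] k \<xi> by simp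
    also have "\<dots> \<le> (sqrt (s - r) * norm a) * nrm \<xi>"
    proof (intro mult_right_mono)
      have "H_inner t (kern s a - kern r a) (kern s a - kern r a) = (s * (t - s) / t - 2 * (r * (t - s) / t) + r * (t - r) / t) * (norm a)\<^sup>2"
        using k sr by (simp add: ip_simps kern_inner_kern algebra_simps)
      also have "s * (t - s) / t - 2 * (r * (t - s) / t) + r * (t - r) / t = (s - r) - (s - r)\<^sup>2 / t"
        using t_pos by (simp add: field_simps power2_eq_square)
      also have "((s - r) - (s - r)\<^sup>2 / t) * (norm a)\<^sup>2 \<le> (s - r) * (norm a)\<^sup>2"
        using t_pos by (intro mult_right_mono) auto
      finally have "nrm (kern s a - kern r a) \<le> sqrt ((s - r) * (norm a)\<^sup>2)"
        unfolding nrm_def by (rule real_sqrt_le_mono)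
      then show "nrm (kern s a - kern r a) \<le> sqrt (s - r) * norm a"
        by (simp add: real_sqrt_mult)
      show "0 \<le> nrm \<xi>" using \<xi> by simp
    qed
    finally have "norm a * norm a \<le> (sqrt (s - r) * nrm \<xi>) * norm a"
      by (simp add: power2_eq_square mult_ac)
    moreover have "0 \<le> sqrt (s - r) * nrm \<xi>" using sr \<xi> by simp
    ultimately have "norm a \<le> sqrt (s - r) * nrm \<xi>"
      by (cases "norm a = 0") (auto simp: mult_le_cancel_right)
    then show ?thesis by (simp add: a_def nrm_eq_H_norm)
  qed
  show ?thesis
    using *[of s r] *[of r s] sr by (cases "r \<le> s") (auto simp: norm_minus_commute)
qed

lemma norm_le_H_norm:
  fixes \<xi> :: "'n path"
  assumes \<xi>: "\<xi> \<in> H0 t" and s: "s \<in> {0..t}"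
  shows "norm (\<xi> s) \<le> sqrt t * H_norm t \<xi>"
proof -
  have "norm (\<xi> s) \<le> sqrt \<bar>s - 0\<bar> * H_norm t \<xi>"
    using norm_diff_le_H_norm[OF \<xi> s, of 0] H0_D(1)[OF \<xi>] t_pos by simp
  also have "\<dots> \<le> sqrt t * H_norm t \<xi>"
    using s \<xi> nrm_nonneg[OF \<xi>] by (intro mult_right_mono) (auto simp: nrm_eq_H_norm)
  finally show ?thesis .
qed

end

section \<open>Linear second order systems\<close>

lemma continuous_on_mult_vec:
  fixes M :: "'a::topological_space \<Rightarrow> real^'m^'n"
  assumes "continuous_on S M" "continuous_on S y"
  shows "continuous_on S (\<lambda>r. M r *v y r)"
  unfolding matrix_vector_mult_def
  by (intro continuous_on_vec_lambda continuous_on_sum continuous_on_mult continuous_on_component assms)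

lemma norm_mult_vec_le:
  fixes A :: "real^'m^'n"
  shows "norm (A *v x) \<le> real CARD('n) * norm A * norm x"
proof -
  have "norm (A *v x) \<le> (\<Sum>i\<in>UNIV. \<bar>(A *v x) $ i\<bar>)" by (rule norm_le_l1_cart)
  also have "\<dots> \<le> (\<Sum>i\<in>(UNIV::'n set). norm A * norm x)"
  proof (rule sum_mono)
    fix i
    have "\<bar>(A *v x) $ i\<bar> \<le> norm (A $ i) * norm x"
      unfolding matrix_vector_mul_component by (rule Cauchy_Schwarz_ineq2)
    also have "\<dots> \<le> norm A * norm x" by (intro mult_right_mono Finite_Cartesian_Product.norm_nth_le norm_ge_zero)
    finally show "\<bar>(A *v x) $ i\<bar> \<le> norm A * norm x" .
  qed
  finally show ?thesis by (simp add: mult.assoc)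
qed

lemma has_vector_derivative_cscale: "(f has_vector_derivative f') F \<Longrightarrow> ((\<lambda>x. c *\<^sub>R f x) has_vector_derivative c *\<^sub>R f') F"
  using bounded_linear.has_vector_derivative[OF bounded_linear_scaleR_right] .

lemma prim_add_scale:
  assumes "continuous_on UNIV a" "continuous_on UNIV b"
  shows "prim (\<lambda>r. a r + c *\<^sub>R b r) = (\<lambda>s. prim a s + c *\<^sub>R prim b s)"
proof
  fix s
  have int: "a integrable_on {x..y}" "b integrable_on {x..y}" for x y
    by (intro integrable_continuous_real continuous_on_subset[OF assms(1)] subset_UNIV,
        intro integrable_continuous_real continuous_on_subset[OF assms(2)] subset_UNIV)
  have "integral {x..y} (\<lambda>r. a r + c *\<^sub>R b r) = integral {x..y} a + c *\<^sub>R integral {x..y} b" for x y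
    using int[of x y] by (subst Henstock_Kurzweil_Integration.integral_add) (auto intro: integrable_cmul)
  then show "prim (\<lambda>r. a r + c *\<^sub>R b r) s = prim a s + c *\<^sub>R prim b s"
    by (simp add: prim_def)
qed

lemma norm_prim_le_const:
  assumes "continuous_on UNIV p" "\<bar>s\<bar> \<le> R" "\<And>r. \<bar>r\<bar> \<le> R \<Longrightarrow> norm (p r) \<le> c" "0 \<le> c"
  shows "norm (prim p s) \<le> c * R"
proof -
  have "norm (prim p s) \<le> c * \<bar>s\<bar> ^ Suc 0 / Suc 0"
    by (rule norm_prim_le[OF assms(1,2)]) (use assms(3) in simp)
  also have "\<dots> \<le> c * R" using assms(2,4) by (simp add: mult_left_mono)
  finally show ?thesis .
qed

text \<open>The coefficients of the power series in \<open>z\<close> of the solution of \<open>y'' = - z M y\<close>, \<open>y(0) = 0\<close>, \<open>y'(0) = w\<close>.\<close>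

primrec pic :: "(real \<Rightarrow> real^'n^'n) \<Rightarrow> real^'n \<Rightarrow> nat \<Rightarrow> real \<Rightarrow> real^'n" where
  "pic M w 0 = (\<lambda>s. s *\<^sub>R w)"
| "pic M w (Suc k) = (\<lambda>s. - prim (prim (\<lambda>r. M r *v pic M w k r)) s)"

definition sol :: "(real \<Rightarrow> real^'n^'n) \<Rightarrow> real \<Rightarrow> real^'n \<Rightarrow> real \<Rightarrow> real^'n" where
  "sol M z w s = (\<Sum>k. z ^ k *\<^sub>R pic M w k s)"

text \<open>Defined by the integrated equation instead of a termwise derivative of the series, so
  that both derivative lemmas follow from \<open>has_vector_derivative_prim\<close> and
  \<open>sol_integral_equation\<close>.\<close>

definition sol' :: "(real \<Rightarrow> real^'n^'n) \<Rightarrow> real \<Rightarrow> real^'n \<Rightarrow> real \<Rightarrow> real^'n" where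
  "sol' M z w s = w - z *\<^sub>R prim (\<lambda>r. M r *v sol M z w r) s"

locale system =
  fixes M :: "real \<Rightarrow> real^'n^'n"
  assumes M_cont: "continuous_on UNIV M"
begin

lemma continuous_Mv: "continuous_on UNIV y \<Longrightarrow> continuous_on UNIV (\<lambda>r. M r *v y r)"
  by (rule continuous_on_mult_vec[OF M_cont])

lemma pic_continuous: "continuous_on UNIV (pic M w k)"
proof (induction k)
  case (Suc k)
  then show ?case
    by (simp del: prim_0) (intro continuous_on_minus continuous_on_prim continuous_Mv)
qed (simp add: continuous_on_scaleR continuous_on_id)

lemma pic_linear: "pic M (v + c *\<^sub>R w) k = (\<lambda>s. pic M v k s + c *\<^sub>R pic M w k s)"
proof (induction k)
  case 0
  show ?case by (simp add: fun_eq_iff scaleR_add_right)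
next
  case (Suc k)
  have "(\<lambda>r. M r *v (pic M v k r + c *\<^sub>R pic M w k r)) = (\<lambda>r. M r *v pic M v k r + c *\<^sub>R (M r *v pic M w k r))"
    by (simp add: matrix_vector_right_distrib matrix_vector_mult_scaleR)
  then have "prim (prim (\<lambda>r. M r *v (pic M v k r + c *\<^sub>R pic M w k r)))
      = (\<lambda>s. prim (prim (\<lambda>r. M r *v pic M v k r)) s + c *\<^sub>R prim (prim (\<lambda>r. M r *v pic M w k r)) s)"
    by (simp add: prim_add_scale continuous_Mv pic_continuous continuous_on_prim)
  then show ?case by (simp add: Suc)
qed

lemma obtain_bound:
  obtains K where "K \<ge> 0" "\<And>r x. \<bar>r\<bar> \<le> R \<Longrightarrow> norm (M r *v x) \<le> K * norm x"
proof -
  have "compact (M ` {-R..R})"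
    by (intro compact_continuous_image continuous_on_subset[OF M_cont] compact_Icc) auto
  from compact_imp_bounded[OF this] obtain B where B: "\<forall>A\<in>M ` {-R..R}. norm A \<le> B"
    unfolding bounded_iff ..
  show thesis
  proof (rule that[of "real CARD('n) * \<bar>B\<bar>"])
    fix r and x :: "real^'n" assume "\<bar>r\<bar> \<le> R"
    then have "M r \<in> M ` {-R..R}" by (intro imageI) auto
    with B have "norm (M r) \<le> \<bar>B\<bar>" by (meson abs_ge_self order_trans)
    then have "real CARD('n) * norm (M r) * norm x \<le> real CARD('n) * \<bar>B\<bar> * norm x"
      by (intro mult_right_mono mult_left_mono) auto
    then show "norm (M r *v x) \<le> real CARD('n) * \<bar>B\<bar> * norm x"
      using norm_mult_vec_le[of "M r" x] by linarith
  qed simp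
qed

text \<open>A step takes two primitives. The first supplies the new factor of the factorial; of the
  second, only the length is kept and bounded by \<open>R\<close>. This is crude, but it already
  gives an exponential majorant.\<close>

lemma pic_bound:
  assumes K: "K \<ge> 0" "\<And>r x. \<bar>r\<bar> \<le> R \<Longrightarrow> norm (M r *v x) \<le> K * norm x" and s: "\<bar>s\<bar> \<le> R"
  shows "norm (pic M w k s) \<le> norm w * R * (K * R) ^ k / fact k * \<bar>s\<bar> ^ k"
  using s
proof (induction k arbitrary: s)
  case 0
  then show ?case by (simp add: mult.commute[of "norm w"] mult_right_mono)
next
  case (Suc k)
  have R: "R \<ge> 0" using Suc.prems by linarith
  define c where "c = norm w * R * (K * R) ^ k / fact k"
  have c: "c \<ge> 0" using R K by (simp add: c_def)
  have b1: "norm (prim (\<lambda>r. M r *v pic M w k r) r) \<le> K * c / Suc k * \<bar>r\<bar> ^ Suc k" if r: "\<bar>r\<bar> \<le> R" for r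
  proof -
    have "norm (prim (\<lambda>r. M r *v pic M w k r) r) \<le> K * c * \<bar>r\<bar> ^ Suc k / Suc k"
    proof (rule norm_prim_le[OF _ r])
      show "continuous_on UNIV (\<lambda>r. M r *v pic M w k r)"
        by (intro continuous_Mv pic_continuous)
      fix u assume u: "\<bar>u\<bar> \<le> R"
      have "norm (M u *v pic M w k u) \<le> K * norm (pic M w k u)" by (rule K(2)[OF u])
      also have "\<dots> \<le> K * (c * \<bar>u\<bar> ^ k)"
        using Suc.IH[OF u] K(1) unfolding c_def by (rule mult_left_mono)
      finally show "norm (M u *v pic M w k u) \<le> K * c * \<bar>u\<bar> ^ k" by (simp add: mult.assoc)
    qed
    then show ?thesis by simp
  qed
  have "norm (prim (prim (\<lambda>r. M r *v pic M w k r)) s) \<le> K * c / Suc k * \<bar>s\<bar> ^ Suc (Suc k) / Suc (Suc k)"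
    by (rule norm_prim_le[OF _ Suc.prems b1]) (intro continuous_on_prim continuous_Mv pic_continuous)
  also have "\<dots> \<le> K * c / Suc k * \<bar>s\<bar> ^ Suc (Suc k) / 1"
    using K c by (intro divide_left_mono mult_nonneg_nonneg divide_nonneg_nonneg) auto
  also have "\<dots> = K * c / Suc k * \<bar>s\<bar> ^ Suc k * \<bar>s\<bar>" by simp
  also have "\<dots> \<le> K * c / Suc k * \<bar>s\<bar> ^ Suc k * R"
    using Suc.prems K c by (intro mult_left_mono mult_nonneg_nonneg divide_nonneg_nonneg) auto
  also have "\<dots> = norm w * R * (K * R) ^ Suc k / fact (Suc k) * \<bar>s\<bar> ^ Suc k"
    by (simp add: c_def field_simps)
  finally show ?case by simp
qed

text \<open>An exponential series dominates the solution series uniformly on boxes in (z, s).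
  Convergence and joint continuity rest on it, and so does the fact that the entries of the
  fundamental matrix are entire in z.\<close>

lemma sol_majorant:
  obtains a where "summable a" "\<And>k z s. \<lbrakk>\<bar>z\<bar> \<le> r; \<bar>s\<bar> \<le> R\<rbrakk> \<Longrightarrow> norm (z ^ k *\<^sub>R pic M w k s) \<le> a k"
proof -
  obtain K where K: "K \<ge> 0" "\<And>u x. \<bar>u\<bar> \<le> R \<Longrightarrow> norm (M u *v x) \<le> K * norm x" using obtain_bound[of R] by metis
  show thesis
  proof (rule that[of "\<lambda>k. norm w * R * (inverse (fact k) * (r * K * R * R) ^ k)"])
    show "summable (\<lambda>k. norm w * R * (inverse (fact k) * (r * K * R * R) ^ k))"
      using summable_exp by (intro summable_mult)
    fix k and z s :: real assume z: "\<bar>z\<bar> \<le> r" and s: "\<bar>s\<bar> \<le> R"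
    have R: "R \<ge> 0" and r: "r \<ge> 0" using s z by linarith+
    have "norm (z ^ k *\<^sub>R pic M w k s) = \<bar>z\<bar> ^ k * norm (pic M w k s)" by (simp add: power_abs)
    also have "\<dots> \<le> r ^ k * (norm w * R * (K * R) ^ k / fact k * \<bar>s\<bar> ^ k)"
      using z pic_bound[OF K s, of w k] r by (intro mult_mono power_mono) auto
    also have "\<dots> \<le> r ^ k * (norm w * R * (K * R) ^ k / fact k * R ^ k)"
      using s R K r by (intro mult_left_mono power_mono) auto
    also have "\<dots> = norm w * R * (inverse (fact k) * (r * K * R * R) ^ k)"
      by (simp add: power_mult_distrib field_simps)
    finally show "norm (z ^ k *\<^sub>R pic M w k s) \<le> norm w * R * (inverse (fact k) * (r * K * R * R) ^ k)" .
  qed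
qed

lemma sol_summable: "summable (\<lambda>k. z ^ k *\<^sub>R pic M w k s)"
proof -
  obtain a where a: "summable a" "\<And>k z' s'. \<lbrakk>\<bar>z'\<bar> \<le> \<bar>z\<bar>; \<bar>s'\<bar> \<le> \<bar>s\<bar>\<rbrakk> \<Longrightarrow> norm (z' ^ k *\<^sub>R pic M w k s') \<le> a k"
    using sol_majorant[of "\<bar>z\<bar>" "\<bar>s\<bar>" w] by metis
  show ?thesis by (rule summable_comparison_test'[OF a(1), of 0]) (rule a(2), auto)
qed

lemma sol_uniform_limit:
  "uniform_limit ({-r..r} \<times> {-R..R}) (\<lambda>n x. \<Sum>k<n. fst x ^ k *\<^sub>R pic M w k (snd x)) (\<lambda>x. sol M (fst x) w (snd x)) sequentially"
proof -
  obtain a where a: "summable a" "\<And>k z s. \<lbrakk>\<bar>z\<bar> \<le> r; \<bar>s\<bar> \<le> R\<rbrakk> \<Longrightarrow> norm (z ^ k *\<^sub>R pic M w k s) \<le> a k"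
    using sol_majorant[of r R w] by metis
  show ?thesis
    unfolding sol_def by (rule Weierstrass_m_test[OF _ a(1)]) (rule a(2), auto)
qed

text \<open>Joint continuity in the parameter and the time permits the passage to the limit under
  the integral in \<open>sol_deriv_parameter\<close>.\<close>

lemma sol_jointly_continuous: "continuous_on UNIV (\<lambda>x. sol M (fst x) w (snd x))"
proof -
  have box: "continuous_on ({-n<..<n} \<times> {-n<..<n}) (\<lambda>x. sol M (fst x) w (snd x))" for n :: real
  proof (rule continuous_on_subset)
    show "continuous_on ({-n..n} \<times> {-n..n}) (\<lambda>x. sol M (fst x) w (snd x))"
    proof (rule uniform_limit_theorem[OF _ sol_uniform_limit])
      have "continuous_on ({-n..n} \<times> {-n..n}) (\<lambda>x. \<Sum>k<m. fst x ^ k *\<^sub>R pic M w k (snd x))" for m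
        by (intro continuous_on_sum continuous_on_scaleR continuous_on_power continuous_on_fst continuous_on_snd
            continuous_on_compose2[OF pic_continuous] continuous_on_id subset_UNIV)
      then show "\<forall>\<^sub>F m in sequentially. continuous_on ({-n..n} \<times> {-n..n}) (\<lambda>x. \<Sum>k<m. fst x ^ k *\<^sub>R pic M w k (snd x))"
        by simp
    qed simp
  qed auto
  have "continuous_on (\<Union>n\<in>(UNIV::real set). {-n<..<n} \<times> {-n<..<n}) (\<lambda>x. sol M (fst x) w (snd x))"
    by (rule continuous_on_open_UN) (auto intro: open_Times box)
  moreover have "(\<Union>n\<in>(UNIV::real set). {-n<..<n} \<times> {-n<..<n}) = UNIV"
  proof (intro equalityI subsetI UNIV_I)
    fix x :: "real \<times> real"
    have "x \<in> {-(\<bar>fst x\<bar> + \<bar>snd x\<bar> + 1)<..<\<bar>fst x\<bar> + \<bar>snd x\<bar> + 1} \<times> {-(\<bar>fst x\<bar> + \<bar>snd x\<bar> + 1)<..<\<bar>fst x\<bar> + \<bar>snd x\<bar> + 1}"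
      by (cases x) auto
    then show "x \<in> (\<Union>n\<in>(UNIV::real set). {-n<..<n} \<times> {-n<..<n})" by blast
  qed
  ultimately show ?thesis by simp
qed

lemma sol_continuous: "continuous_on UNIV (sol M z w)"
  using continuous_on_compose2[OF sol_jointly_continuous[of w], of UNIV "\<lambda>s. (z, s)"]
  by (simp add: continuous_on_Pair continuous_on_id)

text \<open>The partial sums are the Picard iterates of the integral equation; one application of
  the integral operator raises the number of terms by one.\<close>

lemma sol_partial_sums:
  "(\<Sum>k<Suc n. z ^ k *\<^sub>R pic M w k s) = s *\<^sub>R w - z *\<^sub>R prim (prim (\<lambda>r. M r *v (\<Sum>k<n. z ^ k *\<^sub>R pic M w k r))) s"
proof (induction n arbitrary: s)
  case 0
  have "prim (\<lambda>r::real. 0::real^'n) = (\<lambda>s. 0)" by (simp add: prim_def fun_eq_iff)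
  then show ?case by simp
next
  case (Suc n)
  define P where "P r = (\<Sum>k<n. z ^ k *\<^sub>R pic M w k r)" for r
  have Pc: "continuous_on UNIV P"
    unfolding P_def by (intro continuous_on_sum continuous_on_scaleR continuous_on_const pic_continuous)
  have "(\<lambda>r. M r *v (\<Sum>k<Suc n. z ^ k *\<^sub>R pic M w k r)) = (\<lambda>r. M r *v P r + z ^ n *\<^sub>R (M r *v pic M w n r))"
    by (simp add: P_def matrix_vector_right_distrib matrix_vector_mult_scaleR)
  then have "prim (prim (\<lambda>r. M r *v (\<Sum>k<Suc n. z ^ k *\<^sub>R pic M w k r)))
      = (\<lambda>s. prim (prim (\<lambda>r. M r *v P r)) s + z ^ n *\<^sub>R prim (prim (\<lambda>r. M r *v pic M w n r)) s)"
    by (simp only: prim_add_scale continuous_Mv pic_continuous continuous_on_prim Pc)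
  then show ?case
    using Suc[of s] by (simp add: P_def scaleR_add_right algebra_simps)
qed

text \<open>Uniform convergence of the partial sums for |r| \<le> |s| passes through multiplication
  by \<open>M\<close> and through both primitives, so the Picard recursion survives in the
  limit.\<close>

lemma sol_integral_equation:
  "sol M z w s = s *\<^sub>R w - z *\<^sub>R prim (prim (\<lambda>r. M r *v sol M z w r)) s"
proof (rule LIMSEQ_unique)
  show "(\<lambda>n. \<Sum>k<Suc n. z ^ k *\<^sub>R pic M w k s) \<longlonglongrightarrow> sol M z w s"
    using sol_summable[of z w s] unfolding sol_def by (intro LIMSEQ_Suc summable_LIMSEQ)
  define P where "P n r = (\<Sum>k<n. z ^ k *\<^sub>R pic M w k r)" for n r
  have Pc: "continuous_on UNIV (P n)" for n
    unfolding P_def by (intro continuous_on_sum continuous_on_scaleR continuous_on_const pic_continuous)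
  define R where "R = \<bar>s\<bar>"
  obtain K where K: "K \<ge> 0" "\<And>u x. \<bar>u\<bar> \<le> R \<Longrightarrow> norm (M u *v x) \<le> K * norm x" using obtain_bound[of R] by metis
  have ul: "\<exists>N. \<forall>n\<ge>N. \<forall>u. \<bar>u\<bar> \<le> R \<longrightarrow> norm (P n u - sol M z w u) < \<epsilon>" if "\<epsilon> > 0" for \<epsilon>
  proof -
    have "\<forall>\<^sub>F n in sequentially. \<forall>x\<in>{-\<bar>z\<bar>..\<bar>z\<bar>} \<times> {-R..R}. dist (\<Sum>k<n. fst x ^ k *\<^sub>R pic M w k (snd x)) (sol M (fst x) w (snd x)) < \<epsilon>"
      using uniform_limitD[OF sol_uniform_limit that] .
    then obtain N where N: "\<forall>n\<ge>N. \<forall>x\<in>{-\<bar>z\<bar>..\<bar>z\<bar>} \<times> {-R..R}. dist (\<Sum>k<n. fst x ^ k *\<^sub>R pic M w k (snd x)) (sol M (fst x) w (snd x)) < \<epsilon>"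
      unfolding eventually_sequentially ..
    have "norm (P n u - sol M z w u) < \<epsilon>" if "n \<ge> N" "\<bar>u\<bar> \<le> R" for n u
    proof -
      have "- \<bar>z\<bar> \<le> z \<and> z \<le> \<bar>z\<bar>" "- R \<le> u \<and> u \<le> R" using that(2) by linarith+
      then have zu: "(z, u) \<in> {-\<bar>z\<bar>..\<bar>z\<bar>} \<times> {-R..R}" by simp
      show ?thesis using bspec[OF spec[OF N, of n, THEN mp, OF that(1)] zu] by (simp add: P_def dist_norm)
    qed
    then show ?thesis by blast
  qed
  have lim: "(\<lambda>n. prim (prim (\<lambda>r. M r *v P n r)) s) \<longlonglongrightarrow> prim (prim (\<lambda>r. M r *v sol M z w r)) s"
  proof (rule LIMSEQ_I)
    fix e :: real assume e: "e > 0"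
    \<comment> \<open>Multiplication by \<open>M\<close> costs a factor K and each primitive a
      factor R; the added 1 keeps the denominator positive and the final inequality strict.\<close>
    define \<epsilon> where "\<epsilon> = e / (K * R * R + 1)"
    have pos: "K * R * R + 1 > 0" using K by (simp add: R_def add_nonneg_pos)
    then have "\<epsilon> > 0" using e by (simp add: \<epsilon>_def)
    from ul[OF this] obtain N where "\<forall>n\<ge>N. \<forall>u. \<bar>u\<bar> \<le> R \<longrightarrow> norm (P n u - sol M z w u) < \<epsilon>" ..
    then have N: "\<And>n u. n \<ge> N \<Longrightarrow> \<bar>u\<bar> \<le> R \<Longrightarrow> norm (P n u - sol M z w u) < \<epsilon>" by auto
    have "norm (prim (prim (\<lambda>r. M r *v P n r)) s - prim (prim (\<lambda>r. M r *v sol M z w r)) s) < e" if n: "n \<ge> N" for n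
    proof -
      define D where "D r = M r *v (P n r - sol M z w r)" for r
      have Dc: "continuous_on UNIV D"
        unfolding D_def by (intro continuous_Mv continuous_on_diff Pc sol_continuous)
      have "D = (\<lambda>r. M r *v P n r + (-1) *\<^sub>R (M r *v sol M z w r))"
        by (simp add: fun_eq_iff D_def matrix_vector_mult_diff_distrib)
      then have "prim (prim D) = (\<lambda>s. prim (prim (\<lambda>r. M r *v P n r)) s + (-1) *\<^sub>R prim (prim (\<lambda>r. M r *v sol M z w r)) s)"
        by (simp only: prim_add_scale continuous_Mv continuous_on_prim Pc sol_continuous)
      then have "norm (prim (prim (\<lambda>r. M r *v P n r)) s - prim (prim (\<lambda>r. M r *v sol M z w r)) s) = norm (prim (prim D) s)"
        by simp
      also have "\<dots> \<le> K * \<epsilon> * R * R"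
      proof (rule norm_prim_le_const[OF continuous_on_prim[OF Dc]])
        show "\<bar>s\<bar> \<le> R" by (simp add: R_def)
        show "norm (prim D r) \<le> K * \<epsilon> * R" if r: "\<bar>r\<bar> \<le> R" for r
        proof (rule norm_prim_le_const[OF Dc r])
          fix u assume u: "\<bar>u\<bar> \<le> R"
          have "norm (D u) \<le> K * norm (P n u - sol M z w u)" unfolding D_def by (rule K(2)[OF u])
          also have "\<dots> \<le> K * \<epsilon>" using N[OF n u] K(1) by (intro mult_left_mono) auto
          finally show "norm (D u) \<le> K * \<epsilon>" .
        qed (use K \<open>\<epsilon> > 0\<close> in simp)
        show "0 \<le> K * \<epsilon> * R" using K \<open>\<epsilon> > 0\<close> by (simp add: R_def)
      qed
      also have "\<dots> < \<epsilon> * (K * R * R + 1)" using \<open>\<epsilon> > 0\<close> by (simp add: algebra_simps)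
      also have "\<dots> = e" using pos by (simp add: \<epsilon>_def)
      finally show ?thesis .
    qed
    then show "\<exists>no. \<forall>n\<ge>no. norm (prim (prim (\<lambda>r. M r *v P n r)) s - prim (prim (\<lambda>r. M r *v sol M z w r)) s) < e" by blast
  qed
  then have "(\<lambda>n. s *\<^sub>R w - z *\<^sub>R prim (prim (\<lambda>r. M r *v P n r)) s) \<longlonglongrightarrow> s *\<^sub>R w - z *\<^sub>R prim (prim (\<lambda>r. M r *v sol M z w r)) s"
    by (intro tendsto_diff tendsto_const tendsto_scaleR)
  then show "(\<lambda>n. \<Sum>k<Suc n. z ^ k *\<^sub>R pic M w k s) \<longlonglongrightarrow> s *\<^sub>R w - z *\<^sub>R prim (prim (\<lambda>r. M r *v sol M z w r)) s"
    by (simp only: sol_partial_sums P_def)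
qed

lemma sol_deriv: "(sol M z w has_vector_derivative sol' M z w s) (at s)"
proof -
  have id: "((\<lambda>s. s *\<^sub>R w) has_vector_derivative w) (at s)"
    using bounded_linear.has_vector_derivative[OF bounded_linear_scaleR_left has_vector_derivative_id, of w "at s"] by simp
  have "((\<lambda>s. s *\<^sub>R w - z *\<^sub>R prim (prim (\<lambda>r. M r *v sol M z w r)) s) has_vector_derivative sol' M z w s) (at s)"
    unfolding sol'_def
    by (intro has_vector_derivative_diff has_vector_derivative_cscale id
        has_vector_derivative_prim continuous_on_prim continuous_Mv sol_continuous)
  then show ?thesis by (simp flip: sol_integral_equation)
qed

lemma sol'_deriv: "(sol' M z w has_vector_derivative - (z *\<^sub>R (M s *v sol M z w s))) (at s)"
proof -
  have "((\<lambda>s. w - z *\<^sub>R prim (\<lambda>r. M r *v sol M z w r) s) has_vector_derivative 0 - z *\<^sub>R (M s *v sol M z w s)) (at s)"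
    by (intro has_vector_derivative_diff has_vector_derivative_const has_vector_derivative_cscale
        has_vector_derivative_prim continuous_Mv sol_continuous)
  then show ?thesis by (simp add: sol'_def[abs_def])
qed

lemma sol_0: "sol M z w 0 = 0" and sol'_0: "sol' M z w 0 = w"
  by (subst sol_integral_equation) (simp_all add: sol'_def)

lemma sol_linear: "sol M z (v + c *\<^sub>R w) s = sol M z v s + c *\<^sub>R sol M z w s"
proof -
  have "(\<lambda>k. z ^ k *\<^sub>R pic M (v + c *\<^sub>R w) k s) = (\<lambda>k. z ^ k *\<^sub>R pic M v k s + c *\<^sub>R (z ^ k *\<^sub>R pic M w k s))"
    by (simp add: pic_linear scaleR_add_right mult.commute)
  then show ?thesis
    unfolding sol_def
    by (simp only: suminf_add[symmetric] summable_scaleR_right sol_summable suminf_scaleR_right[OF sol_summable])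
qed

lemma linear_sol: "linear (\<lambda>w. sol M z w s)"
proof (rule linearI)
  show "sol M z (v + w) s = sol M z v s + sol M z w s" for v w
    using sol_linear[of z v 1 w s] by simp
  show "sol M z (c *\<^sub>R w) s = c *\<^sub>R sol M z w s" for c w
    using sol_linear[of z 0 c w s] sol_linear[of z 0 1 0 s] by simp
qed

end

text \<open>The Wronskian p \<bullet> q' - p' \<bullet> q has derivative P \<bullet> q - p \<bullet>
  Q. With arbitrary \<open>P\<close> and \<open>Q\<close> it can also compare solutions for two
  different parameters.\<close>

lemma green_identity:
  fixes p q :: "real \<Rightarrow> real^'n"
  assumes "a \<le> b"
    and p: "\<And>s. s \<in> {a..b} \<Longrightarrow> (p has_vector_derivative p' s) (at s within {a..b})"
      "\<And>s. s \<in> {a..b} \<Longrightarrow> (p' has_vector_derivative - P s) (at s within {a..b})"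
    and q: "\<And>s. s \<in> {a..b} \<Longrightarrow> (q has_vector_derivative q' s) (at s within {a..b})"
      "\<And>s. s \<in> {a..b} \<Longrightarrow> (q' has_vector_derivative - Q s) (at s within {a..b})"
  shows "((\<lambda>s. P s \<bullet> q s - p s \<bullet> Q s) has_integral ((p b \<bullet> q' b - p' b \<bullet> q b) - (p a \<bullet> q' a - p' a \<bullet> q a))) {a..b}"
proof (rule fundamental_theorem_of_calculus[OF assms(1)])
  fix s assume s: "s \<in> {a..b}"
  have d: "((\<lambda>s. f s \<bullet> g s) has_vector_derivative f s \<bullet> g' + f' \<bullet> g s) (at s within {a..b})"
    if "(f has_vector_derivative f') (at s within {a..b})" "(g has_vector_derivative g') (at s within {a..b})"
    for f g :: "real \<Rightarrow> real^'n" and f' g'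
    by (rule bounded_bilinear.has_vector_derivative[OF bounded_bilinear_inner that])
  have "((\<lambda>s. p s \<bullet> q' s - p' s \<bullet> q s) has_vector_derivative (p s \<bullet> (- Q s) + p' s \<bullet> q' s) - (p' s \<bullet> q' s + (- P s) \<bullet> q s)) (at s within {a..b})"
    by (intro has_vector_derivative_diff d p q s)
  then show "((\<lambda>s. p s \<bullet> q' s - p' s \<bullet> q s) has_vector_derivative P s \<bullet> q s - p s \<bullet> Q s) (at s within {a..b})"
    by simp
qed

section \<open>Forward and backward solutions of symmetric systems\<close>

locale symmetric_system = system M for M :: "real \<Rightarrow> real^'n^'n" +
  assumes M_sym: "(M s *v v) \<bullet> w = v \<bullet> (M s *v w)"
begin

text \<open>Solutions of \<open>y'' = - z M y\<close> with data \<open>0, a\<close> at the point \<open>s\<close>, respectively \<open>0, - a\<close> at \<open>t\<close>.\<close>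

definition fwd :: "real \<Rightarrow> real \<Rightarrow> real^'n \<Rightarrow> real \<Rightarrow> real^'n" where
  "fwd z s a r = sol (\<lambda>u. M (s + u)) z a (r - s)"

definition fwd' :: "real \<Rightarrow> real \<Rightarrow> real^'n \<Rightarrow> real \<Rightarrow> real^'n" where
  "fwd' z s a r = sol' (\<lambda>u. M (s + u)) z a (r - s)"

definition bwd :: "real \<Rightarrow> real \<Rightarrow> real^'n \<Rightarrow> real \<Rightarrow> real^'n" where
  "bwd t z a r = sol (\<lambda>u. M (t - u)) z a (t - r)"

definition bwd' :: "real \<Rightarrow> real \<Rightarrow> real^'n \<Rightarrow> real \<Rightarrow> real^'n" where
  "bwd' t z a r = - sol' (\<lambda>u. M (t - u)) z a (t - r)"

lemma system_shift: "system (\<lambda>u. M (s + u))" and system_reflect: "system (\<lambda>u. M (s - u))"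
  by (unfold_locales, intro continuous_on_compose2[OF M_cont] continuous_intros subset_UNIV)+

lemma fwd_deriv: "(fwd z s a has_vector_derivative fwd' z s a r) (at r)"
  and fwd'_deriv: "(fwd' z s a has_vector_derivative - (z *\<^sub>R (M r *v fwd z s a r))) (at r)"
  and fwd_0: "fwd z s a s = 0" and fwd'_0: "fwd' z s a s = a"
proof -
  interpret S: system "\<lambda>u. M (s + u)" by (rule system_shift)
  have sh: "((\<lambda>r. r - s) has_real_derivative 1) (at r)" by (auto intro!: derivative_eq_intros)
  show "(fwd z s a has_vector_derivative fwd' z s a r) (at r)"
    using vector_diff_chain_at[OF sh[unfolded has_real_derivative_iff_has_vector_derivative] S.sol_deriv[of z a "r - s"]]
    by (simp add: fwd_def[abs_def] fwd'_def o_def)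
  show "(fwd' z s a has_vector_derivative - (z *\<^sub>R (M r *v fwd z s a r))) (at r)"
    using vector_diff_chain_at[OF sh[unfolded has_real_derivative_iff_has_vector_derivative] S.sol'_deriv[of z a "r - s"]]
    by (simp add: fwd_def[abs_def] fwd'_def[abs_def] o_def)
  show "fwd z s a s = 0" "fwd' z s a s = a"
    by (simp_all add: fwd_def fwd'_def S.sol_0 S.sol'_0)
qed

lemma bwd_deriv: "(bwd t z a has_vector_derivative bwd' t z a r) (at r)"
  and bwd'_deriv: "(bwd' t z a has_vector_derivative - (z *\<^sub>R (M r *v bwd t z a r))) (at r)"
  and bwd_t: "bwd t z a t = 0" and bwd'_t: "bwd' t z a t = - a"
proof -
  interpret S: system "\<lambda>u. M (t - u)" by (rule system_reflect)
  have sh: "((\<lambda>r. t - r) has_real_derivative -1) (at r)" by (auto intro!: derivative_eq_intros)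
  show "(bwd t z a has_vector_derivative bwd' t z a r) (at r)"
    using vector_diff_chain_at[OF sh[unfolded has_real_derivative_iff_has_vector_derivative] S.sol_deriv[of z a "t - r"]]
    by (simp add: bwd_def[abs_def] bwd'_def o_def)
  have "((\<lambda>r. sol' (\<lambda>u. M (t - u)) z a (t - r)) has_vector_derivative z *\<^sub>R (M r *v bwd t z a r)) (at r)"
    using vector_diff_chain_at[OF sh[unfolded has_real_derivative_iff_has_vector_derivative] S.sol'_deriv[of z a "t - r"]]
    by (simp add: bwd_def[abs_def] o_def)
  then show "(bwd' t z a has_vector_derivative - (z *\<^sub>R (M r *v bwd t z a r))) (at r)"
    unfolding bwd'_def[abs_def] by (rule has_vector_derivative_minus)
  show "bwd t z a t = 0" "bwd' t z a t = - a"
    by (simp_all add: bwd_def bwd'_def S.sol_0 S.sol'_0)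
qed

lemma bwd_continuous: "continuous_on S (bwd t z a)"
  by (meson bwd_deriv continuous_at_imp_continuous_on has_vector_derivative_continuous)

lemma fwd_continuous: "continuous_on S (fwd z s a)"
  by (meson fwd_deriv continuous_at_imp_continuous_on has_vector_derivative_continuous)

text \<open>The two functions solve the same symmetric system, so their Wronskian is constant. As
  one vanishes at \<open>t\<close> and the other at \<open>s\<close>, equating its values at these
  points leaves one term each: backward propagation is the transpose of forward propagation.\<close>

lemma bwd_eq_fwd:
  assumes "s \<le> t" shows "bwd t z a s \<bullet> b = a \<bullet> fwd z s b t"
proof -
  have "((\<lambda>r. (z *\<^sub>R (M r *v bwd t z a r)) \<bullet> fwd z s b r - bwd t z a r \<bullet> (z *\<^sub>R (M r *v fwd z s b r))) has_integral
      (bwd t z a t \<bullet> fwd' z s b t - bwd' t z a t \<bullet> fwd z s b t) - (bwd t z a s \<bullet> fwd' z s b s - bwd' t z a s \<bullet> fwd z s b s)) {s..t}"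
    by (rule green_identity[OF assms has_vector_derivative_at_within[OF bwd_deriv] has_vector_derivative_at_within[OF bwd'_deriv]
          has_vector_derivative_at_within[OF fwd_deriv] has_vector_derivative_at_within[OF fwd'_deriv]])
  then have "((\<lambda>r. 0) has_integral (a \<bullet> fwd z s b t - bwd t z a s \<bullet> b)) {s..t}"
    by (simp add: M_sym bwd_t bwd'_t fwd_0 fwd'_0)
  then show ?thesis using has_integral_unique[OF has_integral_0] by fastforce
qed

text \<open>Green's identity between the backward solution for z and the forward solution for z'.
  The case z' = z identifies the boundary term at 0, leaving an exact formula with no
  remainder.\<close>

lemma sol_difference:
  assumes "0 \<le> t"
  shows "a \<bullet> sol M z' w t - a \<bullet> sol M z w t = (z - z') * integral {0..t} (\<lambda>s. bwd t z a s \<bullet> (M s *v sol M z' w s))"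
proof -
  have gr: "((\<lambda>s. (z - z') * (bwd t z a s \<bullet> (M s *v sol M z' w s))) has_integral (a \<bullet> sol M z' w t - bwd t z a 0 \<bullet> w)) {0..t}" for z'
  proof -
    have "((\<lambda>r. (z *\<^sub>R (M r *v bwd t z a r)) \<bullet> sol M z' w r - bwd t z a r \<bullet> (z' *\<^sub>R (M r *v sol M z' w r))) has_integral
      (bwd t z a t \<bullet> sol' M z' w t - bwd' t z a t \<bullet> sol M z' w t) - (bwd t z a 0 \<bullet> sol' M z' w 0 - bwd' t z a 0 \<bullet> sol M z' w 0)) {0..t}"
      by (rule green_identity[OF assms has_vector_derivative_at_within[OF bwd_deriv] has_vector_derivative_at_within[OF bwd'_deriv]
          has_vector_derivative_at_within[OF sol_deriv] has_vector_derivative_at_within[OF sol'_deriv]])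
    then show ?thesis
      by (simp add: M_sym bwd_t bwd'_t sol_0 sol'_0 left_diff_distrib)
  qed
  have "a \<bullet> sol M z w t - bwd t z a 0 \<bullet> w = 0"
    using gr[of z] has_integral_unique[OF has_integral_0] by fastforce
  moreover have "integral {0..t} (\<lambda>s. (z - z') * (bwd t z a s \<bullet> (M s *v sol M z' w s))) = a \<bullet> sol M z' w t - bwd t z a 0 \<bullet> w"
    by (rule integral_unique[OF gr])
  ultimately show ?thesis by simp
qed

text \<open>By the exact formula of \<open>sol_difference\<close> the difference quotient is - I z',
  so differentiability reduces to continuity of the integral I.\<close>

lemma sol_deriv_parameter:
  assumes t: "0 \<le> t"
  shows "((\<lambda>z. a \<bullet> sol M z w t) has_real_derivative - integral {0..t} (\<lambda>s. bwd t z a s \<bullet> (M s *v sol M z w s))) (at z)"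
proof -
  define I where "I z' = integral {0..t} (\<lambda>s. bwd t z a s \<bullet> (M s *v sol M z' w s))" for z'
  have "continuous_on UNIV I"
    unfolding I_def[abs_def] cbox_interval[symmetric]
  proof (rule integral_continuous_on_param)
    have "continuous_on (UNIV \<times> cbox 0 t) (\<lambda>x. bwd t z a (snd x) \<bullet> (M (snd x) *v sol M (fst x) w (snd x)))"
      by (intro continuous_on_inner continuous_on_mult_vec continuous_on_compose2[OF bwd_continuous[of UNIV]]
          continuous_on_compose2[OF M_cont] continuous_on_subset[OF sol_jointly_continuous] continuous_on_snd continuous_on_id subset_UNIV)
    then show "continuous_on (UNIV \<times> cbox 0 t) (\<lambda>(z', s). bwd t z a s \<bullet> (M s *v sol M z' w s))"
      by (simp add: case_prod_beta')
  qed
  then have lim: "(I \<longlongrightarrow> I z) (at z)"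
    by (simp add: continuous_on_def)
  show ?thesis
    unfolding has_field_derivative_iff
  proof (rule Lim_transform_eventually)
    show "((\<lambda>z'. - I z') \<longlongrightarrow> - integral {0..t} (\<lambda>s. bwd t z a s \<bullet> (M s *v sol M z w s))) (at z)"
      using tendsto_minus[OF lim] by (simp add: I_def)
    have "- I z' = (a \<bullet> sol M z' w t - a \<bullet> sol M z w t) / (z' - z)" if "z' \<noteq> z" for z'
      using that sol_difference[OF t, of a z' w z] by (simp add: I_def field_simps)
    then show "\<forall>\<^sub>F z' in at z. - I z' = (a \<bullet> sol M z' w t - a \<bullet> sol M z w t) / (z' - z)"
      by (auto simp: eventually_at_filter)
  qed
qed

text \<open>Uniqueness by duality: pair y with the solution that vanishes at \<open>s\<close> and
  has derivative y s there. The Wronskian is 0 at time 0 by the initial data and equals the square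
  of y s at time \<open>s\<close>.\<close>

lemma solution_unique:
  assumes y: "\<And>s. s \<in> {0..t} \<Longrightarrow> (y has_vector_derivative y' s) (at s within {0..t})"
      "\<And>s. s \<in> {0..t} \<Longrightarrow> (y' has_vector_derivative - (M s *v y s)) (at s within {0..t})"
    and init: "y 0 = 0" "y' 0 = 0" and s: "s \<in> {0..t}"
  shows "y s = 0"
proof -
  have sub: "{0..s} \<subseteq> {0..t}" using s by auto
  define a where "a = y s"
  have "((\<lambda>r. (M r *v y r) \<bullet> fwd 1 s a r - y r \<bullet> (1 *\<^sub>R (M r *v fwd 1 s a r))) has_integral
      (y s \<bullet> fwd' 1 s a s - y' s \<bullet> fwd 1 s a s) - (y 0 \<bullet> fwd' 1 s a 0 - y' 0 \<bullet> fwd 1 s a 0)) {0..s}"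
  proof (rule green_identity[OF _ _ _ has_vector_derivative_at_within[OF fwd_deriv] has_vector_derivative_at_within[OF fwd'_deriv]])
    show "0 \<le> s" using s by simp
    show "(y has_vector_derivative y' r) (at r within {0..s})" if "r \<in> {0..s}" for r
      by (rule has_vector_derivative_within_subset[OF y(1) sub]) (use that sub in auto)
    show "(y' has_vector_derivative - (M r *v y r)) (at r within {0..s})" if "r \<in> {0..s}" for r
      by (rule has_vector_derivative_within_subset[OF y(2) sub]) (use that sub in auto)
  qed
  then have "((\<lambda>r. 0::real) has_integral (a \<bullet> a)) {0..s}"
    by (simp add: M_sym init fwd_0 fwd'_0 a_def)
  then have "a \<bullet> a = 0" using has_integral_unique[OF has_integral_0] by fastforce
  then show ?thesis by (simp add: a_def)
qed

end

section \<open>The compact part of the hessian\<close>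

lemma (in inner_space) ip_ext:
  assumes "x \<in> H" "y \<in> H" "\<And>z. z \<in> H \<Longrightarrow> ip x z = ip y z" shows "x = y"
proof -
  have "ip (x - y) (x - y) = 0" using assms by (simp add: ip_diff_left)
  then have "x - y = 0" using assms by (intro ip_definite) auto
  then show ?thesis by simp
qed

text \<open>By Bessel, only finitely many members of \<open>B\<close> have a squared coefficient of
  at least 1 / (n + 1); the set in question is the union of these finite sets.\<close>

lemma (in inner_space) countable_nonorthogonal:
  assumes B: "orthonormal B" and k: "k \<in> H"
  shows "countable {b\<in>B. ip k b \<noteq> 0}"
proof -
  have on: "ip b c = (if b = c then 1 else 0)" if "b \<in> B" "c \<in> B" for b c
    using B that by (simp add: orthonormal_def)
  have BH: "b \<in> H" if "b \<in> B" for b using B that by (auto simp: orthonormal_def)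
  have "finite {b\<in>B. (ip k b)\<^sup>2 \<ge> 1 / real (Suc n)}" for n
  proof -
    have "card G \<le> nat \<lceil>real (Suc n) * ip k k\<rceil>" if G: "G \<subseteq> {b\<in>B. (ip k b)\<^sup>2 \<ge> 1 / real (Suc n)}" "finite G" for G
    proof -
      have "real (card G) * (1 / real (Suc n)) \<le> (\<Sum>b\<in>G. (ip k b)\<^sup>2)"
        using G by (intro sum_bounded_below) auto
      also have "\<dots> \<le> ip k k"
      proof (rule bessel[of G "\<lambda>b. b"])
        have GB: "G \<subseteq> B" using G(1) by auto
        show "b \<in> H" if "b \<in> G" for b using BH GB that by auto
        show "ip b c = (if b = c then 1 else 0)" if "b \<in> G" "c \<in> G" for b c
          by (rule on) (use that GB in auto)
      qed (use G k in auto)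
      finally have "real (card G) \<le> real (Suc n) * ip k k" by (simp add: field_simps)
      then show ?thesis by linarith
    qed
    then show ?thesis using finite_if_finite_subsets_card_bdd by blast
  qed
  then have "countable (\<Union>n. {b\<in>B. (ip k b)\<^sup>2 \<ge> 1 / real (Suc n)})"
    by (intro countable_UN) (auto intro: countable_finite)
  moreover have "{b\<in>B. ip k b \<noteq> 0} \<subseteq> (\<Union>n. {b\<in>B. (ip k b)\<^sup>2 \<ge> 1 / real (Suc n)})"
  proof
    fix b assume b: "b \<in> {b\<in>B. ip k b \<noteq> 0}"
    then have "(ip k b)\<^sup>2 > 0" by simp
    then obtain n where "1 / real (Suc n) < (ip k b)\<^sup>2" by (rule nat_approx_posE)
    then show "b \<in> (\<Union>n. {b\<in>B. (ip k b)\<^sup>2 \<ge> 1 / real (Suc n)})" using b by (auto intro: less_imp_le)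
  qed
  ultimately show ?thesis by (rule countable_subset[rotated])
qed

text \<open>Double counting of the squared coefficients of the u j along \<open>B\<close>. Totality
  makes each u j contribute exactly 1, and Bessel makes each member of \<open>B\<close> contribute
  at most 1.\<close>

lemma (in inner_space) card_le_of_total:
  assumes B: "orthonormal B" "finite B" and tot: "\<And>x. \<lbrakk>x \<in> H; \<And>b. b \<in> B \<Longrightarrow> ip x b = 0\<rbrakk> \<Longrightarrow> x = 0"
    and u: "\<And>j. j < n \<Longrightarrow> u j \<in> H" "\<And>i j. \<lbrakk>i < n; j < n\<rbrakk> \<Longrightarrow> ip (u i) (u j) = (if i = j then 1 else 0)"
  shows "n \<le> card B"
proof -
  have on: "ip b c = (if b = c then 1 else 0)" if "b \<in> B" "c \<in> B" for b c
    using B(1) that by (simp add: orthonormal_def)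
  have BH: "b \<in> H" if "b \<in> B" for b using B(1) that by (auto simp: orthonormal_def)
  have full: "ip x x = (\<Sum>b\<in>B. (ip x b)\<^sup>2)" if x: "x \<in> H" for x
  proof -
    define p where "p = (\<Sum>b\<in>B. ip x b *\<^sub>R b)"
    note res = orthonormal_residual[of B "\<lambda>b. b", OF BH B(2) x on]
    have "p \<in> H" unfolding p_def using BH by auto
    then have "x - p = 0"
      using res(3) x BH by (intro tot) (auto simp: ip_diff_left p_def)
    then show ?thesis using res(2) by (simp add: p_def)
  qed
  have "real n = (\<Sum>j<n. ip (u j) (u j))" using u by simp
  also have "\<dots> = (\<Sum>j<n. \<Sum>b\<in>B. (ip (u j) b)\<^sup>2)"
    using full u(1) by (intro sum.cong) auto
  also have "\<dots> = (\<Sum>b\<in>B. \<Sum>j<n. (ip (u j) b)\<^sup>2)" by (rule sum.swap)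
  also have "\<dots> \<le> (\<Sum>b\<in>B. 1)"
  proof (rule sum_mono)
    fix b assume b: "b \<in> B"
    have "(\<Sum>j<n. (ip b (u j))\<^sup>2) \<le> ip b b"
      by (rule bessel) (use u BH[OF b] in auto)
    moreover have "(\<Sum>j<n. (ip (u j) b)\<^sup>2) = (\<Sum>j<n. (ip b (u j))\<^sup>2)"
      using u(1) BH[OF b] by (intro sum.cong) (auto simp: ip_sym)
    ultimately show "(\<Sum>j<n. (ip (u j) b)\<^sup>2) \<le> 1" using on[OF b b] by simp
  qed
  finally show ?thesis by simp
qed

context path_space
begin

text \<open>The extension by 0 is continuous because the path vanishes at both endpoints: it equals
  the path evaluated at the time clamped to the interval.\<close>

lemma H0_continuous_UNIV:
  assumes "\<xi> \<in> (H0 t :: 'n path set)" shows "continuous_on S \<xi>"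
proof -
  have "continuous_on UNIV (\<lambda>s. \<xi> (max 0 (min t s)))"
    using t_pos by (intro continuous_on_compose2[OF H0_continuous[OF assms]] continuous_intros) auto
  also have "(\<lambda>s. \<xi> (max 0 (min t s))) = \<xi>"
  proof
    fix s show "\<xi> (max 0 (min t s)) = \<xi> s"
      using H0_D[OF assms] t_pos by (cases "s \<in> {0..t}"; cases "s < 0") auto
  qed
  finally show ?thesis by (rule continuous_on_subset) simp
qed

lemma C2_in_H0:
  fixes p :: "'n path"
  assumes p: "\<And>r. r \<in> {0..t} \<Longrightarrow> (p has_vector_derivative p' r) (at r within {0..t})"
      "\<And>r. r \<in> {0..t} \<Longrightarrow> (p' has_vector_derivative p'' r) (at r within {0..t})"
    and p'': "continuous_on {0..t} p''" and bc: "p 0 = 0" "p t = 0"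
    and h: "h = (\<lambda>r. if r \<in> {0..t} then p r else 0)"
  shows "h \<in> H0 t" and "\<eta> \<in> H0 t \<Longrightarrow> H_inner t h \<eta> = - integral {0..t} (\<lambda>r. p'' r \<bullet> \<eta> r)"
proof -
  have tt: "t \<in> {0..t}" using t_pos by simp
  \<comment> \<open>A gluing at \<open>t\<close> of two equal branches; there is no corner, so the
    jump term drops out.\<close>
  have h': "h = (\<lambda>r. if r \<in> {0..t} then (if r \<le> t then p r else p r) else 0)" by (auto simp: h fun_eq_iff)
  note * = glued_in_H0[OF tt p p p'' p'' refl bc h']
  show "h \<in> H0 t" by (rule *)
  assume "\<eta> \<in> H0 t"
  then have "H_inner t h \<eta> = (p' t - p' t) \<bullet> \<eta> t - integral {0..t} (\<lambda>r. (if r \<le> t then p'' r else p'' r) \<bullet> \<eta> r)"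
    by (intro *(2))
  then show "H_inner t h \<eta> = - integral {0..t} (\<lambda>r. p'' r \<bullet> \<eta> r)" by simp
qed

text \<open>The space is infinite-dimensional, which lets an eigenbasis be indexed by all of
  \<open>nat\<close>. The sines are eigenfunctions of the second derivative: integrating by parts in
  either argument gives \<kappa>^2 times the same integral with two different \<kappa>, so that
  integral vanishes.\<close>

lemma ex_orthonormal_sequence:
  "\<exists>u :: nat \<Rightarrow> 'n path. (\<forall>j. u j \<in> H0 t) \<and> (\<forall>i j. H_inner t (u i) (u j) = (if i = j then 1 else 0))"
proof -
  define a :: "real^'n" where "a = axis undefined 1"
  have a: "a \<noteq> 0" by (simp add: a_def axis_eq_0_iff)
  define \<kappa> where "\<kappa> j = real (Suc j) * pi / t" for j
  have \<kappa>: "\<kappa> j > 0" for j using t_pos by (simp add: \<kappa>_def)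
  define p where "p j r = sin (\<kappa> j * r) *\<^sub>R a" for j r
  define v where "v j = (\<lambda>r. if r \<in> {0..t} then p j r else 0)" for j
  have d: "(p j has_vector_derivative (\<kappa> j * cos (\<kappa> j * r)) *\<^sub>R a) (at r within {0..t})"
    "((\<lambda>r. (\<kappa> j * cos (\<kappa> j * r)) *\<^sub>R a) has_vector_derivative (- (\<kappa> j)\<^sup>2) *\<^sub>R p j r) (at r within {0..t})" for j r
    unfolding p_def has_vector_derivative_def
    by (auto intro!: derivative_eq_intros simp: power2_eq_square algebra_simps)
  have pc: "continuous_on {0..t} (\<lambda>r. (- (\<kappa> j)\<^sup>2) *\<^sub>R p j r)" for j
    unfolding p_def by (intro continuous_intros)
  have "\<kappa> j * t = real (Suc j) * pi" for j using t_pos by (simp add: \<kappa>_def)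
  then have bc: "p j 0 = 0" "p j t = 0" for j by (simp_all only: p_def sin_npi) auto
  note * = C2_in_H0[OF d pc bc v_def[unfolded fun_eq_iff[symmetric]]]
  have vH: "v j \<in> H0 t" for j by (rule *(1)) 
  have ip: "H_inner t (v j) \<eta> = (\<kappa> j)\<^sup>2 * integral {0..t} (\<lambda>r. v j r \<bullet> \<eta> r)" if "\<eta> \<in> H0 t" for j \<eta>
  proof -
    have "H_inner t (v j) \<eta> = - integral {0..t} (\<lambda>r. ((- (\<kappa> j)\<^sup>2) *\<^sub>R p j r) \<bullet> \<eta> r)" by (rule *(2)[OF that])
    also have "integral {0..t} (\<lambda>r. ((- (\<kappa> j)\<^sup>2) *\<^sub>R p j r) \<bullet> \<eta> r) = integral {0..t} (\<lambda>r. (- (\<kappa> j)\<^sup>2) *\<^sub>R (v j r \<bullet> \<eta> r))"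
      by (intro Henstock_Kurzweil_Integration.integral_cong) (simp add: v_def)
    finally show ?thesis by (simp only: Henstock_Kurzweil_Integration.integral_cmul) simp
  qed
  have orth: "H_inner t (v i) (v j) = 0" if "i \<noteq> j" for i j
  proof -
    have "\<kappa> i \<noteq> \<kappa> j" using that t_pos by (simp add: \<kappa>_def)
    then have ne: "(\<kappa> i)\<^sup>2 \<noteq> (\<kappa> j)\<^sup>2" using \<kappa>[of i] \<kappa>[of j] by (simp add: power2_eq_iff)
    have e2: "H_inner t (v j) (v i) = (\<kappa> j)\<^sup>2 * integral {0..t} (\<lambda>r. v i r \<bullet> v j r)"
      using ip[OF vH, of j i] by (simp add: inner_commute)
    have "(\<kappa> i)\<^sup>2 * integral {0..t} (\<lambda>r. v i r \<bullet> v j r) = (\<kappa> j)\<^sup>2 * integral {0..t} (\<lambda>r. v i r \<bullet> v j r)"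
      by (rule trans[OF sym[OF ip[OF vH]] trans[OF ip_sym[OF vH vH] e2]])
    then have "((\<kappa> i)\<^sup>2 - (\<kappa> j)\<^sup>2) * integral {0..t} (\<lambda>r. v i r \<bullet> v j r) = 0" by (simp only: left_diff_distrib)
    then have "integral {0..t} (\<lambda>r. v i r \<bullet> v j r) = 0" using ne by (simp only: mult_eq_0_iff) simp
    then show ?thesis using ip[OF vH, of i j] by simp
  qed
  have ne: "v j \<noteq> 0" for j
  proof
    assume "v j = 0"
    \<comment> \<open>The first maximum of the sine.\<close>
    define q where "q = t / (2 * real (Suc j))"
    have "v j q = 0" using \<open>v j = 0\<close> by simp
    moreover have "q \<in> {0..t}" using t_pos by (simp add: q_def field_simps)
    moreover have "\<kappa> j * q = pi / 2" using t_pos by (simp add: \<kappa>_def q_def del: of_nat_Suc)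
    then have "sin (\<kappa> j * q) = 1" by (simp only: sin_pi_half)
    ultimately show False using a by (simp add: v_def p_def)
  qed
  have pos: "nrm (v j) \<noteq> 0" for j using ne[of j] nrm_eq_0[OF vH] by simp
  define u where "u j = (1 / nrm (v j)) *\<^sub>R v j" for j
  have "H_inner t (u i) (u j) = (if i = j then 1 else 0)" for i j
  proof (cases "i = j")
    case True
    then show ?thesis
      using pos[of j] vH nrm_square[OF vH, of j, symmetric] by (simp add: u_def ip_simps power2_eq_square)
  qed (use orth[of i j] vH in \<open>simp add: u_def ip_simps\<close>)
  moreover have "u j \<in> H0 t" for j using vH by (simp add: u_def)
  ultimately show ?thesis by blast
qed

lemma infinite_total_orthonormal:
  assumes "orthonormal B" and "\<And>x. \<lbrakk>x \<in> (H0 t :: 'n path set); \<And>b. b \<in> B \<Longrightarrow> H_inner t x b = 0\<rbrakk> \<Longrightarrow> x = 0"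
  shows "infinite B"
proof
  assume "finite B"
  obtain u :: "nat \<Rightarrow> 'n path" where u: "\<And>j. u j \<in> H0 t" "\<And>i j. H_inner t (u i) (u j) = (if i = j then 1 else 0)"
    using ex_orthonormal_sequence by metis
  have "Suc (card B) \<le> card B"
    by (rule card_le_of_total[OF assms(1) \<open>finite B\<close> assms(2), where u = u]) (use u in auto)
  then show False by simp
qed

text \<open>A nonzero path is nonzero at some rational time by continuity, so each member of
  \<open>B\<close> is nonorthogonal to a kernel at a rational time in a coordinate direction. There
  are countably many such kernels, and each meets only countably many members.\<close>

lemma countable_orthonormal:
  assumes B: "orthonormal B" shows "countable B"
proof -
  let ?N = "\<lambda>(q, j). {b\<in>B. H_inner t (kern q (axis j 1)) b \<noteq> 0}"
  have "countable (\<Union>x\<in>(\<rat> \<inter> {0..t}) \<times> (UNIV :: 'n set). ?N x)"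
  proof (rule countable_UN)
    show "countable ((\<rat> \<inter> {0..t}) \<times> (UNIV :: 'n set))"
      by (intro countable_SIGMA countable_Int1 countable_rat) auto
    show "countable (?N x)" if "x \<in> (\<rat> \<inter> {0..t}) \<times> (UNIV :: 'n set)" for x
      using that countable_nonorthogonal[OF B kern_in_H0] by auto
  qed
  moreover have "B \<subseteq> (\<Union>x\<in>(\<rat> \<inter> {0..t}) \<times> (UNIV :: 'n set). ?N x)"
  proof
    fix b assume b: "b \<in> B"
    then have bH: "b \<in> H0 t" and "H_inner t b b = 1" using B by (auto simp: orthonormal_def)
    then have "b \<noteq> 0" by auto
    then obtain s where s: "b s \<noteq> 0" by (auto simp: fun_eq_iff)
    have "open (b -` (- {0}))"
      using H0_continuous_UNIV[OF bH, of UNIV] by (intro open_vimage) auto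
    then obtain \<epsilon> where \<epsilon>: "\<epsilon> > 0" "ball s \<epsilon> \<subseteq> b -` (- {0})"
      using s unfolding open_contains_ball by (metis ComplI singletonD vimageI2)
    obtain q where q: "q \<in> \<rat>" "s < q" "q < s + \<epsilon>" using Rats_dense_in_real[of s "s + \<epsilon>"] \<epsilon>(1) by auto
    then have "q \<in> ball s \<epsilon>" by (simp add: dist_real_def)
    then have bq: "b q \<noteq> 0" using \<epsilon>(2) by auto
    then have q0: "q \<in> {0..t}" using H0_D(3)[OF bH] by auto
    obtain j where j: "b q $ j \<noteq> 0" using bq by (auto simp: vec_eq_iff)
    have "H_inner t (kern q (axis j 1)) b = b q $ j"
      using kern_reproducing[OF q0 bH] by (simp add: inner_axis' )
    then have "b \<in> ?N (q, j)" using b j by simp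
    then show "b \<in> (\<Union>x\<in>(\<rat> \<inter> {0..t}) \<times> (UNIV :: 'n set). ?N x)" using q q0 by blast
  qed
  ultimately show ?thesis by (rule countable_subset[rotated])
qed

end

section \<open>The operator representing the potential term\<close>

locale sturm = path_space t "TYPE('n::finite)" + symmetric_system M
  for t :: real and M :: "real \<Rightarrow> real^'n^'n"
begin

definition bil :: "'n path \<Rightarrow> 'n path \<Rightarrow> real" where
  "bil x y = integral {0..t} (\<lambda>s. (M s *v x s) \<bullet> y s)"

text \<open>The solution u of u'' = M \<xi> with u(0) = u(t) = 0: a double primitive, corrected by a
  linear function to vanish at \<open>t\<close>. Integration by parts then shows that it represents
  the form - \<open>bil\<close>.\<close>

definition opf :: "'n path \<Rightarrow> 'n path" where
  "opf \<xi> = (\<lambda>s. if s \<in> {0..t} then prim (prim (\<lambda>r. M r *v \<xi> r)) s - (s / t) *\<^sub>R prim (prim (\<lambda>r. M r *v \<xi> r)) t else 0)"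

lemma bil_integrable:
  assumes "continuous_on {0..t} x" "continuous_on {0..t} y"
  shows "(\<lambda>s. (M s *v x s) \<bullet> y s) integrable_on {0..t}"
  by (intro integrable_continuous_real continuous_on_inner continuous_on_mult_vec assms continuous_on_subset[OF M_cont] subset_UNIV)

lemma opf:
  assumes \<xi>: "\<xi> \<in> H0 t"
  shows opf_in_H0: "opf \<xi> \<in> H0 t" and opf_inner: "\<eta> \<in> H0 t \<Longrightarrow> H_inner t (opf \<xi>) \<eta> = - bil \<xi> \<eta>"
proof -
  let ?u = "prim (prim (\<lambda>r. M r *v \<xi> r))" and ?u' = "prim (\<lambda>r. M r *v \<xi> r)"
  have c: "continuous_on UNIV (\<lambda>r. M r *v \<xi> r)" by (intro continuous_Mv H0_continuous_UNIV \<xi>)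
  have lin: "((\<lambda>s. (s / t) *\<^sub>R ?u t) has_vector_derivative (1 / t) *\<^sub>R ?u t) (at s within {0..t})" for s
    using t_pos by (auto intro!: derivative_eq_intros simp: has_vector_derivative_def)
  have d1: "((\<lambda>s. ?u s - (s / t) *\<^sub>R ?u t) has_vector_derivative (?u' s - (1 / t) *\<^sub>R ?u t)) (at s within {0..t})" for s
    by (rule has_vector_derivative_diff[OF has_vector_derivative_at_within[OF has_vector_derivative_prim[OF continuous_on_prim[OF c]]] lin])
  have d2: "((\<lambda>s. ?u' s - (1 / t) *\<^sub>R ?u t) has_vector_derivative M s *v \<xi> s) (at s within {0..t})" for s
    using has_vector_derivative_diff[OF has_vector_derivative_at_within[OF has_vector_derivative_prim[OF c]] has_vector_derivative_const]
    by simp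
  note * = C2_in_H0[OF d1 d2 continuous_on_subset[OF c subset_UNIV] _ _ opf_def]
  show "opf \<xi> \<in> H0 t" by (rule *(1)) (use t_pos in auto)
  assume "\<eta> \<in> H0 t"
  then show "H_inner t (opf \<xi>) \<eta> = - bil \<xi> \<eta>"
    unfolding bil_def by (intro *(2)) (use t_pos in auto)
qed

lemma bil_sym: "bil x y = bil y x"
proof -
  have "(M s *v x s) \<bullet> y s = (M s *v y s) \<bullet> x s" for s
    by (subst M_sym) (rule inner_commute)
  then show ?thesis unfolding bil_def by (simp only:)
qed

lemma bil_add_left:
  assumes "x \<in> H0 t" "y \<in> H0 t" "z \<in> H0 t" shows "bil (x + y) z = bil x z + bil y z"
  unfolding bil_def using assms
  by (subst Henstock_Kurzweil_Integration.integral_add[symmetric])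
     (auto intro!: bil_integrable H0_continuous_UNIV simp: matrix_vector_right_distrib inner_add_left)

lemma bil_scale_left: "bil (c *\<^sub>R x) z = c * bil x z"
proof -
  have "(\<lambda>s. (M s *v (c *\<^sub>R x) s) \<bullet> z s) = (\<lambda>s. c *\<^sub>R ((M s *v x s) \<bullet> z s))"
    by (simp add: scaleR_fun_def matrix_vector_mult_scaleR)
  then show ?thesis unfolding bil_def by (simp only: Henstock_Kurzweil_Integration.integral_cmul) simp
qed

lemma bil_bound_ex:
  obtains K where "K \<ge> 0" "\<And>s v. s \<in> {0..t} \<Longrightarrow> norm (M s *v v) \<le> K * norm v"
    "\<And>x y c d. \<lbrakk>x \<in> H0 t; y \<in> H0 t; \<And>s. s \<in> {0..t} \<Longrightarrow> norm (x s) \<le> c; \<And>s. s \<in> {0..t} \<Longrightarrow> norm (y s) \<le> d\<rbrakk>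
      \<Longrightarrow> \<bar>bil x y\<bar> \<le> K * c * d * t"
proof -
  obtain K where K: "K \<ge> 0" "\<And>r x. \<bar>r\<bar> \<le> t \<Longrightarrow> norm (M r *v x) \<le> K * norm x"
    using obtain_bound[of t] by metis
  show thesis
  proof (rule that[OF K(1)])
    show "norm (M s *v v) \<le> K * norm v" if "s \<in> {0..t}" for s v using that by (intro K(2)) auto
    fix x y :: "'n path" and c d assume xy: "x \<in> H0 t" "y \<in> H0 t" and c: "\<And>s. s \<in> {0..t} \<Longrightarrow> norm (x s) \<le> c"
      and d: "\<And>s. s \<in> {0..t} \<Longrightarrow> norm (y s) \<le> d"
    have "norm (bil x y) \<le> integral {0..t} (\<lambda>s. K * c * d)"
      unfolding bil_def
    proof (rule Henstock_Kurzweil_Integration.integral_norm_bound_integral)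
      show "(\<lambda>s. (M s *v x s) \<bullet> y s) integrable_on {0..t}" by (intro bil_integrable H0_continuous_UNIV xy)
      show "(\<lambda>s. K * c * d) integrable_on {0..t}" by (intro integrable_continuous_real) simp
      fix s assume s: "s \<in> {0..t}"
      have "norm ((M s *v x s) \<bullet> y s) \<le> norm (M s *v x s) * norm (y s)"
        using Cauchy_Schwarz_ineq2 by simp
      also have "\<dots> \<le> (K * c) * d"
        using K(2)[of s "x s"] c[OF s] d[OF s] s K(1)
        by (intro mult_mono) (auto intro: order_trans[OF _ mult_left_mono] order_trans[OF norm_ge_zero])
      finally show "norm ((M s *v x s) \<bullet> y s) \<le> K * c * d" by simp
    qed
    then show "\<bar>bil x y\<bar> \<le> K * c * d * t" using t_pos by (simp add: mult_ac)
  qed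
qed

lemma opf_add: assumes "x \<in> H0 t" "y \<in> H0 t" shows "opf (x + y) = opf x + opf y"
  by (rule ip_ext) (use assms in \<open>auto simp: opf_in_H0 opf_inner bil_add_left ip_add_left\<close>)

lemma opf_scale: assumes "x \<in> H0 t" shows "opf (c *\<^sub>R x) = c *\<^sub>R opf x"
  by (rule ip_ext) (use assms in \<open>auto simp: opf_in_H0 opf_inner bil_scale_left ip_scale_left\<close>)

lemma opf_sym: assumes "x \<in> H0 t" "y \<in> H0 t" shows "H_inner t (opf x) y = H_inner t x (opf y)"
  using assms ip_sym[of x "opf y"] by (simp add: opf_in_H0 opf_inner bil_sym)

text \<open>The norm of \<open>opf x\<close> is controlled by the supremum norm of x alone. This is
  the source of compactness, as bounded sets of the path space are precompact for uniform
  convergence. The proof tests \<open>opf x\<close> against itself and cancels one factor.\<close>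

lemma opf_bound_ex:
  obtains C where "C \<ge> 0" "\<And>x c. \<lbrakk>x \<in> H0 t; \<And>s. s \<in> {0..t} \<Longrightarrow> norm (x s) \<le> c\<rbrakk> \<Longrightarrow> nrm (opf x) \<le> C * c"
proof -
  obtain K where K: "K \<ge> 0" "\<And>x y c d. \<lbrakk>x \<in> H0 t; y \<in> H0 t; \<And>s. s \<in> {0..t} \<Longrightarrow> norm (x s) \<le> c; \<And>s. s \<in> {0..t} \<Longrightarrow> norm (y s) \<le> d\<rbrakk>
      \<Longrightarrow> \<bar>bil x y\<bar> \<le> K * c * d * t" by (rule bil_bound_ex) (rule that; blast)
  show thesis
  proof (rule that[of "K * t * sqrt t"])
    show "0 \<le> K * t * sqrt t" using K(1) t_pos by simp
    fix x :: "'n path" and c assume x: "x \<in> H0 t" and c: "\<And>s. s \<in> {0..t} \<Longrightarrow> norm (x s) \<le> c"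
    have c0: "c \<ge> 0" using c[of 0] t_pos norm_ge_zero[of "x 0"] by (simp del: norm_ge_zero)
    have "nrm (opf x) * nrm (opf x) = - bil x (opf x)"
      using nrm_square[OF opf_in_H0[OF x]] opf_inner[OF x opf_in_H0[OF x]] by (simp add: power2_eq_square)
    also have "\<dots> \<le> K * c * (sqrt t * nrm (opf x)) * t"
      using K(2)[OF x opf_in_H0[OF x] c norm_le_H_norm[OF opf_in_H0[OF x]]] by (simp add: nrm_eq_H_norm)
    finally have "nrm (opf x) * nrm (opf x) \<le> (K * t * sqrt t * c) * nrm (opf x)" by (simp add: mult_ac)
    moreover have "0 \<le> K * t * sqrt t * c" using K(1) t_pos c0 by simp
    ultimately show "nrm (opf x) \<le> K * t * sqrt t * c"
      using nrm_nonneg[OF opf_in_H0[OF x]] by (cases "nrm (opf x) = 0") (auto simp: mult_le_cancel_right)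
  qed
qed

text \<open>The Hoelder estimate makes unit vectors equicontinuous, so Arzela-Ascoli extracts a
  uniformly convergent subsequence. Its image is Cauchy by \<open>opf_bound_ex\<close>, and
  completeness provides the limit.\<close>

lemma opf_compact:
  fixes x :: "nat \<Rightarrow> 'n path"
  assumes x: "\<And>n. x n \<in> H0 t" and unit: "\<And>n. H_inner t (x n) (x n) = 1"
  shows "\<exists>g\<in>H0 t. \<exists>k. strict_mono (k::nat\<Rightarrow>nat) \<and> tends (\<lambda>n. opf (x (k n))) g"
proof -
  have nrm1: "H_norm t (x n) = 1" for n using unit by (simp add: H_norm_def)
  obtain g k where k: "strict_mono (k::nat\<Rightarrow>nat)"
    and conv: "\<And>e. 0 < e \<Longrightarrow> \<exists>N. \<forall>n s. n \<ge> N \<and> s \<in> {0..t} \<longrightarrow> norm (x (k n) s - g s) < e"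
  proof (rule Arzela_Ascoli[of "{0..t}" x "sqrt t"])
    show "norm (x n s) \<le> sqrt t" if "s \<in> {0..t}" for n s
      using norm_le_H_norm[OF x that, of n] by (simp add: nrm1)
    fix s e :: real assume s: "s \<in> {0..t}" and e: "0 < e"
    have "norm (x n s - x n r) < e" if r: "r \<in> {0..t}" "norm (s - r) < e\<^sup>2" for n r
    proof -
      have "norm (x n s - x n r) \<le> sqrt \<bar>s - r\<bar>"
        using norm_diff_le_H_norm[OF x s r(1), of n] by (simp add: nrm1)
      also have "\<dots> < e" using r(2) e by (simp add: real_less_lsqrt)
      finally show ?thesis .
    qed
    then show "\<exists>d>0. \<forall>n r. r \<in> {0..t} \<and> norm (s - r) < d \<longrightarrow> norm (x n s - x n r) < e"
      using e by (intro exI[of _ "e\<^sup>2"]) auto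
  qed (auto intro: that)
  obtain C where C: "C \<ge> 0" "\<And>x c. \<lbrakk>x \<in> H0 t; \<And>s. s \<in> {0..t} \<Longrightarrow> norm (x s) \<le> c\<rbrakk> \<Longrightarrow> nrm (opf x) \<le> C * c"
    by (rule opf_bound_ex) (rule that; blast)
  have "\<exists>h\<in>H0 t. tends (\<lambda>n. opf (x (k n))) h"
  proof (rule complete)
    show "opf (x (k n)) \<in> H0 t" for n by (rule opf_in_H0[OF x])
    fix e :: real assume e: "e > 0"
    define d where "d = e / (4 * (C + 1))"
    have d: "d > 0" using e C by (simp add: d_def)
    from conv[OF d] obtain N where N: "\<And>n s. n \<ge> N \<Longrightarrow> s \<in> {0..t} \<Longrightarrow> norm (x (k n) s - g s) < d" by auto
    have "nrm (opf (x (k m)) - opf (x (k n))) < e" if mn: "m \<ge> N" "n \<ge> N" for m n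
    proof -
      have "opf (x (k m)) = opf (x (k m) - x (k n)) + opf (x (k n))"
        using opf_add[of "x (k m) - x (k n)" "x (k n)"] x by simp
      then have "nrm (opf (x (k m)) - opf (x (k n))) = nrm (opf (x (k m) - x (k n)))" by simp
      also have "\<dots> \<le> C * (2 * d)"
      proof (rule C(2))
        show "x (k m) - x (k n) \<in> H0 t" using x by simp
        fix s assume s: "s \<in> {0..t}"
        have "norm ((x (k m) - x (k n)) s) = norm ((x (k m) s - g s) - (x (k n) s - g s))" by (simp add: fun_diff_def)
        also have "\<dots> \<le> norm (x (k m) s - g s) + norm (x (k n) s - g s)" by (rule norm_triangle_ineq4)
        also have "\<dots> \<le> 2 * d" using N[OF mn(1) s] N[OF mn(2) s] by simp
        finally show "norm ((x (k m) - x (k n)) s) \<le> 2 * d" .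
      qed
      also have "\<dots> < (C + 1) * (4 * d)" using C(1) d by (simp add: algebra_simps add_pos_nonneg)
      also have "\<dots> = e" using C(1) by (simp add: d_def field_simps)
      finally show ?thesis .
    qed
    then show "\<exists>N. \<forall>m\<ge>N. \<forall>n\<ge>N. nrm (opf (x (k m)) - opf (x (k n))) < e" by blast
  qed
  then show ?thesis using k by auto
qed

lemma opf_bounded: "\<exists>C. \<forall>x\<in>H0 t. nrm (opf x) \<le> C * nrm x"
proof -
  obtain C where C: "C \<ge> 0" "\<And>x c. \<lbrakk>x \<in> H0 t; \<And>s. s \<in> {0..t} \<Longrightarrow> norm (x s) \<le> c\<rbrakk> \<Longrightarrow> nrm (opf x) \<le> C * c"
    by (rule opf_bound_ex) (rule that; blast)
  have "nrm (opf x) \<le> (C * sqrt t) * nrm x" if x: "x \<in> H0 t" for x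
    using C(2)[OF x norm_le_H_norm[OF x]] by (simp add: nrm_eq_H_norm mult.assoc)
  then show ?thesis by blast
qed

text \<open>The spectral theorem yields an unindexed set; being countable and infinite, it is
  enumerated bijectively by \<open>nat\<close>.\<close>

theorem ex_eigenbasis:
  "\<exists>(e :: nat \<Rightarrow> 'n path) \<nu>. (\<forall>i. e i \<in> H0 t) \<and> (\<forall>i j. H_inner t (e i) (e j) = (if i = j then 1 else 0))
     \<and> (\<forall>x\<in>H0 t. (\<forall>i. H_inner t x (e i) = 0) \<longrightarrow> x = 0) \<and> (\<forall>i. opf (e i) = \<nu> i *\<^sub>R e i)"
proof -
  obtain C where C: "\<forall>x\<in>H0 t. nrm (opf x) \<le> C * nrm x" using opf_bounded ..
  have "compact_symmetric (H0 t) (H_inner t) opf C"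
  proof (unfold_locales)
    show "nrm (opf x) \<le> C * nrm x" if "x \<in> H0 t" for x using C that by (rule bspec)
    show "\<exists>g\<in>H0 t. \<exists>k. strict_mono (k::nat\<Rightarrow>nat) \<and> tends (\<lambda>n. opf (u (k n))) g"
      if "\<And>n. u n \<in> H0 t" "\<And>n. H_inner t (u n) (u n) = 1" for u :: "nat \<Rightarrow> 'n path"
      using that by (rule opf_compact)
  qed (simp_all add: opf_in_H0 opf_add opf_scale opf_sym)
  then obtain B where B: "orthonormal B" "\<forall>b\<in>B. \<exists>\<mu>. opf b = \<mu> *\<^sub>R b" "\<forall>x\<in>H0 t. (\<forall>b\<in>B. H_inner t x b = 0) \<longrightarrow> x = 0"
    using compact_symmetric.spectral_theorem[of "H0 t" "H_inner t" opf C] by auto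
  have "infinite B"
    by (rule infinite_total_orthonormal[OF B(1)]) (use B(3) in auto)
  moreover have "countable B" by (rule countable_orthonormal[OF B(1)])
  ultimately have bij: "bij_betw (from_nat_into B) UNIV B" by (intro bij_betw_from_nat_into)
  define e where "e = from_nat_into B"
  have eB: "e i \<in> B" for i using bij by (auto simp: e_def bij_betw_def)
  have surj: "\<exists>i. b = e i" if "b \<in> B" for b using bij that by (auto simp: e_def bij_betw_def)
  have inj: "e i = e j \<longleftrightarrow> i = j" for i j using bij by (auto simp: e_def bij_betw_def inj_def)
  obtain \<nu> where \<nu>: "\<And>b. b \<in> B \<Longrightarrow> opf b = \<nu> b *\<^sub>R b" using B(2) by metis
  have "e i \<in> H0 t" for i using eB[of i] B(1) by (auto simp: orthonormal_def)
  moreover have "H_inner t (e i) (e j) = (if i = j then 1 else 0)" for i j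
    using eB[of i] eB[of j] B(1) inj[of i j] by (simp add: orthonormal_def)
  moreover have "x = 0" if "x \<in> H0 t" "\<forall>i. H_inner t x (e i) = 0" for x
    using B(3) that surj by metis
  moreover have "opf (e i) = \<nu> (e i) *\<^sub>R e i" for i by (rule \<nu>[OF eB])
  ultimately show ?thesis by (intro exI[of _ e] exI[of _ "\<lambda>i. \<nu> (e i)"]) auto
qed

end

section \<open>Traces\<close>

text \<open>An arbitrary eigenbasis rather than the one of \<open>ex_eigenbasis\<close>:
  \<open>has_determinant\<close> asks for the same product along every listing of the
  eigenvalues.\<close>

locale eigenbasis = sturm t M for t :: real and M :: "real \<Rightarrow> real^'n^'n" +
  fixes e :: "nat \<Rightarrow> 'n path" and \<nu> :: "nat \<Rightarrow> real"
  assumes e_H0: "e i \<in> H0 t"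
    and e_orthonormal: "H_inner t (e i) (e j) = (if i = j then 1 else 0)"
    and e_total: "\<lbrakk>x \<in> H0 t; \<And>i. H_inner t x (e i) = 0\<rbrakk> \<Longrightarrow> x = 0"
    and e_eigen: "opf (e i) = \<nu> i *\<^sub>R e i"
begin

lemma nu_eq: "\<nu> i = - bil (e i) (e i)"
  using opf_inner[OF e_H0 e_H0, of i i] by (simp add: e_eigen ip_scale_left e_H0 e_orthonormal)

lemma e_eval: "s \<in> {0..t} \<Longrightarrow> H_inner t (kern s a) (e i) = a \<bullet> e i s"
  by (rule kern_reproducing[OF _ e_H0])

text \<open>The numbers a \<bullet> e i s are the Fourier coefficients of \<open>kern s a\<close>,
  whose squared norm is s (t - s) / t times that of a.\<close>

lemma bessel_eval:
  assumes s: "s \<in> {0..t}" shows "(\<Sum>i<N. (a \<bullet> e i s)\<^sup>2) \<le> t * (norm a)\<^sup>2"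
proof -
  have "(\<Sum>i<N. (H_inner t (kern s a) (e i))\<^sup>2) \<le> H_inner t (kern s a) (kern s a)"
    by (rule bessel) (use e_H0 e_orthonormal kern_in_H0[OF s] in auto)
  also have "\<dots> = s * (t - s) / t * (norm a)\<^sup>2" by (rule kern_inner_kern(1)[OF s s order_refl])
  also have "\<dots> \<le> t * (norm a)\<^sup>2"
  proof (rule mult_right_mono)
    have "s * (t - s) \<le> t * t" using s by (intro mult_mono) auto
    then show "s * (t - s) / t \<le> t" using t_pos by (simp add: field_simps)
  qed simp
  finally show ?thesis using e_eval[OF s] by simp
qed

text \<open>The bound is independent of both s and N. It yields summability of the eigenvalues and,
  later, the dominating function in \<open>trace_formula\<close>.\<close>

lemma sum_norm_e:
  assumes s: "s \<in> {0..t}" shows "(\<Sum>i<N. (norm (e i s))\<^sup>2) \<le> real CARD('n) * t"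
proof -
  have "(norm x)\<^sup>2 = (\<Sum>j\<in>UNIV. (axis j 1 \<bullet> x)\<^sup>2)" for x :: "real^'n"
    unfolding power2_norm_eq_inner inner_vec_def[of x x] by (simp add: inner_axis' power2_eq_square)
  then have "(\<Sum>i<N. (norm (e i s))\<^sup>2) = (\<Sum>i<N. \<Sum>j\<in>UNIV. (axis j 1 \<bullet> e i s)\<^sup>2)" by simp
  also have "\<dots> = (\<Sum>j\<in>UNIV. \<Sum>i<N. (axis j 1 \<bullet> e i s)\<^sup>2)" by (rule sum.swap)
  also have "\<dots> \<le> (\<Sum>j\<in>(UNIV::'n set). t)"
  proof (rule sum_mono)
    fix j :: 'n
    show "(\<Sum>i<N. (axis j 1 \<bullet> e i s)\<^sup>2) \<le> t" using bessel_eval[OF s, of "axis j 1" N] by simp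
  qed
  finally show ?thesis by simp
qed

lemma quadratic_bound:
  obtains K where "K \<ge> 0" "\<And>s i. s \<in> {0..t} \<Longrightarrow> \<bar>(M s *v e i s) \<bullet> e i s\<bar> \<le> K * (norm (e i s))\<^sup>2"
proof -
  obtain K where K: "K \<ge> 0" "\<And>s v. s \<in> {0..t} \<Longrightarrow> norm (M s *v v) \<le> K * norm v"
    by (rule bil_bound_ex) (rule that; blast)
  show thesis
  proof (rule that[OF K(1)])
    fix s i assume s: "s \<in> {0..t}"
    have "\<bar>(M s *v e i s) \<bullet> e i s\<bar> \<le> norm (M s *v e i s) * norm (e i s)" by (rule Cauchy_Schwarz_ineq2)
    also have "\<dots> \<le> K * norm (e i s) * norm (e i s)" by (intro mult_right_mono K(2) s norm_ge_zero)
    finally show "\<bar>(M s *v e i s) \<bullet> e i s\<bar> \<le> K * (norm (e i s))\<^sup>2" by (simp add: power2_eq_square mult.assoc)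
  qed
qed

lemma e_continuous: "continuous_on S (e i)"
  by (rule H0_continuous_UNIV[OF e_H0])

text \<open>Since \<nu> i is minus the integral of (M e i) \<bullet> e i, a sum of absolute values
  is bounded by the integral of K times the sum of the |e i s|^2, which \<open>sum_norm_e\<close>
  bounds uniformly.\<close>

theorem summable_nu: "summable (\<lambda>i. \<bar>\<nu> i\<bar>)"
proof -
  obtain K where K: "K \<ge> 0" "\<And>s i. s \<in> {0..t} \<Longrightarrow> \<bar>(M s *v e i s) \<bullet> e i s\<bar> \<le> K * (norm (e i s))\<^sup>2"
    by (rule quadratic_bound) (rule that; blast)
  have int: "(\<lambda>s. K * (norm (e i s))\<^sup>2) integrable_on {0..t}" for i
    by (intro integrable_continuous_real continuous_on_mult continuous_on_const continuous_on_power continuous_on_norm e_continuous)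
  have "(\<Sum>i<N. \<bar>\<nu> i\<bar>) \<le> K * real CARD('n) * t * t" for N
  proof -
    have "(\<Sum>i<N. \<bar>\<nu> i\<bar>) \<le> (\<Sum>i<N. integral {0..t} (\<lambda>s. K * (norm (e i s))\<^sup>2))"
    proof (rule sum_mono)
      fix i
      have "norm (bil (e i) (e i)) \<le> integral {0..t} (\<lambda>s. K * (norm (e i s))\<^sup>2)"
        unfolding bil_def
        by (rule Henstock_Kurzweil_Integration.integral_norm_bound_integral[OF bil_integrable[OF e_continuous e_continuous] int])
          (use K(2) in simp)
      then show "\<bar>\<nu> i\<bar> \<le> integral {0..t} (\<lambda>s. K * (norm (e i s))\<^sup>2)" by (simp add: nu_eq)
    qed
    also have "\<dots> = integral {0..t} (\<lambda>s. \<Sum>i<N. K * (norm (e i s))\<^sup>2)"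
      by (rule Henstock_Kurzweil_Integration.integral_sum[symmetric]) (auto intro: int)
    also have "\<dots> \<le> integral {0..t} (\<lambda>s. K * (real CARD('n) * t))"
    proof (rule integral_le)
      show "(\<lambda>s. \<Sum>i<N. K * (norm (e i s))\<^sup>2) integrable_on {0..t}" by (rule integrable_sum) (auto intro: int)
      show "(\<lambda>s. K * (real CARD('n) * t)) integrable_on {0..t}" by (intro integrable_continuous_real) simp
      show "(\<Sum>i<N. K * (norm (e i s))\<^sup>2) \<le> K * (real CARD('n) * t)" if "s \<in> {0..t}" for s
        unfolding sum_distrib_left[symmetric] by (intro mult_left_mono sum_norm_e that K(1))
    qed
    also have "\<dots> = K * real CARD('n) * t * t" using t_pos by (simp add: mult_ac)
    finally show ?thesis .
  qed
  then show ?thesis by (intro summableI_nonneg_bounded) auto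
qed

text \<open>The path \<open>h\<close> below is \<open>(I + z f)\<^sup>-\<^sup>1 (kern s a)\<close>, so the series is the Parseval expansion
  of its inner product with \<open>kern s c\<close>.\<close>

lemma resolvent_expansion:
  assumes N: "\<And>v. sol M z (N *v v) t = v" and nz: "\<And>i. 1 + z * \<nu> i \<noteq> 0" and s: "s \<in> {0..t}"
  shows "(\<lambda>i. (a \<bullet> e i s) * (c \<bullet> e i s) / (1 + z * \<nu> i)) sums (c \<bullet> sol M z (N *v fwd z s a t) s)"
proof -
  \<comment> \<open>As \<open>N\<close> inverts the map w to sol M z w t, the function p below
    agrees at \<open>t\<close> with \<open>fwd\<close>. Hence q = p - fwd vanishes at
    \<open>t\<close>, agrees with p at \<open>s\<close>, and its derivative there differs from that
    of p by \<open>a\<close>: h is Green's function applied to \<open>a\<close>.\<close>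
  define b where "b = N *v fwd z s a t"
  define p where "p r = sol M z b r" for r
  define p' where "p' r = sol' M z b r" for r
  define p'' where "p'' r = - (z *\<^sub>R (M r *v p r))" for r
  define q where "q r = p r - fwd z s a r" for r
  define q' where "q' r = p' r - fwd' z s a r" for r
  define q'' where "q'' r = p'' r - - (z *\<^sub>R (M r *v fwd z s a r))" for r
  define h where "h = (\<lambda>r. if r \<in> {0..t} then (if r \<le> s then p r else q r) else 0)"
  have dp: "(p has_vector_derivative p' r) (at r within {0..t})" for r
    unfolding p_def[abs_def] p'_def by (rule has_vector_derivative_at_within[OF sol_deriv])
  have dp': "(p' has_vector_derivative p'' r) (at r within {0..t})" for r
    unfolding p_def p''_def p'_def[abs_def] by (rule has_vector_derivative_at_within[OF sol'_deriv])
  have dq: "(q has_vector_derivative q' r) (at r within {0..t})" for r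
    unfolding q_def[abs_def] q'_def by (rule has_vector_derivative_diff[OF dp has_vector_derivative_at_within[OF fwd_deriv]])
  have dq': "(q' has_vector_derivative q'' r) (at r within {0..t})" for r
    unfolding q'_def[abs_def] q''_def by (rule has_vector_derivative_diff[OF dp' has_vector_derivative_at_within[OF fwd'_deriv]])
  have Mc: "continuous_on {0..t} M" by (rule continuous_on_subset[OF M_cont]) simp
  have pc: "continuous_on {0..t} p''"
    unfolding p''_def p_def by (intro continuous_on_minus continuous_on_scaleR continuous_on_const continuous_on_mult_vec Mc
        continuous_on_subset[OF sol_continuous subset_UNIV])
  have qc: "continuous_on {0..t} q''"
    unfolding q''_def by (intro continuous_on_diff pc continuous_on_minus continuous_on_scaleR continuous_on_const continuous_on_mult_vec Mc
        fwd_continuous)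
  have pq: "p s = q s" "p 0 = 0" "q t = 0"
    by (simp_all add: q_def fwd_0 p_def sol_0 b_def N)
  note glue = glued_in_H0[OF s dp dp' dq dq' pc qc pq h_def]
  have hH: "h \<in> H0 t" by (rule glue(1))
  have weak: "H_inner t h \<eta> = a \<bullet> \<eta> s + z * bil h \<eta>" if \<eta>: "\<eta> \<in> H0 t" for \<eta>
  proof -
    have "H_inner t h \<eta> = (p' s - q' s) \<bullet> \<eta> s - integral {0..t} (\<lambda>r. (if r \<le> s then p'' r else q'' r) \<bullet> \<eta> r)"
      by (rule glue(2)[OF \<eta>])
    also have "p' s - q' s = a" by (simp add: q'_def fwd'_0)
    also have "integral {0..t} (\<lambda>r. (if r \<le> s then p'' r else q'' r) \<bullet> \<eta> r) = integral {0..t} (\<lambda>r. (- z) *\<^sub>R ((M r *v h r) \<bullet> \<eta> r))"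
    proof (rule Henstock_Kurzweil_Integration.integral_cong)
      fix r assume r: "r \<in> {0..t}"
      have "q'' r = - (z *\<^sub>R (M r *v q r))"
        by (simp add: q''_def p''_def q_def matrix_vector_mult_diff_distrib scaleR_diff_right)
      then show "(if r \<le> s then p'' r else q'' r) \<bullet> \<eta> r = (- z) *\<^sub>R ((M r *v h r) \<bullet> \<eta> r)"
        using r by (simp add: h_def p''_def)
    qed
    also have "\<dots> = - z * bil h \<eta>" unfolding bil_def Henstock_Kurzweil_Integration.integral_cmul by simp
    finally show ?thesis by simp
  qed
  have coeff: "H_inner t h (e i) = (a \<bullet> e i s) / (1 + z * \<nu> i)" for i
  proof -
    \<comment> \<open>Symmetry and the eigenvalue equation make the weak equation diagonal in the
      basis, so each coefficient of h can be solved for separately.\<close>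
    have "bil h (e i) = - (\<nu> i * H_inner t h (e i))"
      using opf_inner[OF e_H0 hH, of i] ip_sym[OF e_H0 hH, of i] hH
      by (simp add: e_eigen ip_scale_left e_H0 bil_sym[of h])
    then have "H_inner t h (e i) * (1 + z * \<nu> i) = a \<bullet> e i s"
      using weak[OF e_H0, of i] by (simp add: algebra_simps)
    then show ?thesis using nz[of i] by (simp add: field_simps)
  qed
  have "(\<lambda>i. H_inner t h (e i) * H_inner t (kern s c) (e i)) sums H_inner t h (kern s c)"
    by (rule parseval[OF e_H0 e_orthonormal e_total hH kern_in_H0[OF s]])
  moreover have "H_inner t h (kern s c) = c \<bullet> sol M z b s"
    using kern_reproducing[OF s hH, of c] ip_sym[OF hH kern_in_H0[OF s], of c] s by (simp add: h_def p_def)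
  ultimately show ?thesis
    by (simp add: coeff e_eval[OF s] b_def)
qed

text \<open>The i-th term is minus the integral of (M e i) \<bullet> e i / (1 + z \<nu> i). For
  fixed s these integrands sum, by \<open>resolvent_expansion\<close>, to a trace of
  \<open>M\<close> against Green's function on the diagonal; dominated convergence exchanges sum and
  integral. The right-hand side is arranged so that its integrals are the derivatives of
  \<open>sol_deriv_parameter\<close>.\<close>

theorem trace_formula:
  assumes N: "\<And>v. sol M z (N *v v) t = v" and nz: "\<And>i. \<bar>1 + z * \<nu> i\<bar> \<ge> 1 / 2"
  shows "(\<lambda>i. \<nu> i / (1 + z * \<nu> i)) sums
    (\<Sum>i\<in>UNIV. \<Sum>j\<in>UNIV. N $ j $ i * - integral {0..t} (\<lambda>s. bwd t z (axis i 1) s \<bullet> (M s *v sol M z (axis j 1) s)))"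
proof -
  have nz': "1 + z * \<nu> i \<noteq> 0" for i using nz[of i] by auto
  obtain K where K: "K \<ge> 0" "\<And>s i. s \<in> {0..t} \<Longrightarrow> \<bar>(M s *v e i s) \<bullet> e i s\<bar> \<le> K * (norm (e i s))\<^sup>2"
    by (rule quadratic_bound) (rule that; blast)
  define g where "g i s = (M s *v e i s) \<bullet> e i s / (1 + z * \<nu> i)" for i s
  define \<tau> where "\<tau> s = (\<Sum>i\<in>UNIV. \<Sum>j\<in>UNIV. N $ j $ i * (bwd t z (axis i 1) s \<bullet> (M s *v sol M z (axis j 1) s)))" for s
  have gint: "g i integrable_on {0..t}" for i
    unfolding g_def divide_inverse by (intro integrable_on_mult_left bil_integrable e_continuous)
  have g_eq: "integral {0..t} (g i) = - (\<nu> i / (1 + z * \<nu> i))" for i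
    unfolding g_def[abs_def] nu_eq[of i] bil_def divide_inverse by simp
  have gsum: "(\<lambda>i. g i s) sums \<tau> s" if s: "s \<in> {0..t}" for s
  proof -
    \<comment> \<open>Splits the quadratic form into products of two linear evaluations, the shape
      required by \<open>resolvent_expansion\<close>, with directions axis k 1 and M axis k
      1.\<close>
    have quad: "(M s *v x) \<bullet> x = (\<Sum>k\<in>UNIV. (axis k 1 \<bullet> x) * ((M s *v axis k 1) \<bullet> x))" for x :: "real^'n"
    proof -
      have "(M s *v x) \<bullet> x = (\<Sum>k\<in>UNIV. x $ k * (M s *v x) $ k)"
        by (simp add: inner_vec_def mult.commute)
      moreover have "(M s *v axis k 1) \<bullet> x = (M s *v x) $ k" for k
        by (simp add: M_sym inner_axis')
      ultimately show ?thesis by (simp add: inner_axis')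
    qed
    have "(\<lambda>i. \<Sum>k\<in>UNIV. (axis k 1 \<bullet> e i s) * ((M s *v axis k 1) \<bullet> e i s) / (1 + z * \<nu> i))
        sums (\<Sum>k\<in>UNIV. (M s *v axis k 1) \<bullet> sol M z (N *v fwd z s (axis k 1) t) s)"
      by (rule sums_sum) (rule resolvent_expansion[OF N nz' s])
    moreover have "(\<Sum>k\<in>UNIV. (axis k 1 \<bullet> e i s) * ((M s *v axis k 1) \<bullet> e i s) / (1 + z * \<nu> i)) = g i s" for i
      by (simp add: g_def quad sum_divide_distrib)
    moreover have "(\<Sum>k\<in>UNIV. (M s *v axis k 1) \<bullet> sol M z (N *v fwd z s (axis k 1) t) s) = \<tau> s"
    proof -
      have expand: "sol M z w s = (\<Sum>j\<in>UNIV. w $ j *\<^sub>R sol M z (axis j 1) s)" for w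
      proof -
        have "sol M z w s = sol M z (\<Sum>j\<in>UNIV. w $ j *s axis j 1) s" by (simp add: basis_expansion)
        also have "\<dots> = (\<Sum>j\<in>UNIV. sol M z (w $ j *s axis j 1) s)" by (rule linear_sum[OF linear_sol])
        finally show ?thesis by (simp add: scalar_mult_eq_scaleR linear_cmul[OF linear_sol])
      qed
      \<comment> \<open>Transposition moves the dependence on the starting point s from the forward
        solution to the backward one, which starts at the fixed time \<open>t\<close>.\<close>
      have fw: "fwd z s (axis k 1) t $ i = bwd t z (axis i 1) s $ k" for i k
        using bwd_eq_fwd[of s t z "axis i 1" "axis k 1"] s by (simp add: inner_axis inner_axis')
      have "(M s *v axis k 1) \<bullet> sol M z (N *v fwd z s (axis k 1) t) s
          = (\<Sum>j\<in>UNIV. \<Sum>i\<in>UNIV. N $ j $ i * (bwd t z (axis i 1) s $ k * (M s *v sol M z (axis j 1) s) $ k))" for k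
      proof -
        have "(M s *v axis k 1) \<bullet> sol M z (N *v fwd z s (axis k 1) t) s
            = (\<Sum>j\<in>UNIV. (N *v fwd z s (axis k 1) t) $ j * ((M s *v axis k 1) \<bullet> sol M z (axis j 1) s))"
          by (subst expand) (simp add: inner_sum_right)
        also have "\<dots> = (\<Sum>j\<in>UNIV. (\<Sum>i\<in>UNIV. N $ j $ i * bwd t z (axis i 1) s $ k) * (M s *v sol M z (axis j 1) s) $ k)"
          by (simp add: matrix_vector_mult_def[of N] fw M_sym inner_axis')
        finally show ?thesis by (simp add: sum_distrib_right mult.assoc)
      qed
      then have "(\<Sum>k\<in>UNIV. (M s *v axis k 1) \<bullet> sol M z (N *v fwd z s (axis k 1) t) s)
          = (\<Sum>k\<in>UNIV. \<Sum>j\<in>UNIV. \<Sum>i\<in>UNIV. N $ j $ i * (bwd t z (axis i 1) s $ k * (M s *v sol M z (axis j 1) s) $ k))"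
        by simp
      also have "\<dots> = (\<Sum>j\<in>UNIV. \<Sum>k\<in>UNIV. \<Sum>i\<in>UNIV. N $ j $ i * (bwd t z (axis i 1) s $ k * (M s *v sol M z (axis j 1) s) $ k))"
        by (rule sum.swap)
      also have "\<dots> = (\<Sum>j\<in>UNIV. \<Sum>i\<in>UNIV. \<Sum>k\<in>UNIV. N $ j $ i * (bwd t z (axis i 1) s $ k * (M s *v sol M z (axis j 1) s) $ k))"
        by (intro sum.cong refl sum.swap)
      also have "\<dots> = (\<Sum>j\<in>UNIV. \<Sum>i\<in>UNIV. N $ j $ i * (bwd t z (axis i 1) s \<bullet> (M s *v sol M z (axis j 1) s)))"
        by (simp add: inner_vec_def sum_distrib_left)
      also have "\<dots> = \<tau> s" unfolding \<tau>_def by (rule sum.swap)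
      finally show ?thesis .
    qed
    ultimately show ?thesis by simp
  qed
  have dom: "(\<lambda>N. integral {0..t} (\<lambda>s. \<Sum>i<N. g i s)) \<longlonglongrightarrow> integral {0..t} \<tau>"
  proof (rule dominated_convergence(2))
    show "(\<lambda>s. \<Sum>i<N. g i s) integrable_on {0..t}" for N by (rule integrable_sum) (auto intro: gint)
    show "(\<lambda>s. 2 * K * (real CARD('n) * t)) integrable_on {0..t}" by (intro integrable_continuous_real) simp
    show "(\<lambda>N. \<Sum>i<N. g i s) \<longlonglongrightarrow> \<tau> s" if "s \<in> {0..t}" for s using gsum[OF that] by (simp add: sums_def)
    fix N s assume s: "s \<in> {0..t}"
    have "norm (\<Sum>i<N. g i s) \<le> (\<Sum>i<N. 2 * K * (norm (e i s))\<^sup>2)"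
    proof (rule sum_norm_le)
      fix i
      have "norm (g i s) = \<bar>(M s *v e i s) \<bullet> e i s\<bar> / \<bar>1 + z * \<nu> i\<bar>" by (simp add: g_def)
      \<comment> \<open>The lower bound 1/2 on the denominators gives a dominating constant 2 K,
        uniform in i.\<close>
      also have "\<dots> \<le> (K * (norm (e i s))\<^sup>2) / (1 / 2)"
        by (intro frac_le K(2) s nz mult_nonneg_nonneg K(1)) auto
      finally show "norm (g i s) \<le> 2 * K * (norm (e i s))\<^sup>2" by simp
    qed
    also have "\<dots> \<le> 2 * K * (real CARD('n) * t)"
      unfolding sum_distrib_left[symmetric] using K(1) by (intro mult_left_mono sum_norm_e s) auto
    finally show "norm (\<Sum>i<N. g i s) \<le> 2 * K * (real CARD('n) * t)" .
  qed
  have "integral {0..t} (\<lambda>s. \<Sum>i<N. g i s) = - (\<Sum>i<N. \<nu> i / (1 + z * \<nu> i))" for N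
    by (subst Henstock_Kurzweil_Integration.integral_sum) (auto simp: gint g_eq sum_negf)
  then have "(\<lambda>i. \<nu> i / (1 + z * \<nu> i)) sums (- integral {0..t} \<tau>)"
    using tendsto_minus[OF dom] by (simp add: sums_def)
  also have "- integral {0..t} \<tau> = (\<Sum>i\<in>UNIV. \<Sum>j\<in>UNIV. N $ j $ i * - integral {0..t} (\<lambda>s. bwd t z (axis i 1) s \<bullet> (M s *v sol M z (axis j 1) s)))"
  proof -
    have int: "(\<lambda>s. N $ j $ i * (bwd t z (axis i 1) s \<bullet> (M s *v sol M z (axis j 1) s))) integrable_on {0..t}" for i j
      by (intro integrable_continuous_real continuous_on_mult continuous_on_const continuous_on_inner bwd_continuous
          continuous_on_mult_vec continuous_on_subset[OF M_cont subset_UNIV] continuous_on_subset[OF sol_continuous subset_UNIV])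
    have "integral {0..t} \<tau> = (\<Sum>i\<in>UNIV. \<Sum>j\<in>UNIV. integral {0..t} (\<lambda>s. N $ j $ i * (bwd t z (axis i 1) s \<bullet> (M s *v sol M z (axis j 1) s))))"
      unfolding \<tau>_def[abs_def]
      by (simp only: Henstock_Kurzweil_Integration.integral_sum finite_class.finite_UNIV integrable_sum int)
    also have "\<dots> = (\<Sum>i\<in>UNIV. \<Sum>j\<in>UNIV. N $ j $ i * integral {0..t} (\<lambda>s. bwd t z (axis i 1) s \<bullet> (M s *v sol M z (axis j 1) s)))"
      by simp
    finally show ?thesis by (simp add: sum_negf)
  qed
  finally show ?thesis .
qed

end

section \<open>Determinants\<close>

text \<open>At the identity matrix only the identity permutation contributes. Any other permutation
  moves at least two points, so when one factor is differentiated, an off-diagonal entry equal to 0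
  is still left in the product.\<close>

lemma det_deriv_at_one:
  fixes B :: "real \<Rightarrow> real^'n^'n"
  assumes d: "\<And>i j. ((\<lambda>x. B x $ i $ j) has_real_derivative B' i j) (at z)" and one: "B z = mat 1"
  shows "((\<lambda>x. det (B x)) has_real_derivative (\<Sum>i\<in>UNIV. B' i i)) (at z)"
proof -
  let ?P = "{p. p permutes (UNIV :: 'n set)}"
  define \<phi> where "\<phi> p h = (\<Sum>i\<in>UNIV. (B' i (p i) * h) * (\<Prod>j\<in>UNIV - {i}. B z $ j $ p j))" for p :: "'n \<Rightarrow> 'n" and h
  have dp: "((\<lambda>x. \<Prod>i\<in>UNIV. B x $ i $ p i) has_derivative \<phi> p) (at z)" for p :: "'n \<Rightarrow> 'n"
    unfolding \<phi>_def[abs_def]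
    by (rule has_derivative_prod) (use d in \<open>simp add: has_field_derivative_def\<close>)
  have "((\<lambda>x. \<Sum>p\<in>?P. of_int (sign p) * (\<Prod>i\<in>UNIV. B x $ i $ p i)) has_derivative (\<lambda>h. \<Sum>p\<in>?P. of_int (sign p) * \<phi> p h)) (at z)"
    by (rule has_derivative_sum) (rule has_derivative_mult_right[OF dp])
  moreover have "(\<Sum>p\<in>?P. of_int (sign p) * \<phi> p h) = (\<Sum>i\<in>UNIV. B' i i) * h" for h
  proof -
    have "of_int (sign p) * \<phi> p h = (if p = id then (\<Sum>i\<in>UNIV. B' i i) * h else 0)" if p: "p \<in> ?P" for p
    proof (cases "p = id")
      case True
      then show ?thesis by (simp add: \<phi>_def one mat_def sum_distrib_right)
    next
      case False
      have z: "(\<Prod>j\<in>UNIV - {i}. B z $ j $ p j) = 0" for i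
      proof -
        obtain j where j: "p j \<noteq> j" using False by (auto simp: fun_eq_iff)
        \<comment> \<open>If i itself is moved, then p i is moved too, by injectivity, and serves as
          the second point.\<close>
        have "\<exists>k. k \<noteq> i \<and> p k \<noteq> k"
        proof (cases "j = i")
          case True
          have "inj p" using p by (auto intro: permutes_inj)
          then have "p (p i) \<noteq> p i" using j True by (auto dest: injD)
          then show ?thesis using j True by (intro exI[of _ "p i"]) auto
        qed (use j in auto)
        then obtain k where "k \<noteq> i" "p k \<noteq> k" by blast
        then show ?thesis by (intro prod_zero) (auto simp: one mat_def intro!: bexI[of _ k])
      qed
      have "\<phi> p h = 0"
        unfolding \<phi>_def by (intro sum.neutral ballI) (simp only: z mult_zero_right)
      then show ?thesis using False by simp
    qed
    then have "(\<Sum>p\<in>?P. of_int (sign p) * \<phi> p h) = (\<Sum>p\<in>?P. if p = id then (\<Sum>i\<in>UNIV. B' i i) * h else 0)"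
      by (rule sum.cong[OF refl])
    also have "\<dots> = (\<Sum>i\<in>UNIV. B' i i) * h"
      by (subst sum.delta) (auto simp: finite_permutations permutes_id)
    finally show ?thesis .
  qed
  ultimately show ?thesis
    by (simp add: has_field_derivative_def det_def)
qed

text \<open>Jacobi's formula. Multiplying by the constant matrix \<open>N\<close> reduces it to the
  derivative of a determinant at the identity.\<close>

lemma det_deriv:
  fixes A :: "real \<Rightarrow> real^'n^'n" and N :: "real^'n^'n"
  assumes d: "\<And>i j. ((\<lambda>x. A x $ i $ j) has_real_derivative A' i j) (at z)" and N: "A z ** N = mat 1"
  shows "((\<lambda>x. det (A x)) has_real_derivative det (A z) * (\<Sum>i\<in>UNIV. \<Sum>j\<in>UNIV. N $ j $ i * A' i j)) (at z)"
proof -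
  have NA: "N ** A z = mat 1" using N by (simp add: matrix_left_right_inverse)
  have dd: "det (A z) * det N = 1" using N by (metis det_I det_mul)
  have "((\<lambda>x. det (N ** A x)) has_real_derivative (\<Sum>j\<in>UNIV. \<Sum>i\<in>UNIV. N $ j $ i * A' i j)) (at z)"
  proof (rule det_deriv_at_one[where B = "\<lambda>x. N ** A x" and z = z and B' = "\<lambda>i j. \<Sum>k\<in>UNIV. N $ i $ k * A' k j", OF _ NA])
    fix i j
    have "((\<lambda>x. \<Sum>k\<in>UNIV. N $ i $ k * A x $ k $ j) has_real_derivative (\<Sum>k\<in>UNIV. N $ i $ k * A' k j)) (at z)"
      by (rule DERIV_sum) (rule DERIV_cmult[OF d])
    then show "((\<lambda>x. (N ** A x) $ i $ j) has_real_derivative (\<Sum>k\<in>UNIV. N $ i $ k * A' k j)) (at z)"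
      by (simp add: matrix_matrix_mult_def)
  qed
  then have "((\<lambda>x. det (A z) * det (N ** A x)) has_real_derivative det (A z) * (\<Sum>j\<in>UNIV. \<Sum>i\<in>UNIV. N $ j $ i * A' i j)) (at z)"
    by (rule DERIV_cmult)
  moreover have "det (A z) * det (N ** A x) = det (A x)" for x
    using dd by (simp add: det_mul flip: mult.assoc)
  moreover have "(\<Sum>j\<in>UNIV. \<Sum>i\<in>UNIV. N $ j $ i * A' i j) = (\<Sum>i\<in>UNIV. \<Sum>j\<in>UNIV. N $ j $ i * A' i j)"
    by (rule sum.swap)
  ultimately show ?thesis by simp
qed

text \<open>The partial products converge uniformly on discs by the M-test, so their limit is entire
  and the logarithmic derivative may be taken term by term. The value is given as a limit of partial
  products, which covers vanishing factors as well.\<close>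

lemma entire_product:
  fixes \<nu> :: "nat \<Rightarrow> real"
  assumes \<nu>: "summable (\<lambda>i. \<bar>\<nu> i\<bar>)"
  shows "\<exists>D :: complex \<Rightarrow> complex. D holomorphic_on UNIV \<and>
    (\<forall>z. (\<lambda>n. \<Prod>k<n. 1 + z * of_real (\<nu> k)) \<longlonglongrightarrow> D z) \<and>
    (\<forall>z. D z \<noteq> 0 \<longrightarrow> (\<lambda>k. of_real (\<nu> k) / (1 + z * of_real (\<nu> k))) sums (deriv D z / D z))"
proof -
  define f where "f k z = 1 + z * complex_of_real (\<nu> k)" for k z
  define D where "D z = lim (\<lambda>n. \<Prod>k<n. f k z)" for z
  have ul: "uniform_limit (cball 0 R) (\<lambda>n z. \<Prod>k<n. f k z) D sequentially" for R
  proof -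
    have "uniformly_convergent_on (cball 0 R) (\<lambda>n z. \<Prod>k<n. 1 + z * complex_of_real (\<nu> k))"
    proof (rule Infinite_Products.uniformly_convergent_on_prod)
      show "uniformly_convergent_on (cball 0 R) (\<lambda>N z. \<Sum>k<N. norm (z * complex_of_real (\<nu> k)))"
      proof (rule Weierstrass_m_test')
        show "norm (norm (z * complex_of_real (\<nu> k))) \<le> R * \<bar>\<nu> k\<bar>" if "z \<in> cball 0 R" for k z
          using that by (simp add: norm_mult mult_right_mono)
        show "summable (\<lambda>k. R * \<bar>\<nu> k\<bar>)" using \<nu> by (rule summable_mult)
      qed
    qed (auto intro!: continuous_intros)
    then show ?thesis
      unfolding uniformly_convergent_uniform_limit_iff D_def[abs_def] f_def by simp
  qed
  have holf: "f k holomorphic_on A" for k A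
    unfolding f_def[abs_def] by (intro holomorphic_intros)
  show ?thesis
  proof (intro exI conjI allI impI)
    show "D holomorphic_on UNIV"
    proof (rule holomorphic_uniform_sequence)
      show "(\<lambda>z. \<Prod>k<n. f k z) holomorphic_on UNIV" for n by (intro holomorphic_on_prod holf)
      show "\<exists>d>0. cball x d \<subseteq> UNIV \<and> uniform_limit (cball x d) (\<lambda>n z. \<Prod>k<n. f k z) D sequentially" for x
      proof (intro exI conjI)
        show "uniform_limit (cball x 1) (\<lambda>n z. \<Prod>k<n. f k z) D sequentially"
        proof (rule uniform_limit_on_subset[OF ul])
          show "cball x 1 \<subseteq> cball 0 (norm x + 1)"
          proof
            fix y assume "y \<in> cball x 1"
            then show "y \<in> cball 0 (norm x + 1)"
              using norm_triangle_ineq2[of y x] by (simp add: dist_norm norm_minus_commute)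
          qed
        qed
      qed auto
    qed simp
    show "(\<lambda>n. \<Prod>k<n. 1 + z * of_real (\<nu> k)) \<longlonglongrightarrow> D z" for z
      using tendsto_uniform_limitI[OF ul[of "norm z"], of z] by (simp add: f_def)
    show "(\<lambda>k. of_real (\<nu> k) / (1 + z * of_real (\<nu> k))) sums (deriv D z / D z)" if "D z \<noteq> 0" for z
    proof -
      have "(\<lambda>k. deriv (f k) z / f k z) sums (deriv D z / D z)"
        by (rule logderiv_prodinf_complex_uniform_limit[where A = "ball 0 (norm z + 1)"])
          (use that in \<open>auto intro: holf uniform_limit_on_subset[OF ul[of "norm z + 1"]]\<close>)
      moreover have "deriv (f k) z = of_real (\<nu> k)" for k
        unfolding f_def[abs_def] by (rule DERIV_imp_deriv) (auto intro!: derivative_eq_intros)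
      ultimately show ?thesis by (simp add: f_def)
    qed
  qed
qed

section \<open>The fundamental matrix as an entire function of the parameter\<close>

context sturm
begin

text \<open>The matrix of w to Y_t / t for the equation with coefficient z M; at z = 1 this is the
  endomorphism of the theorem.\<close>

definition Ymat :: "real \<Rightarrow> real^'n^'n" where
  "Ymat z = matrix (\<lambda>w. (1 / t) *\<^sub>R sol M z w t)"

lemma Ymat_nth: "Ymat z $ i $ j = (axis i 1 \<bullet> sol M z (axis j 1) t) / t"
  by (simp add: Ymat_def matrix_def inner_axis')

lemma Ymat_mult: "Ymat z *v w = (1 / t) *\<^sub>R sol M z w t"
  unfolding Ymat_def
  by (rule fun_cong[OF matrix_vector_mul(2)]) (intro linear_compose_scale_right linear_sol)

lemma Ymat_0: "Ymat 0 = mat 1"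
proof -
  have "sol M 0 w t = t *\<^sub>R w" for w by (subst sol_integral_equation) simp
  then have "Ymat 0 = matrix (\<lambda>w. w)" using t_pos by (simp add: Ymat_def)
  then show ?thesis by (simp add: matrix_id_mat_1[unfolded id_def])
qed

text \<open>The entries of \<open>Ymat\<close> continued to complex z: \<open>sol\<close> takes a
  real parameter, but its power series has coefficients independent of z. \<open>Ydet\<close>
  applies the Leibniz formula to these entries.\<close>

definition entry :: "'n \<Rightarrow> 'n \<Rightarrow> complex \<Rightarrow> complex" where
  "entry i j z = (\<Sum>k. of_real (pic M (axis j 1) k t $ i / t) * z ^ k)"

definition Ydet :: "complex \<Rightarrow> complex" where
  "Ydet z = (\<Sum>p | p permutes (UNIV::'n set). of_int (sign p) * (\<Prod>i\<in>UNIV. entry i (p i) z))"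

lemma entry_sums: "(\<lambda>k. of_real (pic M (axis j 1) k t $ i / t) * z ^ k) sums entry i j z"
proof -
  obtain a where a: "summable a" "\<And>k x s. \<lbrakk>\<bar>x\<bar> \<le> norm z; \<bar>s\<bar> \<le> t\<rbrakk> \<Longrightarrow> norm (x ^ k *\<^sub>R pic M (axis j 1) k s) \<le> a k"
    using sol_majorant[of "norm z" t "axis j 1"] by metis
  have "summable (\<lambda>k. complex_of_real (pic M (axis j 1) k t $ i / t) * z ^ k)"
  proof (rule summable_comparison_test'[of "\<lambda>k. a k / t" 0])
    show "summable (\<lambda>k. a k / t)" using a(1) by (rule summable_divide)
    fix k
    have "norm (complex_of_real (pic M (axis j 1) k t $ i / t) * z ^ k) = norm z ^ k * \<bar>pic M (axis j 1) k t $ i\<bar> / t"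
      using t_pos by (simp add: norm_mult norm_power norm_divide)
    also have "\<dots> \<le> norm z ^ k * norm (pic M (axis j 1) k t) / t"
      using t_pos by (intro divide_right_mono mult_left_mono component_le_norm_cart) auto
    also have "\<dots> \<le> a k / t"
      using a(2)[of "norm z" t k] t_pos by (intro divide_right_mono) auto
    finally show "norm (complex_of_real (pic M (axis j 1) k t $ i / t) * z ^ k) \<le> a k / t" .
  qed
  then show ?thesis unfolding entry_def by (rule summable_sums)
qed

lemma Ydet_holomorphic: "Ydet holomorphic_on UNIV"
proof -
  have "entry i j holomorphic_on UNIV" for i j
  proof -
    have b: "entry i j holomorphic_on ball 0 r" for r
      by (rule power_series_holomorphic[of 0 r "\<lambda>k. of_real (pic M (axis j 1) k t $ i / t)"]) (simp only: diff_0_right entry_sums)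
    have "entry i j field_differentiable at z" for z
      using holomorphic_on_imp_differentiable_at[OF b[of "norm z + 1"], of z] by simp
    then show ?thesis by (simp add: holomorphic_on_def)
  qed
  then show ?thesis
    unfolding Ydet_def[abs_def] by (intro holomorphic_on_sum holomorphic_on_mult holomorphic_on_const holomorphic_on_prod)
qed

lemma Ydet_of_real: "Ydet (of_real x) = of_real (det (Ymat x))"
proof -
  have "entry i j (of_real x) = of_real (Ymat x $ i $ j)" for i j
  proof (rule sums_unique2[OF entry_sums])
    have "(\<lambda>k. x ^ k *\<^sub>R pic M (axis j 1) k t) sums sol M x (axis j 1) t"
      unfolding sol_def by (rule summable_sums[OF sol_summable])
    from bounded_linear.sums[OF bounded_linear_vec_nth this, of i]
    have "(\<lambda>k. x ^ k * pic M (axis j 1) k t $ i / t) sums (sol M x (axis j 1) t $ i / t)"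
      by (intro sums_divide) simp
    then have "(\<lambda>k. complex_of_real (x ^ k * pic M (axis j 1) k t $ i / t)) sums of_real (sol M x (axis j 1) t $ i / t)"
      by (simp only: sums_of_real_iff)
    then show "(\<lambda>k. complex_of_real (pic M (axis j 1) k t $ i / t) * of_real x ^ k) sums of_real (Ymat x $ i $ j)"
      by (simp add: Ymat_nth inner_axis' mult.commute)
  qed
  then show ?thesis by (simp add: Ydet_def det_def)
qed

end

section \<open>Comparison of the determinant with the product\<close>

context eigenbasis
begin

text \<open>One number S serves both sides: the trace formula gives it as the sum over eigenvalues,
  Jacobi's formula as the logarithmic derivative of the determinant.\<close>

lemma det_log_derivative:
  assumes det: "det (Ymat z) \<noteq> 0" and nz: "\<And>i. \<bar>1 + z * \<nu> i\<bar> \<ge> 1 / 2"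
  obtains S where "(\<lambda>i. \<nu> i / (1 + z * \<nu> i)) sums S"
    "((\<lambda>z. det (Ymat z)) has_real_derivative det (Ymat z) * S) (at z)"
proof -
  obtain N :: "real^'n^'n" where N: "Ymat z ** N = mat 1"
    using det invertible_det_nz[of "Ymat z"] by (auto simp: invertible_def)
  \<comment> \<open>\<open>Ymat\<close> carries a factor 1/t, whereas \<open>trace_formula\<close>
    asks for an inverse of the solution map itself; hence the division.\<close>
  define N' :: "real^'n^'n" where "N' = (\<chi> i j. N $ i $ j / t)"
  have N'v: "N' *v v = (1 / t) *\<^sub>R (N *v v)" for v
    by (simp add: N'_def matrix_vector_mult_def vec_eq_iff sum_divide_distrib)
  have inv: "sol M z (N' *v v) t = v" for v
  proof -
    have "(1 / t) *\<^sub>R sol M z (N *v v) t = v"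
      using N by (simp add: Ymat_mult[symmetric] matrix_vector_mul_assoc)
    then show ?thesis by (simp only: N'v linear_cmul[OF linear_sol])
  qed
  define W where "W i j = - integral {0..t} (\<lambda>s. bwd t z (axis i 1) s \<bullet> (M s *v sol M z (axis j 1) s))" for i j
  have dW: "((\<lambda>z. Ymat z $ i $ j) has_real_derivative W i j / t) (at z)" for i j
    unfolding Ymat_nth W_def by (rule DERIV_cdivide[OF sol_deriv_parameter]) (use t_pos in simp)
  have "(\<lambda>i. \<nu> i / (1 + z * \<nu> i)) sums (\<Sum>i\<in>UNIV. \<Sum>j\<in>UNIV. N' $ j $ i * W i j)"
    unfolding W_def by (rule trace_formula[OF inv nz])
  moreover have "N' $ j $ i * W i j = N $ j $ i * (W i j / t)" for i j by (simp add: N'_def)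
  moreover have "((\<lambda>z. det (Ymat z)) has_real_derivative det (Ymat z) * (\<Sum>i\<in>UNIV. \<Sum>j\<in>UNIV. N $ j $ i * (W i j / t))) (at z)"
    by (rule det_deriv[OF dW N])
  ultimately show thesis by (intro that) simp_all
qed

text \<open>The partial products are real for real parameters, so \<open>D\<close> restricts to a
  real function R, and E / R has derivative 0 near 0 since both logarithmic derivatives are S. At
  the end R 1 is identified with \<open>prodinf\<close>, and convergence of the product gives
  \<open>has_prod\<close> even if some factor is 0.\<close>

theorem det_eq_prod: "(\<lambda>i. 1 + \<nu> i) has_prod det (Ymat 1)"
proof -
  from entire_product[OF summable_nu] obtain D :: "complex \<Rightarrow> complex" where D0: "D holomorphic_on UNIV \<and>
    (\<forall>z. (\<lambda>n. \<Prod>k<n. 1 + z * of_real (\<nu> k)) \<longlonglongrightarrow> D z) \<and>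
    (\<forall>z. D z \<noteq> 0 \<longrightarrow> (\<lambda>k. of_real (\<nu> k) / (1 + z * of_real (\<nu> k))) sums (deriv D z / D z))" ..
  note D = D0[THEN conjunct1] D0[THEN conjunct2, THEN conjunct1, rule_format] D0[THEN conjunct2, THEN conjunct2, rule_format]
  define E where "E x = det (Ymat x)" for x
  define R where "R x = Re (D (of_real x))" for x
  have prods: "(\<lambda>n. complex_of_real (\<Prod>k<n. 1 + x * \<nu> k)) \<longlonglongrightarrow> D (of_real x)" for x
    using D(2)[of "of_real x"] by simp
  then have Rlim: "(\<lambda>n. \<Prod>k<n. 1 + x * \<nu> k) \<longlonglongrightarrow> R x" for x
    using tendsto_Re[OF prods[of x]] unfolding R_def by (simp only: Re_complex_of_real)
  have DR: "D (of_real x) = of_real (R x)" for x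
    by (rule LIMSEQ_unique[OF prods tendsto_of_real[OF Rlim]])
  have conv: "convergent_prod (\<lambda>k. 1 + x * \<nu> k)" for x
  proof (rule abs_convergent_prod_imp_convergent_prod, rule summable_imp_abs_convergent_prod)
    show "summable (\<lambda>i. norm (1 + x * \<nu> i - 1))"
      using summable_mult[OF summable_nu, of "\<bar>x\<bar>"] by (simp add: abs_mult)
  qed
  have R_prodinf: "R x = prodinf (\<lambda>k. 1 + x * \<nu> k)" for x
    using convergent_prod_LIMSEQ[OF conv, of x] Rlim[of x] unfolding LIMSEQ_lessThan_iff_atMost
    by (intro LIMSEQ_unique)
  have R_nz: "R x \<noteq> 0" if "\<And>i. 1 + x * \<nu> i \<noteq> 0" for x
    unfolding R_prodinf by (rule prodinf_nonzero[OF conv that])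
  have E0: "E 0 = 1" by (simp add: E_def Ymat_0)
  have R0: "R 0 = 1" using LIMSEQ_unique[OF Rlim[of 0], of 1] by simp
  define K where "K = (\<Sum>i. \<bar>\<nu> i\<bar>)"
  have K: "\<bar>\<nu> i\<bar> \<le> K" for i
    unfolding K_def using sum_le_suminf[OF summable_nu, of "{i}"] by simp
  have "continuous_on UNIV (\<lambda>x::real. Re (Ydet (of_real x)))"
    by (intro continuous_on_Re continuous_on_compose2[OF holomorphic_on_imp_continuous_on[OF Ydet_holomorphic]]
        continuous_on_of_real continuous_on_id) simp
  then have "continuous_on UNIV E" by (simp add: Ydet_of_real E_def[abs_def])
  then have "(E \<longlongrightarrow> E 0) (at 0)" by (simp add: continuous_on_def)
  then have "(E \<longlongrightarrow> 1) (at 0)" by (simp only: E0)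
  then have "\<forall>\<^sub>F x in at 0. E x \<noteq> 0" by (rule tendsto_imp_eventually_ne) simp
  then obtain d where d: "d > 0" "\<And>x. \<lbrakk>x \<noteq> 0; \<bar>x\<bar> < d\<rbrakk> \<Longrightarrow> E x \<noteq> 0"
    unfolding eventually_at by (auto simp: dist_real_def)
  have K0: "K \<ge> 0" using K[of 0] by linarith
  \<comment> \<open>The first bound keeps E away from 0; the second gives |x \<nu> i| \<le> K / (2
    (K + 1)) \<le> 1/2 for every i.\<close>
  define \<delta> where "\<delta> = min d (1 / (2 * (K + 1)))"
  have \<delta>: "\<delta> > 0" using d K0 by (simp add: \<delta>_def)
  have small: "\<bar>1 + x * \<nu> i\<bar> \<ge> 1 / 2" if x: "x \<in> {-\<delta><..<\<delta>}" for x i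
  proof -
    have "\<bar>x * \<nu> i\<bar> \<le> 1 / (2 * (K + 1)) * K"
      unfolding abs_mult using x K[of i] K0 by (intro mult_mono) (auto simp: \<delta>_def)
    also have "\<dots> \<le> 1 / 2" using K0 by (simp add: field_simps)
    finally show ?thesis by linarith
  qed
  have Enz: "E x \<noteq> 0" if "x \<in> {-\<delta><..<\<delta>}" for x
  proof (cases "x = 0")
    case False
    have "\<bar>x\<bar> < \<delta>" using that by auto
    also have "\<delta> \<le> d" by (simp add: \<delta>_def)
    finally show ?thesis by (rule d(2)[OF False])
  qed (use E0 in simp)
  have Rnz: "R x \<noteq> 0" if "x \<in> {-\<delta><..<\<delta>}" for x
    by (rule R_nz) (use small[OF that] in \<open>metis abs_zero half_gt_zero_iff not_less zero_less_one\<close>)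
  have quot: "((\<lambda>x. E x / R x) has_real_derivative 0) (at x within {-\<delta><..<\<delta>})" if x: "x \<in> {-\<delta><..<\<delta>}" for x
  proof -
    obtain S where S: "(\<lambda>i. \<nu> i / (1 + x * \<nu> i)) sums S" "(E has_real_derivative E x * S) (at x)"
      using det_log_derivative[of x] Enz[OF x] small[OF x] unfolding E_def[abs_def] by metis
    have Dx: "D (of_real x) \<noteq> 0" using Rnz[OF x] by (simp add: DR)
    have "(\<lambda>k. complex_of_real (\<nu> k / (1 + x * \<nu> k))) sums of_real S"
      using S(1) by (simp only: sums_of_real_iff)
    moreover have "(\<lambda>k. complex_of_real (\<nu> k / (1 + x * \<nu> k))) sums (deriv D (of_real x) / D (of_real x))"
      using D(3)[OF Dx] by simp
    ultimately have "deriv D (of_real x) / D (of_real x) = of_real S" by (rule sums_unique2[symmetric])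
    then have dD: "deriv D (of_real x) = of_real (R x * S)" using Dx by (simp add: DR field_simps)
    have "(D has_field_derivative deriv D (of_real x)) (at (of_real x))"
      using D(1) by (rule holomorphic_derivI) auto
    then have "((\<lambda>x. D (of_real x)) has_vector_derivative deriv D (of_real x)) (at x)"
      by (rule has_vector_derivative_real_field)
    from bounded_linear.has_vector_derivative[OF bounded_linear_Re this]
    have Rd: "(R has_real_derivative R x * S) (at x)"
      by (simp add: dD R_def[abs_def] has_real_derivative_iff_has_vector_derivative)
    have "((\<lambda>x. E x / R x) has_real_derivative ((E x * S) * R x - E x * (R x * S)) / (R x * R x)) (at x)"
      by (rule DERIV_divide[OF S(2) Rd Rnz[OF x]])
    moreover have "((E x * S) * R x - E x * (R x * S)) / (R x * R x) = 0" by simp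
    ultimately have "((\<lambda>x. E x / R x) has_real_derivative 0) (at x)" by (simp only:)
    then show ?thesis by (rule has_field_derivative_at_within)
  qed
  from has_field_derivative_zero_constant[OF _ quot] obtain c where c: "\<And>x. x \<in> {-\<delta><..<\<delta>} \<Longrightarrow> E x / R x = c" by auto
  have "c = 1" using c[of 0] \<delta> E0 R0 by simp
  then have ER: "E x = R x" if "x \<in> {-\<delta><..<\<delta>}" for x
    using c[OF that] Rnz[OF that] by simp
  \<comment> \<open>Agreement on a real interval with endpoint 0 is enough, since 0 is then a limit
    point of zeros of the difference.\<close>
  have "Ydet 1 - D 1 = 0"
  proof (rule analytic_continuation[of "\<lambda>z. Ydet z - D z" UNIV "of_real ` {0<..<\<delta>}" 0])
    show "(\<lambda>z. Ydet z - D z) holomorphic_on UNIV" by (intro holomorphic_on_diff Ydet_holomorphic D(1))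
    show "(0::complex) islimpt of_real ` {0<..<\<delta>}"
      unfolding islimpt_approachable
    proof (intro allI impI)
      fix \<epsilon> :: real assume "\<epsilon> > 0"
      define x where "x = min \<epsilon> \<delta> / 2"
      have x: "0 < x" "x < \<delta>" "x < \<epsilon>" using \<open>\<epsilon> > 0\<close> \<delta> by (auto simp: x_def)
      then show "\<exists>x'\<in>of_real ` {0<..<\<delta>}. x' \<noteq> 0 \<and> dist x' (0::complex) < \<epsilon>"
        by (intro bexI[of _ "of_real x"]) auto
    qed
    show "Ydet z - D z = 0" if "z \<in> of_real ` {0<..<\<delta>}" for z
      using that ER \<delta> by (auto simp: Ydet_of_real DR E_def)
  qed auto
  then have "E 1 = R 1" using Ydet_of_real[of 1] DR[of 1] by (simp add: E_def)
  also have "R 1 = prodinf (\<lambda>k. 1 + \<nu> k)" using R_prodinf[of 1] by simp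
  finally show ?thesis
    using convergent_prod_has_prod[OF conv[of 1]] by (simp add: E_def)
qed

end

section \<open>Differentials of the action\<close>

lemma line_derivative:
  fixes F :: "'a::real_normed_vector \<Rightarrow> real"
  assumes "(F has_derivative F') (at (y + s *\<^sub>R a))"
  shows "((\<lambda>s. F (y + s *\<^sub>R a)) has_real_derivative F' a) (at s)"
proof -
  have "((\<lambda>s. y + s *\<^sub>R a) has_derivative (\<lambda>h. h *\<^sub>R a)) (at s)"
    by (auto intro!: derivative_eq_intros)
  from has_derivative_compose[OF this assms]
  have "((\<lambda>s. F (y + s *\<^sub>R a)) has_derivative (\<lambda>h. F' (h *\<^sub>R a))) (at s)" .
  moreover have "F' (h *\<^sub>R a) = F' a * h" for h
    using linear_cmul[OF has_derivative_linear[OF assms], of h a] by simp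
  ultimately show ?thesis by (simp add: has_field_derivative_def)
qed

text \<open>Schwarz: the second difference is symmetric in \<open>a\<close> and \<open>b\<close>, and equals \<open>h\<^sup>2\<close> times a second derivative.\<close>

lemma second_difference:
  fixes F :: "'a::real_normed_vector \<Rightarrow> real"
  assumes G: "\<And>x. (F has_derivative (\<lambda>v. G v x)) (at x)" and H: "\<And>v x. (G v has_derivative (\<lambda>w. H v w x)) (at x)"
    and h: "h > 0"
  shows "\<exists>y. norm (y - x) \<le> h * (norm a + norm b) \<and>
    F (x + h *\<^sub>R a + h *\<^sub>R b) - F (x + h *\<^sub>R a) - F (x + h *\<^sub>R b) + F x = h\<^sup>2 * H a b y"
proof -
  define \<phi> where "\<phi> s = F ((x + h *\<^sub>R b) + s *\<^sub>R a) - F (x + s *\<^sub>R a)" for s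
  have "\<exists>s. 0 < s \<and> s < h \<and> \<phi> h - \<phi> 0 = (h - 0) * (G a ((x + h *\<^sub>R b) + s *\<^sub>R a) - G a (x + s *\<^sub>R a))"
    unfolding \<phi>_def by (rule MVT2[OF h]) (intro DERIV_diff line_derivative G)
  then obtain s where s: "0 < s" "s < h" "\<phi> h - \<phi> 0 = h * (G a ((x + h *\<^sub>R b) + s *\<^sub>R a) - G a (x + s *\<^sub>R a))" by auto
  define \<psi> where "\<psi> r = G a ((x + s *\<^sub>R a) + r *\<^sub>R b)" for r
  have "\<exists>r. 0 < r \<and> r < h \<and> \<psi> h - \<psi> 0 = (h - 0) * H a b ((x + s *\<^sub>R a) + r *\<^sub>R b)"
    unfolding \<psi>_def by (rule MVT2[OF h]) (intro line_derivative H)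
  then obtain r where r: "0 < r" "r < h" "\<psi> h - \<psi> 0 = h * H a b ((x + s *\<^sub>R a) + r *\<^sub>R b)" by auto
  show ?thesis
  proof (intro exI conjI)
    have "norm ((x + s *\<^sub>R a) + r *\<^sub>R b - x) \<le> s * norm a + r * norm b"
      using norm_triangle_ineq[of "s *\<^sub>R a" "r *\<^sub>R b"] s r by (simp add: algebra_simps)
    also have "\<dots> \<le> h * norm a + h * norm b"
      using s r by (intro add_mono mult_right_mono) auto
    finally show "norm ((x + s *\<^sub>R a) + r *\<^sub>R b - x) \<le> h * (norm a + norm b)" by (simp add: distrib_left)
    have "F (x + h *\<^sub>R a + h *\<^sub>R b) - F (x + h *\<^sub>R a) - F (x + h *\<^sub>R b) + F x = \<phi> h - \<phi> 0"
      by (simp add: \<phi>_def add.commute add.left_commute)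
    also have "\<dots> = h * (\<psi> h - \<psi> 0)"
      unfolding s(3) \<psi>_def by (simp add: add.commute add.left_commute)
    finally show "F (x + h *\<^sub>R a + h *\<^sub>R b) - F (x + h *\<^sub>R a) - F (x + h *\<^sub>R b) + F x = h\<^sup>2 * H a b ((x + s *\<^sub>R a) + r *\<^sub>R b)"
      unfolding r(3) by (simp add: power2_eq_square)
  qed
qed

lemma second_derivative_symmetric:
  fixes F :: "'a::real_normed_vector \<Rightarrow> real"
  assumes G: "\<And>x. (F has_derivative (\<lambda>v. G v x)) (at x)" and H: "\<And>v x. (G v has_derivative (\<lambda>w. H v w x)) (at x)"
    and cont: "\<And>v w. continuous_on UNIV (H v w)"
  shows "H a b x = H b a x"
proof -
  define h :: "nat \<Rightarrow> real" where "h n = 1 / Suc n" for n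
  have h: "h n > 0" for n by (simp add: h_def)
  define \<Delta> where "\<Delta> a b n = F (x + h n *\<^sub>R a + h n *\<^sub>R b) - F (x + h n *\<^sub>R a) - F (x + h n *\<^sub>R b) + F x" for a b n
  have lim: "(\<lambda>n. \<Delta> a b n / (h n)\<^sup>2) \<longlonglongrightarrow> H a b x" for a b
  proof -
    obtain y where y: "\<And>n. norm (y n - x) \<le> h n * (norm a + norm b)" "\<And>n. \<Delta> a b n = (h n)\<^sup>2 * H a b (y n)"
      using second_difference[OF G H h, where x = x and a = a and b = b] unfolding \<Delta>_def by metis
    have "(\<lambda>n. y n - x) \<longlonglongrightarrow> 0"
    proof (rule Lim_null_comparison)
      show "\<forall>\<^sub>F n in sequentially. norm (y n - x) \<le> h n * (norm a + norm b)" using y(1) by simp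
      show "(\<lambda>n. h n * (norm a + norm b)) \<longlonglongrightarrow> 0"
        unfolding h_def by (intro tendsto_mult_left_zero LIMSEQ_Suc[OF lim_1_over_n])
    qed
    then have "y \<longlonglongrightarrow> x" by (rule LIM_zero_cancel)
    then have "(\<lambda>n. H a b (y n)) \<longlonglongrightarrow> H a b x"
      using continuous_on_tendsto_compose[OF cont, of y x sequentially] by simp
    moreover have "\<Delta> a b n / (h n)\<^sup>2 = H a b (y n)" for n
      using y(2)[of n] h[of n] by simp
    ultimately show ?thesis by simp
  qed
  have "\<Delta> a b = \<Delta> b a" by (simp add: \<Delta>_def fun_eq_iff add.commute add.left_commute)
  then show ?thesis using LIMSEQ_unique[OF lim[of a b]] lim[of b a] by simp
qed

text \<open>The derivative is uniformly continuous on a compact ball, so the mean value inequality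
  gives one \<delta> for all base points. Applied along a path, this makes the remainder small
  uniformly in time.\<close>

lemma uniform_linearization:
  fixes f :: "'a::euclidean_space \<Rightarrow> 'b::real_normed_vector"
  assumes d: "\<And>x. (f has_derivative f' x) (at x)" and cont: "\<And>v. continuous_on UNIV (\<lambda>x. f' x v)"
    and \<epsilon>: "\<epsilon> > 0"
  shows "\<exists>\<delta>>0. \<forall>p u. norm p \<le> R \<longrightarrow> norm u < \<delta> \<longrightarrow> norm (f (p + u) - f p - f' p u) \<le> \<epsilon> * norm u"
proof -
  \<comment> \<open>The derivative is compared on each basis vector, and the errors add up over the
    basis.\<close>
  define \<epsilon>' where "\<epsilon>' = \<epsilon> / DIM('a)"
  have \<epsilon>': "\<epsilon>' > 0" using \<epsilon> by (simp add: \<epsilon>'_def)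
  have "\<forall>i\<in>Basis. \<exists>\<delta>>0. \<forall>x\<in>cball 0 (R + 1). \<forall>y\<in>cball 0 (R + 1). dist y x < \<delta> \<longrightarrow> dist (f' y i) (f' x i) < \<epsilon>'"
  proof
    fix i :: 'a
    have "uniformly_continuous_on (cball 0 (R + 1)) (\<lambda>x. f' x i)"
      by (intro compact_uniformly_continuous continuous_on_subset[OF cont]) auto
    then show "\<exists>\<delta>>0. \<forall>x\<in>cball 0 (R + 1). \<forall>y\<in>cball 0 (R + 1). dist y x < \<delta> \<longrightarrow> dist (f' y i) (f' x i) < \<epsilon>'"
      using \<epsilon>' unfolding uniformly_continuous_on_def by simp
  qed
  then obtain \<delta> where \<delta>: "\<And>i. i \<in> Basis \<Longrightarrow> \<delta> i > 0"
    "\<And>i x y. \<lbrakk>i \<in> Basis; x \<in> cball 0 (R + 1); y \<in> cball 0 (R + 1); dist y x < \<delta> i\<rbrakk> \<Longrightarrow> dist (f' y i) (f' x i) < \<epsilon>'"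
    by metis
  \<comment> \<open>The cap 1 keeps all intermediate points in the ball of radius R + 1.\<close>
  define D where "D = Min (insert 1 (\<delta> ` Basis))"
  have D: "D > 0" "D \<le> 1" using \<delta>(1) by (auto simp: D_def)
  have D3: "D \<le> \<delta> i" if "i \<in> Basis" for i unfolding D_def by (rule Min_le) (use that in auto)
  have "norm (f (p + u) - f p - f' p u) \<le> \<epsilon> * norm u" if p: "norm p \<le> R" and u: "norm u < D" for p u
  proof -
    have lin: "linear (f' x)" for x by (rule has_derivative_linear[OF d])
    have expand: "f' x v = (\<Sum>i\<in>Basis. (v \<bullet> i) *\<^sub>R f' x i)" for x v
    proof -
      have "f' x v = f' x (\<Sum>i\<in>Basis. (v \<bullet> i) *\<^sub>R i)" by (simp add: euclidean_representation)
      then show ?thesis by (simp add: linear_sum[OF lin] linear_cmul[OF lin])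
    qed
    have "norm (f (p + u) - f p - f' p ((p + u) - p)) \<le> norm ((p + u) - p) * \<epsilon>"
    proof (rule differentiable_bound_linearization[where S = "ball p D" and f' = f'])
      show "p + r *\<^sub>R (p + u - p) \<in> ball p D" if "r \<in> {0..1}" for r
      proof -
        have "\<bar>r\<bar> * norm u \<le> 1 * norm u" using that by (intro mult_right_mono) auto
        then show ?thesis using u by (simp add: dist_norm)
      qed
      show "(f has_derivative f' x) (at x within ball p D)" for x by (rule has_derivative_at_withinI[OF d])
      show "p \<in> ball p D" using D by simp
      fix x assume x: "x \<in> ball p D"
      have "norm x \<le> R + 1"
        using x p D norm_triangle_ineq2[of x p] by (simp add: dist_norm norm_minus_commute)
      then have cb: "x \<in> cball 0 (R + 1)" "p \<in> cball 0 (R + 1)" using p by auto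
      have bas: "norm (f' x i - f' p i) \<le> \<epsilon>'" if "i \<in> Basis" for i
        using \<delta>(2)[OF that cb(2) cb(1)] x D3[OF that] by (simp add: dist_norm norm_minus_commute)
      have "norm ((f' x - f' p) v) \<le> \<epsilon> * norm v" for v
      proof -
        have "(f' x - f' p) v = (\<Sum>i\<in>Basis. (v \<bullet> i) *\<^sub>R (f' x i - f' p i))"
          using expand[of x v] expand[of p v] by (simp add: scaleR_diff_right sum_subtractf)
        also have "norm \<dots> \<le> (\<Sum>i\<in>(Basis::'a set). norm v * \<epsilon>')"
        proof (rule sum_norm_le)
          fix i :: 'a assume i: "i \<in> Basis"
          have "\<bar>v \<bullet> i\<bar> * norm (f' x i - f' p i) \<le> norm v * \<epsilon>'"
            using Basis_le_norm[OF i] bas[OF i] \<epsilon>' by (intro mult_mono) auto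
          then show "norm ((v \<bullet> i) *\<^sub>R (f' x i - f' p i)) \<le> norm v * \<epsilon>'" by simp
        qed
        also have "\<dots> = \<epsilon> * norm v" by (simp add: \<epsilon>'_def)
        finally show ?thesis .
      qed
      then show "onorm (f' x - f' p) \<le> \<epsilon>" by (intro onorm_le)
    qed
    then show ?thesis by (simp add: mult.commute)
  qed
  then show ?thesis using D(1) by blast
qed

definition grad :: "(real^'n \<Rightarrow> real) \<Rightarrow> real^'n \<Rightarrow> real^'n" where
  "grad V x = (\<chi> i. frechet_derivative V (at x) (axis i 1))"

section \<open>Gradient and hessian of the potential\<close>

locale C3 =
  fixes V :: "real^'n \<Rightarrow> real"
  assumes C3: "C_k 3 V"
begin

lemma V_deriv: "(V has_derivative (\<lambda>v. frechet_derivative V (at x) v)) (at x)"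
  using C3 by (simp add: numeral_3_eq_3 frechet_derivative_works)

lemma V'_deriv: "((\<lambda>x. frechet_derivative V (at x) v) has_derivative
    (\<lambda>w. frechet_derivative (\<lambda>y. frechet_derivative V (at y) v) (at x) w)) (at x)"
  using C3 by (simp add: numeral_3_eq_3 flip: frechet_derivative_works)

text \<open>The third level of \<open>C_k\<close> makes the second derivatives differentiable, hence
  continuous.\<close>

lemma V''_continuous: "continuous_on UNIV (\<lambda>x. frechet_derivative (\<lambda>y. frechet_derivative V (at y) v) (at x) w)"
  using C3 by (auto simp: numeral_3_eq_3 intro!: differentiable_imp_continuous_on differentiable_at_imp_differentiable_on)

lemma hessian_nth: "hessian_matrix V x $ i $ j = frechet_derivative (\<lambda>y. frechet_derivative V (at y) (axis j 1)) (at x) (axis i 1)"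
  by (simp add: hessian_matrix_def)

lemma hessian_symmetric: "hessian_matrix V x $ i $ j = hessian_matrix V x $ j $ i"
  unfolding hessian_nth by (rule second_derivative_symmetric[OF V_deriv V'_deriv V''_continuous])

lemma hessian_self_adjoint: "(hessian_matrix V x *v v) \<bullet> w = v \<bullet> (hessian_matrix V x *v w)"
proof -
  have "transpose (hessian_matrix V x) = hessian_matrix V x"
    by (simp add: transpose_def vec_eq_iff hessian_symmetric[of x])
  then show ?thesis by (metis dot_lmul_matrix vector_transpose_matrix)
qed

lemma hessian_continuous: "continuous_on UNIV (hessian_matrix V)"
  unfolding hessian_matrix_def[abs_def] by (intro continuous_on_vec_lambda V''_continuous)

lemma grad_eq: "frechet_derivative V (at x) v = grad V x \<bullet> v"
proof -
  have lin: "linear (frechet_derivative V (at x))" by (rule has_derivative_linear[OF V_deriv])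
  have "frechet_derivative V (at x) v = frechet_derivative V (at x) (\<Sum>i\<in>UNIV. v $ i *s axis i 1)"
    by (simp add: basis_expansion)
  also have "\<dots> = (\<Sum>i\<in>UNIV. v $ i * frechet_derivative V (at x) (axis i 1))"
    by (simp add: linear_sum[OF lin] scalar_mult_eq_scaleR linear_cmul[OF lin])
  also have "\<dots> = grad V x \<bullet> v" by (simp add: grad_def inner_vec_def mult.commute)
  finally show ?thesis .
qed

lemma grad_deriv: "(grad V has_derivative (\<lambda>v. hessian_matrix V x *v v)) (at x)"
proof -
  have "((\<lambda>x. grad V x $ i) has_derivative (\<lambda>v. (hessian_matrix V x *v v) $ i)) (at x)" for i
  proof -
    define L where "L = frechet_derivative (\<lambda>y. frechet_derivative V (at y) (axis i 1)) (at x)"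
    have d: "((\<lambda>x. grad V x $ i) has_derivative L) (at x)"
      unfolding grad_def L_def using V'_deriv[of "axis i 1" x] by simp
    have lin: "linear L" by (rule has_derivative_linear[OF d])
    have "L v = (hessian_matrix V x *v v) $ i" for v
    proof -
      have "L v = L (\<Sum>j\<in>UNIV. v $ j *s axis j 1)" by (simp add: basis_expansion)
      also have "\<dots> = (\<Sum>j\<in>UNIV. v $ j * L (axis j 1))"
        by (simp add: linear_sum[OF lin] scalar_mult_eq_scaleR linear_cmul[OF lin])
      also have "\<dots> = (\<Sum>j\<in>UNIV. v $ j * hessian_matrix V x $ j $ i)" by (simp add: L_def hessian_nth)
      \<comment> \<open>The row index of \<open>hessian_matrix\<close> is the direction of the outer
        derivative, so differentiating the i-th component of the gradient gives column i; symmetry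
        turns it into row i.\<close>
      also have "\<dots> = (\<Sum>j\<in>UNIV. hessian_matrix V x $ i $ j * v $ j)"
        by (intro sum.cong refl) (simp add: hessian_symmetric[of x _ i] mult.commute)
      finally show ?thesis by (simp add: matrix_vector_mult_def)
    qed
    then have "L = (\<lambda>v. (hessian_matrix V x *v v) $ i)" by (rule ext)
    then show ?thesis using d by simp
  qed
  then show ?thesis
    by (subst has_derivative_componentwise_within) (auto simp: Basis_vec_def inner_axis)
qed

lemma grad_continuous: "continuous_on S (grad V)"
  by (meson continuous_at_imp_continuous_on grad_deriv has_derivative_continuous)

lemma V_continuous: "continuous_on S V"
  by (meson continuous_at_imp_continuous_on V_deriv has_derivative_continuous)

end

text \<open>A version for velocities of paths with arbitrary endpoints, which lie outside the
  carrier \<open>H0 t\<close> of the abstract inequality.\<close>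

lemma L2_cauchy_schwarz:
  assumes v: "L2 t v" and w: "L2 t w"
  shows "\<bar>LINT s|lebesgue_on {0..t}. v s \<bullet> w s\<bar>
    \<le> sqrt (LINT s|lebesgue_on {0..t}. v s \<bullet> v s) * sqrt (LINT s|lebesgue_on {0..t}. w s \<bullet> w s)"
proof -
  let ?I = "\<lambda>v w. LINT s|lebesgue_on {0..t}. v s \<bullet> w s"
  note int = L2_inner_integrable[OF v v] L2_inner_integrable[OF v w] L2_inner_integrable[OF w w]
  have nn: "0 \<le> ?I v v" "0 \<le> ?I w w" by (auto intro!: integral_nonneg_AE)
  have quad: "0 \<le> ?I v v - 2 * l * ?I v w + l\<^sup>2 * ?I w w" for l
  proof -
    have "0 \<le> (LINT s|lebesgue_on {0..t}. (v s - l *\<^sub>R w s) \<bullet> (v s - l *\<^sub>R w s))"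
      by (auto intro!: integral_nonneg_AE)
    also have "(\<lambda>s. (v s - l *\<^sub>R w s) \<bullet> (v s - l *\<^sub>R w s)) = (\<lambda>s. v s \<bullet> v s - 2 * l * (v s \<bullet> w s) + l\<^sup>2 * (w s \<bullet> w s))"
      by (simp add: fun_eq_iff inner_diff inner_commute power2_eq_square algebra_simps)
    also have "(LINT s|lebesgue_on {0..t}. v s \<bullet> v s - 2 * l * (v s \<bullet> w s) + l\<^sup>2 * (w s \<bullet> w s)) = ?I v v - 2 * l * ?I v w + l\<^sup>2 * ?I w w"
      using int by simp
    finally show ?thesis .
  qed
  have "(?I v w)\<^sup>2 \<le> ?I v v * ?I w w"
  proof (cases "?I w w = 0")
    case True
    have "?I v w = 0"
    proof (rule ccontr)
      assume ne: "?I v w \<noteq> 0"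
      \<comment> \<open>With this coefficient and vanishing leading term the quadratic polynomial
        takes the value -1.\<close>
      have "2 * ((?I v v + 1) / (2 * ?I v w)) * ?I v w = ?I v v + 1" using ne by simp
      then show False using quad[of "(?I v v + 1) / (2 * ?I v w)"] True by simp
    qed
    then show ?thesis using True by simp
  next
    case False
    then have pos: "?I w w > 0" using nn by linarith
    have "?I v v - 2 * (?I v w / ?I w w) * ?I v w + (?I v w / ?I w w)\<^sup>2 * ?I w w = ?I v v - (?I v w)\<^sup>2 / ?I w w"
      using pos by (simp add: power2_eq_square field_simps)
    with quad[of "?I v w / ?I w w"] have "(?I v w)\<^sup>2 / ?I w w \<le> ?I v v" by linarith
    then show ?thesis using pos by (simp add: pos_divide_le_eq)
  qed
  then show ?thesis
    unfolding real_sqrt_mult[symmetric] by (intro real_le_rsqrt) simp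
qed

section \<open>Uniqueness of first and second differentials\<close>

context path_space
begin

lemma H_space_add:
  fixes \<zeta> \<eta> :: "'n path"
  assumes "\<zeta> \<in> H_space t x y" "\<eta> \<in> H0 t" shows "(\<lambda>s. \<zeta> s + \<eta> s) \<in> H_space t x y"
proof -
  have "has_L2_derivative t (\<lambda>s. \<zeta> s + \<eta> s) (\<lambda>s. velocity t \<zeta> s + velocity t \<eta> s)"
    by (intro has_L2_derivative_add H0_velocity[OF assms(1)] H0_velocity[OF assms(2)])
  then show ?thesis using assms unfolding H_space_def by auto
qed

lemma H_norm_scale: "\<xi> \<in> (H0 t :: 'n path set) \<Longrightarrow> H_norm t (\<lambda>s. c *\<^sub>R \<xi> s) = \<bar>c\<bar> * H_norm t \<xi>"
  using nrm_scale[of \<xi> c] by (simp add: nrm_eq_H_norm scaleR_fun_def)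

lemma small_multiple:
  fixes \<xi> :: "'n path"
  assumes "\<xi> \<in> H0 t" "\<delta> > 0" obtains c where "c > 0" "H_norm t (\<lambda>s. c *\<^sub>R \<xi> s) < \<delta>" "(\<lambda>s. c *\<^sub>R \<xi> s) \<in> H0 t"
proof -
  define c where "c = \<delta> / (2 * (H_norm t \<xi> + 1))"
  have n: "H_norm t \<xi> \<ge> 0" using nrm_nonneg[OF assms(1)] by (simp add: nrm_eq_H_norm)
  have c: "c > 0" using n assms(2) by (simp add: c_def)
  have "c * H_norm t \<xi> < c * (2 * (H_norm t \<xi> + 1))" using c n by (intro mult_strict_left_mono) auto
  also have "\<dots> = \<delta>" using n by (simp add: c_def)
  finally have "H_norm t (\<lambda>s. c *\<^sub>R \<xi> s) < \<delta>" using c by (simp add: H_norm_scale[OF assms(1)])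
  moreover have "(\<lambda>s. c *\<^sub>R \<xi> s) \<in> H0 t" using H_intros(4)[OF assms(1), of c] by (simp add: scaleR_fun_def)
  ultimately show ?thesis using c by (rule_tac that)
qed

lemma eq_of_small_difference:
  fixes a b n :: real
  assumes "\<And>\<epsilon>. \<epsilon> > 0 \<Longrightarrow> \<bar>a - b\<bar> \<le> 2 * \<epsilon> * n" and "n \<ge> 0" shows "a = b"
proof (rule ccontr)
  assume "a \<noteq> b"
  define \<epsilon> where "\<epsilon> = \<bar>a - b\<bar> / (4 * (n + 1))"
  have "\<epsilon> > 0" using \<open>a \<noteq> b\<close> assms(2) by (simp add: \<epsilon>_def)
  have "\<bar>a - b\<bar> \<le> 2 * \<epsilon> * n" by (rule assms(1)[OF \<open>\<epsilon> > 0\<close>])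
  also have "\<dots> < 4 * \<epsilon> * (n + 1)" using \<open>\<epsilon> > 0\<close> assms(2) by (simp add: algebra_simps add_strict_increasing)
  also have "\<dots> = \<bar>a - b\<bar>" using assms(2) by (simp add: \<epsilon>_def field_simps)
  finally show False by simp
qed

text \<open>A fixed direction is shrunk until both expansions apply; the shrinking factor then
  cancels by homogeneity, leaving an arbitrarily small bound.\<close>

lemma differential_unique:
  fixes \<eta> :: "'n path"
  assumes l: "has_differential t F \<gamma> l" and l': "has_differential t F \<gamma> l'" and \<eta>: "\<eta> \<in> H0 t"
  shows "l \<eta> = l' \<eta>"
proof (rule eq_of_small_difference)
  show "H_norm t \<eta> \<ge> 0" using nrm_nonneg[OF \<eta>] by (simp add: nrm_eq_H_norm)
  fix \<epsilon> :: real assume \<epsilon>: "\<epsilon> > 0"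
  obtain \<delta> where \<delta>: "\<delta> > 0" "\<And>\<xi>. \<xi> \<in> H0 t \<Longrightarrow> H_norm t \<xi> < \<delta> \<Longrightarrow> \<bar>F (\<lambda>s. \<gamma> s + \<xi> s) - F \<gamma> - l \<xi>\<bar> \<le> \<epsilon> * H_norm t \<xi>"
    using l \<epsilon> unfolding has_differential_def by metis
  obtain \<delta>' where \<delta>': "\<delta>' > 0" "\<And>\<xi>. \<xi> \<in> H0 t \<Longrightarrow> H_norm t \<xi> < \<delta>' \<Longrightarrow> \<bar>F (\<lambda>s. \<gamma> s + \<xi> s) - F \<gamma> - l' \<xi>\<bar> \<le> \<epsilon> * H_norm t \<xi>"
    using l' \<epsilon> unfolding has_differential_def by metis
  obtain c where c: "c > 0" "H_norm t (\<lambda>s. c *\<^sub>R \<eta> s) < min \<delta> \<delta>'" "(\<lambda>s. c *\<^sub>R \<eta> s) \<in> H0 t"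
    using small_multiple[OF \<eta>, of "min \<delta> \<delta>'"] \<delta>(1) \<delta>'(1) by auto
  have "\<bar>l (\<lambda>s. c *\<^sub>R \<eta> s) - l' (\<lambda>s. c *\<^sub>R \<eta> s)\<bar> \<le> 2 * (\<epsilon> * H_norm t (\<lambda>s. c *\<^sub>R \<eta> s))"
    using \<delta>(2)[OF c(3)] \<delta>'(2)[OF c(3)] c(2) by linarith
  moreover have "l (\<lambda>s. c *\<^sub>R \<eta> s) = c * l \<eta>" "l' (\<lambda>s. c *\<^sub>R \<eta> s) = c * l' \<eta>"
    using l l' \<eta> unfolding has_differential_def H_linear_def by auto
  ultimately have "c * \<bar>l \<eta> - l' \<eta>\<bar> \<le> c * (2 * \<epsilon> * H_norm t \<eta>)"
    using c(1) by (simp add: H_norm_scale[OF \<eta>] abs_mult mult_ac flip: right_diff_distrib)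
  then show "\<bar>l \<eta> - l' \<eta>\<bar> \<le> 2 * \<epsilon> * H_norm t \<eta>" using c(1) by simp
qed

text \<open>The families of first differentials agree near the base point by uniqueness, so both
  bilinear forms linearise the same map. This makes the hessian operator independent of the form
  chosen in its definition.\<close>

lemma second_differential_unique:
  fixes \<xi> \<eta> :: "'n path"
  assumes b: "has_second_differential t F \<gamma> b" and b': "has_second_differential t F \<gamma> b'"
    and \<xi>: "\<xi> \<in> H0 t" and \<eta>: "\<eta> \<in> H0 t"
  shows "b \<xi> \<eta> = b' \<xi> \<eta>"
proof -
  obtain D r where D: "r > 0" "\<And>\<xi>. \<xi> \<in> H0 t \<Longrightarrow> H_norm t \<xi> < r \<Longrightarrow> has_differential t F (\<lambda>s. \<gamma> s + \<xi> s) (D \<xi>)"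
    and D2: "\<forall>\<epsilon>>0. \<exists>\<delta>>0. \<forall>\<xi>\<in>H0 t. H_norm t \<xi> < \<delta> \<longrightarrow>
           (\<forall>\<eta>\<in>H0 t. \<bar>D \<xi> \<eta> - D (\<lambda>_. 0) \<eta> - b \<xi> \<eta>\<bar> \<le> \<epsilon> * H_norm t \<xi> * H_norm t \<eta>)"
    using b unfolding has_second_differential_def by blast
  obtain D' r' where D': "r' > 0" "\<And>\<xi>. \<xi> \<in> H0 t \<Longrightarrow> H_norm t \<xi> < r' \<Longrightarrow> has_differential t F (\<lambda>s. \<gamma> s + \<xi> s) (D' \<xi>)"
    and D2': "\<forall>\<epsilon>>0. \<exists>\<delta>>0. \<forall>\<xi>\<in>H0 t. H_norm t \<xi> < \<delta> \<longrightarrow>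
           (\<forall>\<eta>\<in>H0 t. \<bar>D' \<xi> \<eta> - D' (\<lambda>_. 0) \<eta> - b' \<xi> \<eta>\<bar> \<le> \<epsilon> * H_norm t \<xi> * H_norm t \<eta>)"
    using b' unfolding has_second_differential_def by blast
  have DD: "D \<xi> \<eta> = D' \<xi> \<eta>" if "\<xi> \<in> H0 t" "H_norm t \<xi> < r" "H_norm t \<xi> < r'" for \<xi>
    by (rule differential_unique[OF D(2) D'(2) \<eta>]) (use that in auto)
  have z: "(\<lambda>_. 0) \<in> (H0 t :: 'n path set)" using H_intros(1) by (simp add: zero_fun_def)
  have "H_norm t (\<lambda>_. 0 :: real^'n) = 0" using nrm_eq_0[OF H_intros(1)] by (simp add: nrm_eq_H_norm zero_fun_def)
  then have D0: "D (\<lambda>_. 0) \<eta> = D' (\<lambda>_. 0) \<eta>" using DD[OF z] D(1) D'(1) by simp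
  show ?thesis
  proof (rule eq_of_small_difference)
    show "H_norm t \<xi> * H_norm t \<eta> \<ge> 0" using nrm_nonneg[OF \<xi>] nrm_nonneg[OF \<eta>] by (simp add: nrm_eq_H_norm)
    fix \<epsilon> :: real assume \<epsilon>: "\<epsilon> > 0"
    obtain \<delta> where \<delta>: "\<delta> > 0" "\<And>\<xi>. \<xi> \<in> H0 t \<Longrightarrow> H_norm t \<xi> < \<delta> \<Longrightarrow> \<bar>D \<xi> \<eta> - D (\<lambda>_. 0) \<eta> - b \<xi> \<eta>\<bar> \<le> \<epsilon> * H_norm t \<xi> * H_norm t \<eta>"
      using D2 \<epsilon> \<eta> by metis
    obtain \<delta>' where \<delta>': "\<delta>' > 0" "\<And>\<xi>. \<xi> \<in> H0 t \<Longrightarrow> H_norm t \<xi> < \<delta>' \<Longrightarrow> \<bar>D' \<xi> \<eta> - D' (\<lambda>_. 0) \<eta> - b' \<xi> \<eta>\<bar> \<le> \<epsilon> * H_norm t \<xi> * H_norm t \<eta>"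
      using D2' \<epsilon> \<eta> by metis
    obtain c where c: "c > 0" "H_norm t (\<lambda>s. c *\<^sub>R \<xi> s) < min (min \<delta> \<delta>') (min r r')" "(\<lambda>s. c *\<^sub>R \<xi> s) \<in> H0 t"
      using small_multiple[OF \<xi>, of "min (min \<delta> \<delta>') (min r r')"] \<delta>(1) \<delta>'(1) D(1) D'(1) by auto
    have "\<bar>b (\<lambda>s. c *\<^sub>R \<xi> s) \<eta> - b' (\<lambda>s. c *\<^sub>R \<xi> s) \<eta>\<bar> \<le> 2 * (\<epsilon> * H_norm t (\<lambda>s. c *\<^sub>R \<xi> s) * H_norm t \<eta>)"
      using \<delta>(2)[OF c(3)] \<delta>'(2)[OF c(3)] DD[OF c(3)] D0 c(2) by auto
    moreover have "b (\<lambda>s. c *\<^sub>R \<xi> s) \<eta> = c * b \<xi> \<eta>" "b' (\<lambda>s. c *\<^sub>R \<xi> s) \<eta> = c * b' \<xi> \<eta>"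
      using b b' \<xi> \<eta> unfolding has_second_differential_def H_linear_def by auto
    ultimately have "c * \<bar>b \<xi> \<eta> - b' \<xi> \<eta>\<bar> \<le> c * (2 * \<epsilon> * (H_norm t \<xi> * H_norm t \<eta>))"
      using c(1) by (simp add: H_norm_scale[OF \<xi>] abs_mult mult_ac flip: right_diff_distrib)
    then show "\<bar>b \<xi> \<eta> - b' \<xi> \<eta>\<bar> \<le> 2 * \<epsilon> * (H_norm t \<xi> * H_norm t \<eta>)" using c(1) by simp
  qed
qed

end

section \<open>The hessian of the action\<close>

locale action_setup = C3 V + path_space t "TYPE('n::finite)"
  for V :: "real^'n \<Rightarrow> real" and t :: real +
  fixes \<omega> x y :: "real^'n" and \<gamma> :: "'n path"
  assumes \<gamma>: "\<gamma> \<in> H_space t x y"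
begin

text \<open>The first variation of the action. The term in \<omega> integrates to \<omega> \<bullet>
  (y - x), a constant on the affine space, and so has differential 0.\<close>

definition dA :: "'n path \<Rightarrow> 'n path \<Rightarrow> real" where
  "dA \<zeta> \<eta> = H_inner t \<zeta> \<eta> - integral {0..t} (\<lambda>s. grad V (\<zeta> s) \<bullet> \<eta> s)"

lemma H_spaceD:
  assumes "\<zeta> \<in> H_space t x y"
  shows "has_L2_derivative t \<zeta> (velocity t \<zeta>)" "L2 t (velocity t \<zeta>)" "continuous_on {0..t} \<zeta>" "\<zeta> 0 = x" "\<zeta> t = y"
  using assms H0_velocity[OF assms] H0_continuous[OF assms] has_L2_derivativeD(1)[OF H0_velocity[OF assms]]
  unfolding H_space_def by auto

lemma action_eq:
  assumes \<zeta>: "\<zeta> \<in> H_space t x y"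
  shows "action V \<omega> t \<zeta> = H_inner t \<zeta> \<zeta> / 2 - integral {0..t} (\<lambda>s. V (\<zeta> s)) - \<omega> \<bullet> (y - x)"
proof -
  let ?v = "velocity t \<zeta>" and ?M = "lebesgue_on {0..t}"
  note Z = H_spaceD[OF \<zeta>]
  have i1: "integrable ?M (\<lambda>s. ?v s \<bullet> ?v s)" by (rule L2_inner_integrable[OF Z(2) Z(2)])
  have i2: "integrable ?M (\<lambda>s. V (\<zeta> s))"
    by (intro continuous_imp_integrable_real continuous_on_compose2[OF V_continuous[of UNIV] Z(3)]) simp
  have i3: "integrable ?M ?v" by (rule L2_integrable[OF Z(2)])
  have "action V \<omega> t \<zeta> = (LINT s|?M. (?v s \<bullet> ?v s) / 2 - V (\<zeta> s) - \<omega> \<bullet> ?v s)"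
    unfolding action_def lagrangian_def by (simp only: power2_norm_eq_inner)
  also have "\<dots> = (LINT s|?M. ?v s \<bullet> ?v s) / 2 - (LINT s|?M. V (\<zeta> s)) - (LINT s|?M. \<omega> \<bullet> ?v s)"
    using i1 i2 i3 by simp
  also have "(LINT s|?M. \<omega> \<bullet> ?v s) = \<omega> \<bullet> (LINT s|?M. ?v s)"
    using i3 by simp
  also have "(LINT s|?M. ?v s) = y - x"
    using has_L2_derivativeD(3)[OF Z(1), of t] t_pos Z(4,5) by simp
  also have "(LINT s|?M. V (\<zeta> s)) = integral {0..t} (\<lambda>s. V (\<zeta> s))" by (rule LINT_eq_integral[OF i2])
  finally show ?thesis by (simp add: H_inner_def)
qed

text \<open>Bilinearity when one argument lies in the affine space, and hence outside the
  carrier.\<close>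

lemma H_inner_add_sides:
  fixes \<zeta> \<xi> \<eta> :: "'n path"
  assumes "\<zeta> \<in> H_space t x y" "\<xi> \<in> H0 t" "\<eta> \<in> H0 t"
  shows "H_inner t \<zeta> (\<lambda>s. \<xi> s + \<eta> s) = H_inner t \<zeta> \<xi> + H_inner t \<zeta> \<eta>"
    and "H_inner t \<zeta> (\<lambda>s. c *\<^sub>R \<xi> s) = c * H_inner t \<zeta> \<xi>"
    and "H_inner t (\<lambda>s. \<zeta> s + \<xi> s) \<eta> = H_inner t \<zeta> \<eta> + H_inner t \<xi> \<eta>"
    and "H_inner t (\<lambda>s. \<zeta> s + \<xi> s) (\<lambda>s. \<zeta> s + \<xi> s) = H_inner t \<zeta> \<zeta> + 2 * H_inner t \<zeta> \<xi> + H_inner t \<xi> \<xi>"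
proof -
  note d = H0_velocity[OF assms(1)] H0_velocity[OF assms(2)] H0_velocity[OF assms(3)]
  note L = d[THEN has_L2_derivativeD(1)]
  note int = L2_inner_integrable[OF L(1) L(1)] L2_inner_integrable[OF L(1) L(2)] L2_inner_integrable[OF L(1) L(3)]
    L2_inner_integrable[OF L(2) L(2)] L2_inner_integrable[OF L(2) L(3)] L2_inner_integrable[OF L(2) L(1)]
  show "H_inner t \<zeta> (\<lambda>s. \<xi> s + \<eta> s) = H_inner t \<zeta> \<xi> + H_inner t \<zeta> \<eta>"
    by (subst velocity_inner_eq[OF d(1) has_L2_derivative_add[OF d(2,3)]]) (simp add: H_inner_def inner_add_right int)
  show "H_inner t \<zeta> (\<lambda>s. c *\<^sub>R \<xi> s) = c * H_inner t \<zeta> \<xi>"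
    by (subst velocity_inner_eq[OF d(1) has_L2_derivative_scale[OF d(2)]]) (simp add: H_inner_def)
  show "H_inner t (\<lambda>s. \<zeta> s + \<xi> s) \<eta> = H_inner t \<zeta> \<eta> + H_inner t \<xi> \<eta>"
    by (subst velocity_inner_eq[OF has_L2_derivative_add[OF d(1,2)] d(3)]) (simp add: H_inner_def inner_add_left int)
  have "H_inner t (\<lambda>s. \<zeta> s + \<xi> s) (\<lambda>s. \<zeta> s + \<xi> s)
      = (LINT s|lebesgue_on {0..t}. velocity t \<zeta> s \<bullet> velocity t \<zeta> s + 2 * (velocity t \<zeta> s \<bullet> velocity t \<xi> s) + velocity t \<xi> s \<bullet> velocity t \<xi> s)"
    by (subst velocity_inner_eq[OF has_L2_derivative_add[OF d(1,2)] has_L2_derivative_add[OF d(1,2)]])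
      (simp add: inner_add inner_commute algebra_simps)
  also have "\<dots> = H_inner t \<zeta> \<zeta> + 2 * H_inner t \<zeta> \<xi> + H_inner t \<xi> \<xi>"
    using int by (simp add: H_inner_def)
  finally show "H_inner t (\<lambda>s. \<zeta> s + \<xi> s) (\<lambda>s. \<zeta> s + \<xi> s) = H_inner t \<zeta> \<zeta> + 2 * H_inner t \<zeta> \<xi> + H_inner t \<xi> \<xi>" .
qed

lemma integral_bound_ivl:
  fixes f :: "real \<Rightarrow> real"
  assumes "continuous_on {0..t} f" "\<And>s. s \<in> {0..t} \<Longrightarrow> \<bar>f s\<bar> \<le> c" shows "\<bar>integral {0..t} f\<bar> \<le> c * t"
proof -
  have "norm (integral {0..t} f) \<le> integral {0..t} (\<lambda>_. c)"
    by (rule Henstock_Kurzweil_Integration.integral_norm_bound_integral)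
      (use assms in \<open>auto intro!: integrable_continuous_real\<close>)
  then show ?thesis using t_pos by (simp add: mult.commute)
qed

lemma grad_comp_continuous:
  assumes "\<zeta> \<in> H_space t x y" shows "continuous_on {0..t} (\<lambda>s. grad V (\<zeta> s))"
  by (rule continuous_on_compose2[OF grad_continuous[of UNIV] H_spaceD(3)[OF assms]]) simp

lemma path_bounded:
  assumes "\<zeta> \<in> H_space t x y" shows "\<exists>R. \<forall>s\<in>{0..t}. norm (\<zeta> s) \<le> R"
proof -
  have "bounded (\<zeta> ` {0..t})"
    by (rule compact_imp_bounded[OF compact_continuous_image[OF H_spaceD(3)[OF assms] compact_Icc]])
  then show ?thesis by (simp add: bounded_iff)
qed

lemma dA_linear: assumes \<zeta>: "\<zeta> \<in> H_space t x y" shows "H_linear t (dA \<zeta>)"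
  unfolding H_linear_def
proof (intro conjI ballI allI)
  have int: "(\<lambda>s. grad V (\<zeta> s) \<bullet> \<eta> s) integrable_on {0..t}" if "\<eta> \<in> H0 t" for \<eta>
    by (intro integrable_continuous_real continuous_on_inner grad_comp_continuous[OF \<zeta>] H0_continuous[OF that])
  show "dA \<zeta> (\<lambda>s. \<xi> s + \<eta> s) = dA \<zeta> \<xi> + dA \<zeta> \<eta>" if "\<xi> \<in> H0 t" "\<eta> \<in> H0 t" for \<xi> \<eta>
    using int[OF that(1)] int[OF that(2)]
    by (simp add: dA_def H_inner_add_sides[OF \<zeta> that] inner_add_right Henstock_Kurzweil_Integration.integral_add)
  show "dA \<zeta> (\<lambda>s. c *\<^sub>R \<xi> s) = c * dA \<zeta> \<xi>" if "\<xi> \<in> H0 t" for c \<xi>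
    by (simp add: dA_def H_inner_add_sides(2)[OF \<zeta> that that] right_diff_distrib)
qed

lemma dA_bounded:
  assumes \<zeta>: "\<zeta> \<in> H_space t x y" shows "\<exists>C. \<forall>\<eta>\<in>H0 t. \<bar>dA \<zeta> \<eta>\<bar> \<le> C * H_norm t \<eta>"
proof -
  have "bounded ((\<lambda>s. grad V (\<zeta> s)) ` {0..t})"
    by (rule compact_imp_bounded[OF compact_continuous_image[OF grad_comp_continuous[OF \<zeta>] compact_Icc]])
  then obtain G where "\<forall>v\<in>(\<lambda>s. grad V (\<zeta> s)) ` {0..t}. norm v \<le> G" unfolding bounded_iff ..
  then have G: "norm (grad V (\<zeta> s)) \<le> G" if "s \<in> {0..t}" for s using that by auto
  have "\<bar>dA \<zeta> \<eta>\<bar> \<le> (sqrt (H_inner t \<zeta> \<zeta>) + G * sqrt t * t) * H_norm t \<eta>" if \<eta>: "\<eta> \<in> H0 t" for \<eta>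
  proof -
    have "\<bar>H_inner t \<zeta> \<eta>\<bar> \<le> sqrt (H_inner t \<zeta> \<zeta>) * H_norm t \<eta>"
      unfolding H_inner_def H_norm_def
      by (rule L2_cauchy_schwarz[OF H_spaceD(2)[OF \<zeta>] has_L2_derivativeD(1)[OF H0_velocity[OF \<eta>]]])
    moreover have "\<bar>integral {0..t} (\<lambda>s. grad V (\<zeta> s) \<bullet> \<eta> s)\<bar> \<le> G * (sqrt t * H_norm t \<eta>) * t"
    proof (rule integral_bound_ivl)
      show "continuous_on {0..t} (\<lambda>s. grad V (\<zeta> s) \<bullet> \<eta> s)"
        by (intro continuous_on_inner grad_comp_continuous[OF \<zeta>] H0_continuous[OF \<eta>])
      fix s assume s: "s \<in> {0..t}"
      have "\<bar>grad V (\<zeta> s) \<bullet> \<eta> s\<bar> \<le> norm (grad V (\<zeta> s)) * norm (\<eta> s)" by (rule Cauchy_Schwarz_ineq2)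
      also have "\<dots> \<le> G * (sqrt t * H_norm t \<eta>)"
        using G[OF s] norm_le_H_norm[OF \<eta> s] by (intro mult_mono) (auto intro: order_trans[OF norm_ge_zero])
      finally show "\<bar>grad V (\<zeta> s) \<bullet> \<eta> s\<bar> \<le> G * (sqrt t * H_norm t \<eta>)" .
    qed
    ultimately show ?thesis unfolding dA_def by (simp add: algebra_simps)
  qed
  then show ?thesis by blast
qed

lemma H_norm_nonneg: "\<eta> \<in> H0 t \<Longrightarrow> H_norm t (\<eta> :: 'n path) \<ge> 0"
  using nrm_nonneg by (simp add: nrm_eq_H_norm)

text \<open>Since \<open>H\<^sup>1\<close> embeds in the continuous paths, the remainder is controlled by a uniform linearization
  of \<open>V\<close> near the compact image of the path.\<close>

lemma action_differential:
  assumes \<zeta>: "\<zeta> \<in> H_space t x y" shows "has_differential t (action V \<omega> t) \<zeta> (dA \<zeta>)"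
  unfolding has_differential_def
proof (intro conjI dA_linear[OF \<zeta>] dA_bounded[OF \<zeta>] allI impI)
  fix \<epsilon> :: real assume \<epsilon>: "\<epsilon> > 0"
  obtain R where R: "\<forall>s\<in>{0..t}. norm (\<zeta> s) \<le> R" using path_bounded[OF \<zeta>] ..
  \<comment> \<open>The supremum bound costs sqrt t and the integral t; the factor 2 reserves half
    of \<epsilon> for the kinetic term.\<close>
  define e where "e = \<epsilon> / (2 * t * sqrt t)"
  have e: "e > 0" using \<epsilon> t_pos by (simp add: e_def)
  have dV: "(V has_derivative (\<lambda>v. grad V x \<bullet> v)) (at x)" for x
    using V_deriv[of x] by (simp add: grad_eq)
  have "\<exists>\<delta>>0. \<forall>p u. norm p \<le> R \<longrightarrow> norm u < \<delta> \<longrightarrow> norm (V (p + u) - V p - grad V p \<bullet> u) \<le> e * norm u"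
    by (rule uniform_linearization[OF dV _ e]) (intro continuous_on_inner grad_continuous continuous_on_const)
  then obtain \<delta> where \<delta>: "\<delta> > 0" "\<And>p u. \<lbrakk>norm p \<le> R; norm u < \<delta>\<rbrakk> \<Longrightarrow> \<bar>V (p + u) - V p - grad V p \<bullet> u\<bar> \<le> e * norm u"
    by auto
  \<comment> \<open>The second bound makes the perturbation pointwise smaller than \<delta>; the
    first makes the quadratic kinetic term at most half of the allowance.\<close>
  define d where "d = min \<epsilon> (\<delta> / sqrt t)"
  have d: "d > 0" using \<epsilon> \<delta>(1) t_pos by (simp add: d_def)
  show "\<exists>\<delta>>0. \<forall>\<xi>\<in>H0 t. H_norm t \<xi> < \<delta> \<longrightarrow> \<bar>action V \<omega> t (\<lambda>s. \<zeta> s + \<xi> s) - action V \<omega> t \<zeta> - dA \<zeta> \<xi>\<bar> \<le> \<epsilon> * H_norm t \<xi>"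
  proof (intro exI conjI ballI impI)
    show "d > 0" by (fact d)
    fix \<xi> :: "'n path" assume \<xi>: "\<xi> \<in> H0 t" and small: "H_norm t \<xi> < d"
    let ?n = "H_norm t \<xi>"
    have n0: "?n \<ge> 0" by (rule H_norm_nonneg[OF \<xi>])
    have \<zeta>\<xi>: "(\<lambda>s. \<zeta> s + \<xi> s) \<in> H_space t x y" by (rule H_space_add[OF \<zeta> \<xi>])
    have c1: "continuous_on {0..t} (\<lambda>s. V (\<zeta> s + \<xi> s))" "continuous_on {0..t} (\<lambda>s. V (\<zeta> s))"
      by (rule continuous_on_compose2[OF V_continuous[of UNIV] H_spaceD(3)[OF \<zeta>\<xi>]], simp,
          rule continuous_on_compose2[OF V_continuous[of UNIV] H_spaceD(3)[OF \<zeta>]], simp)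
    have c2: "continuous_on {0..t} (\<lambda>s. grad V (\<zeta> s) \<bullet> \<xi> s)"
      by (intro continuous_on_inner grad_comp_continuous[OF \<zeta>] H0_continuous[OF \<xi>])
    define I where "I = integral {0..t} (\<lambda>s. V (\<zeta> s + \<xi> s) - V (\<zeta> s) - grad V (\<zeta> s) \<bullet> \<xi> s)"
    have "I = integral {0..t} (\<lambda>s. V (\<zeta> s + \<xi> s)) - integral {0..t} (\<lambda>s. V (\<zeta> s)) - integral {0..t} (\<lambda>s. grad V (\<zeta> s) \<bullet> \<xi> s)"
      unfolding I_def using c1 c2
      by (simp add: Henstock_Kurzweil_Integration.integral_diff integrable_continuous_real integrable_diff)
    then have eq: "action V \<omega> t (\<lambda>s. \<zeta> s + \<xi> s) - action V \<omega> t \<zeta> - dA \<zeta> \<xi> = H_inner t \<xi> \<xi> / 2 - I"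
      unfolding action_eq[OF \<zeta>] action_eq[OF \<zeta>\<xi>] dA_def H_inner_add_sides(4)[OF \<zeta> \<xi> \<xi>] by (simp add: field_simps)
    have "\<bar>I\<bar> \<le> e * (sqrt t * ?n) * t"
      unfolding I_def
    proof (rule integral_bound_ivl)
      show "continuous_on {0..t} (\<lambda>s. V (\<zeta> s + \<xi> s) - V (\<zeta> s) - grad V (\<zeta> s) \<bullet> \<xi> s)"
        by (intro continuous_on_diff c1 c2)
      fix s assume s: "s \<in> {0..t}"
      have u: "norm (\<xi> s) \<le> sqrt t * ?n" by (rule norm_le_H_norm[OF \<xi> s])
      also have "\<dots> < sqrt t * (\<delta> / sqrt t)"
        using small t_pos by (intro mult_strict_left_mono) (auto simp: d_def)
      also have "\<dots> = \<delta>" using t_pos by simp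
      finally have "\<bar>V (\<zeta> s + \<xi> s) - V (\<zeta> s) - grad V (\<zeta> s) \<bullet> \<xi> s\<bar> \<le> e * norm (\<xi> s)"
        by (rule \<delta>(2)[OF bspec[OF R s]])
      also have "\<dots> \<le> e * (sqrt t * ?n)" using u e by (intro mult_left_mono) auto
      finally show "\<bar>V (\<zeta> s + \<xi> s) - V (\<zeta> s) - grad V (\<zeta> s) \<bullet> \<xi> s\<bar> \<le> e * (sqrt t * ?n)" .
    qed
    also have "\<dots> = \<epsilon> / 2 * ?n" using t_pos by (simp add: e_def field_simps)
    finally have I: "\<bar>I\<bar> \<le> \<epsilon> / 2 * ?n" .
    have "H_inner t \<xi> \<xi> = ?n * ?n"
      using nrm_square[OF \<xi>] by (simp add: nrm_eq_H_norm power2_eq_square)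
    also have "\<dots> \<le> \<epsilon> * ?n" using small n0 by (intro mult_right_mono) (auto simp: d_def)
    finally have "\<bar>H_inner t \<xi> \<xi> / 2\<bar> \<le> \<epsilon> / 2 * ?n" using ip_nonneg[OF \<xi>] by simp
    then show "\<bar>action V \<omega> t (\<lambda>s. \<zeta> s + \<xi> s) - action V \<omega> t \<zeta> - dA \<zeta> \<xi>\<bar> \<le> \<epsilon> * ?n"
      unfolding eq using I by linarith
  qed
qed

text \<open>Clamping the time gives a coefficient that is continuous on the whole line, as
  \<open>system\<close> requires; the path itself is extended by 0 and may jump at the
  endpoints.\<close>

definition Hs :: "real \<Rightarrow> real^'n^'n" where
  "Hs s = hessian_matrix V (\<gamma> (max 0 (min t s)))"

lemma Hs_eq: "s \<in> {0..t} \<Longrightarrow> Hs s = hessian_matrix V (\<gamma> s)"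
  by (simp add: Hs_def)

sublocale sturm t Hs
proof
  have "continuous_on UNIV (\<lambda>s. \<gamma> (max 0 (min t s)))"
    using t_pos by (intro continuous_on_compose2[OF H0_continuous[OF \<gamma>]] continuous_intros) auto
  then show "continuous_on UNIV Hs"
    unfolding Hs_def[abs_def] by (rule continuous_on_compose2[OF hessian_continuous]) simp
  show "(Hs s *v v) \<bullet> w = v \<bullet> (Hs s *v w)" for s v w
    unfolding Hs_def by (rule hessian_self_adjoint)
qed

lemma H_linearI:
  fixes l :: "'n path \<Rightarrow> real"
  assumes "\<And>\<xi> \<eta>. \<lbrakk>\<xi> \<in> H0 t; \<eta> \<in> H0 t\<rbrakk> \<Longrightarrow> l (\<xi> + \<eta>) = l \<xi> + l \<eta>" "\<And>c \<xi>. \<xi> \<in> H0 t \<Longrightarrow> l (c *\<^sub>R \<xi>) = c * l \<xi>"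
  shows "H_linear t l"
  using assms unfolding H_linear_def plus_fun_def scaleR_fun_def by simp

lemma H_self_adjointI:
  fixes T :: "'n path \<Rightarrow> 'n path"
  assumes "T \<in> H0 t \<rightarrow>\<^sub>E H0 t" "\<And>\<xi> \<eta>. \<lbrakk>\<xi> \<in> H0 t; \<eta> \<in> H0 t\<rbrakk> \<Longrightarrow> T (\<xi> + \<eta>) = T \<xi> + T \<eta>"
    "\<And>c \<xi>. \<xi> \<in> H0 t \<Longrightarrow> T (c *\<^sub>R \<xi>) = c *\<^sub>R T \<xi>" "\<forall>\<xi>\<in>H0 t. nrm (T \<xi>) \<le> C * nrm \<xi>"
    "\<And>\<xi> \<eta>. \<lbrakk>\<xi> \<in> H0 t; \<eta> \<in> H0 t\<rbrakk> \<Longrightarrow> H_inner t (T \<xi>) \<eta> = H_inner t \<xi> (T \<eta>)"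
  shows "H_self_adjoint t T"
  unfolding H_self_adjoint_def H_operator_def
proof (intro conjI ballI allI)
  show "T (\<lambda>s. \<xi> s + \<eta> s) = (\<lambda>s. T \<xi> s + T \<eta> s)" if "\<xi> \<in> H0 t" "\<eta> \<in> H0 t" for \<xi> \<eta>
    using assms(2)[OF that] by (simp only: plus_fun_def)
  show "T (\<lambda>s. c *\<^sub>R \<xi> s) = (\<lambda>s. c *\<^sub>R T \<xi> s)" if "\<xi> \<in> H0 t" for c \<xi>
    using assms(3)[OF that] by (simp only: scaleR_fun_def)
  show "\<exists>C. \<forall>\<xi>\<in>H0 t. H_norm t (T \<xi>) \<le> C * H_norm t \<xi>"
    using assms(4) unfolding nrm_eq_H_norm by (rule exI)
qed (use assms(1,5) in auto)

lemma bil_add_right: "\<lbrakk>\<xi> \<in> H0 t; \<eta> \<in> H0 t; \<zeta> \<in> H0 t\<rbrakk> \<Longrightarrow> bil \<zeta> (\<xi> + \<eta>) = bil \<zeta> \<xi> + bil \<zeta> \<eta>"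
  using bil_add_left[of \<xi> \<eta> \<zeta>] by (simp only: bil_sym[of \<zeta>])

lemma bil_scale_right: "bil \<zeta> (c *\<^sub>R \<xi>) = c * bil \<zeta> \<xi>"
  using bil_scale_left[of c \<xi> \<zeta>] by (simp only: bil_sym[of \<zeta>])

text \<open>The kinetic part is exactly quadratic, so the remainder comes only from linearising the
  gradient of the potential along \<gamma>, where \<open>uniform_linearization\<close>
  applies.\<close>

lemma second_differential:
  "has_second_differential t (action V \<omega> t) \<gamma> (\<lambda>\<xi> \<eta>. H_inner t \<xi> \<eta> - bil \<xi> \<eta>)"
  unfolding has_second_differential_def
proof (intro conjI ballI)
  show "H_linear t (\<lambda>\<eta>. H_inner t \<xi> \<eta> - bil \<xi> \<eta>)" if "\<xi> \<in> H0 t" for \<xi>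
    by (rule H_linearI) (use that in \<open>simp_all add: ip_add_right ip_scale_right bil_add_right bil_scale_right algebra_simps\<close>)
  show "H_linear t (\<lambda>\<xi>. H_inner t \<xi> \<eta> - bil \<xi> \<eta>)" if "\<eta> \<in> H0 t" for \<eta>
    by (rule H_linearI) (use that in \<open>simp_all add: ip_add_left ip_scale_left bil_add_left bil_scale_left algebra_simps\<close>)
  obtain K where K: "K \<ge> 0" "\<And>x y c d. \<lbrakk>x \<in> H0 t; y \<in> H0 t; \<And>s. s \<in> {0..t} \<Longrightarrow> norm (x s) \<le> c; \<And>s. s \<in> {0..t} \<Longrightarrow> norm (y s) \<le> d\<rbrakk>
      \<Longrightarrow> \<bar>bil x y\<bar> \<le> K * c * d * t" by (rule bil_bound_ex) (rule that; blast)
  have "\<bar>H_inner t \<xi> \<eta> - bil \<xi> \<eta>\<bar> \<le> (1 + K * t * t) * H_norm t \<xi> * H_norm t \<eta>" if "\<xi> \<in> H0 t" "\<eta> \<in> H0 t" for \<xi> \<eta>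
  proof -
    have "\<bar>bil \<xi> \<eta>\<bar> \<le> K * (sqrt t * H_norm t \<xi>) * (sqrt t * H_norm t \<eta>) * t"
      by (rule K(2)[OF that norm_le_H_norm[OF that(1)] norm_le_H_norm[OF that(2)]])
    also have "\<dots> = (K * (sqrt t * sqrt t) * t) * H_norm t \<xi> * H_norm t \<eta>" by (simp only: mult_ac)
    also have "\<dots> = K * t * t * H_norm t \<xi> * H_norm t \<eta>" using t_pos by simp
    finally have "\<bar>bil \<xi> \<eta>\<bar> \<le> K * t * t * H_norm t \<xi> * H_norm t \<eta>" .
    moreover have "\<bar>H_inner t \<xi> \<eta>\<bar> \<le> H_norm t \<xi> * H_norm t \<eta>"
      using cauchy_schwarz[OF that] by (simp add: nrm_eq_H_norm)
    ultimately have "\<bar>H_inner t \<xi> \<eta> - bil \<xi> \<eta>\<bar> \<le> H_norm t \<xi> * H_norm t \<eta> + K * t * t * H_norm t \<xi> * H_norm t \<eta>" by linarith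
    then show ?thesis by (simp add: algebra_simps)
  qed
  then show "\<exists>C. \<forall>\<xi>\<in>H0 t. \<forall>\<eta>\<in>H0 t. \<bar>H_inner t \<xi> \<eta> - bil \<xi> \<eta>\<bar> \<le> C * H_norm t \<xi> * H_norm t \<eta>" by blast
  define D where "D \<xi> = dA (\<lambda>s. \<gamma> s + \<xi> s)" for \<xi>
  have diff: "has_differential t (action V \<omega> t) (\<lambda>s. \<gamma> s + \<xi> s) (D \<xi>)" if "\<xi> \<in> H0 t" for \<xi>
    unfolding D_def by (rule action_differential[OF H_space_add[OF \<gamma> that]])
  have "\<exists>\<delta>>0. \<forall>\<xi>\<in>H0 t. H_norm t \<xi> < \<delta> \<longrightarrow>
      (\<forall>\<eta>\<in>H0 t. \<bar>D \<xi> \<eta> - D (\<lambda>_. 0) \<eta> - (H_inner t \<xi> \<eta> - bil \<xi> \<eta>)\<bar> \<le> \<epsilon> * H_norm t \<xi> * H_norm t \<eta>)" if \<epsilon>: "\<epsilon> > 0" for \<epsilon>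
  proof -
    obtain R where R: "\<forall>s\<in>{0..t}. norm (\<gamma> s) \<le> R" using path_bounded[OF \<gamma>] ..
    \<comment> \<open>Two supremum bounds cost sqrt t each, and the integral costs t.\<close>
    define e where "e = \<epsilon> / (t * t)"
    have e: "e > 0" using \<epsilon> t_pos by (simp add: e_def)
    have "\<exists>\<delta>>0. \<forall>p u. norm p \<le> R \<longrightarrow> norm u < \<delta> \<longrightarrow> norm (grad V (p + u) - grad V p - hessian_matrix V p *v u) \<le> e * norm u"
      by (rule uniform_linearization[OF grad_deriv _ e]) (intro continuous_on_mult_vec hessian_continuous continuous_on_const)
    then obtain \<delta> where \<delta>: "\<delta> > 0" "\<And>p u. \<lbrakk>norm p \<le> R; norm u < \<delta>\<rbrakk> \<Longrightarrow> norm (grad V (p + u) - grad V p - hessian_matrix V p *v u) \<le> e * norm u"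
      by auto
    have "\<bar>D \<xi> \<eta> - D (\<lambda>_. 0) \<eta> - (H_inner t \<xi> \<eta> - bil \<xi> \<eta>)\<bar> \<le> \<epsilon> * H_norm t \<xi> * H_norm t \<eta>"
      if \<xi>: "\<xi> \<in> H0 t" and small: "H_norm t \<xi> < \<delta> / sqrt t" and \<eta>: "\<eta> \<in> H0 t" for \<xi> \<eta>
    proof -
      let ?g = "\<lambda>s. (grad V (\<gamma> s + \<xi> s) - grad V (\<gamma> s) - hessian_matrix V (\<gamma> s) *v \<xi> s) \<bullet> \<eta> s"
      have c1: "continuous_on {0..t} (\<lambda>s. grad V (\<gamma> s + \<xi> s) \<bullet> \<eta> s)"
        by (intro continuous_on_inner grad_comp_continuous[OF H_space_add[OF \<gamma> \<xi>]] H0_continuous[OF \<eta>])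
      have c2: "continuous_on {0..t} (\<lambda>s. grad V (\<gamma> s) \<bullet> \<eta> s)"
        by (intro continuous_on_inner grad_comp_continuous[OF \<gamma>] H0_continuous[OF \<eta>])
      have c3: "continuous_on {0..t} (\<lambda>s. (hessian_matrix V (\<gamma> s) *v \<xi> s) \<bullet> \<eta> s)"
        by (intro continuous_on_inner continuous_on_mult_vec H0_continuous[OF \<eta>] H0_continuous[OF \<xi>]
            continuous_on_compose2[OF hessian_continuous H0_continuous[OF \<gamma>]]) simp
      have bil: "bil \<xi> \<eta> = integral {0..t} (\<lambda>s. (hessian_matrix V (\<gamma> s) *v \<xi> s) \<bullet> \<eta> s)"
        unfolding bil_def by (intro Henstock_Kurzweil_Integration.integral_cong) (simp add: Hs_eq)
      have "integral {0..t} ?g = integral {0..t} (\<lambda>s. grad V (\<gamma> s + \<xi> s) \<bullet> \<eta> s) - integral {0..t} (\<lambda>s. grad V (\<gamma> s) \<bullet> \<eta> s) - bil \<xi> \<eta>"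
        unfolding bil inner_diff_left using c1 c2 c3
        by (simp add: Henstock_Kurzweil_Integration.integral_diff integrable_continuous_real integrable_diff)
      then have eq: "D \<xi> \<eta> - D (\<lambda>_. 0) \<eta> - (H_inner t \<xi> \<eta> - bil \<xi> \<eta>) = - integral {0..t} ?g"
        by (simp add: D_def dA_def H_inner_add_sides(3)[OF \<gamma> \<xi> \<eta>])
      have "\<bar>integral {0..t} ?g\<bar> \<le> (e * (sqrt t * H_norm t \<xi>)) * (sqrt t * H_norm t \<eta>) * t"
      proof (rule integral_bound_ivl)
        show "continuous_on {0..t} ?g" unfolding inner_diff_left by (intro continuous_on_diff c1 c2 c3)
        fix s assume s: "s \<in> {0..t}"
        have u: "norm (\<xi> s) \<le> sqrt t * H_norm t \<xi>" by (rule norm_le_H_norm[OF \<xi> s])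
        also have "\<dots> < sqrt t * (\<delta> / sqrt t)" using small t_pos by (intro mult_strict_left_mono) auto
        also have "\<dots> = \<delta>" using t_pos by simp
        finally have "norm (grad V (\<gamma> s + \<xi> s) - grad V (\<gamma> s) - hessian_matrix V (\<gamma> s) *v \<xi> s) \<le> e * norm (\<xi> s)"
          by (rule \<delta>(2)[OF bspec[OF R s]])
        also have "\<dots> \<le> e * (sqrt t * H_norm t \<xi>)" using u e by (intro mult_left_mono) auto
        finally have b: "norm (grad V (\<gamma> s + \<xi> s) - grad V (\<gamma> s) - hessian_matrix V (\<gamma> s) *v \<xi> s) \<le> e * (sqrt t * H_norm t \<xi>)" .
        have "\<bar>?g s\<bar> \<le> norm (grad V (\<gamma> s + \<xi> s) - grad V (\<gamma> s) - hessian_matrix V (\<gamma> s) *v \<xi> s) * norm (\<eta> s)"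
          by (rule Cauchy_Schwarz_ineq2)
        also have "\<dots> \<le> (e * (sqrt t * H_norm t \<xi>)) * (sqrt t * H_norm t \<eta>)"
          by (rule mult_mono'[OF b norm_le_H_norm[OF \<eta> s]]) auto
        finally show "\<bar>?g s\<bar> \<le> (e * (sqrt t * H_norm t \<xi>)) * (sqrt t * H_norm t \<eta>)" .
      qed
      also have "\<dots> = e * (sqrt t * sqrt t) * t * H_norm t \<xi> * H_norm t \<eta>" by (simp only: mult_ac)
      also have "\<dots> = \<epsilon> * H_norm t \<xi> * H_norm t \<eta>" using t_pos by (simp add: e_def)
      finally show ?thesis unfolding eq by simp
    qed
    then show ?thesis using \<delta>(1) t_pos by (intro exI[of _ "\<delta> / sqrt t"]) auto
  qed
  then show "\<exists>D r. r > 0 \<and>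
        (\<forall>\<xi>\<in>H0 t. H_norm t \<xi> < r \<longrightarrow> has_differential t (action V \<omega> t) (\<lambda>s. \<gamma> s + \<xi> s) (D \<xi>)) \<and>
        (\<forall>\<epsilon>>0. \<exists>\<delta>>0. \<forall>\<xi>\<in>H0 t. H_norm t \<xi> < \<delta> \<longrightarrow>
           (\<forall>\<eta>\<in>H0 t. \<bar>D \<xi> \<eta> - D (\<lambda>_. 0) \<eta> - (H_inner t \<xi> \<eta> - bil \<xi> \<eta>)\<bar> \<le> \<epsilon> * H_norm t \<xi> * H_norm t \<eta>))"
    \<comment> \<open>The action is differentiable at every path of the affine space, so the radius
      1 is an arbitrary choice.\<close>
    using diff by (intro exI[of _ D] exI[of _ 1]) auto
qed

section \<open>Existence and uniqueness of the hessian operator\<close>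

definition T0 :: "'n path \<Rightarrow> 'n path" where
  "T0 = (\<lambda>\<xi>\<in>H0 t. \<xi> + opf \<xi>)"

lemma opf_self_adjoint: "H_self_adjoint t (restrict opf (H0 t))"
proof -
  obtain C where "\<forall>\<xi>\<in>H0 t. nrm (opf \<xi>) \<le> C * nrm \<xi>" using opf_bounded ..
  then show ?thesis
    by (intro H_self_adjointI[where C = C]) (simp_all add: opf_in_H0 opf_add opf_scale opf_sym)
qed

lemma T0_self_adjoint: "H_self_adjoint t T0"
proof -
  obtain C where C: "\<forall>\<xi>\<in>H0 t. nrm (opf \<xi>) \<le> C * nrm \<xi>" using opf_bounded ..
  have "nrm (\<xi> + opf \<xi>) \<le> (1 + C) * nrm \<xi>" if "\<xi> \<in> H0 t" for \<xi>
    using nrm_triangle[OF that opf_in_H0[OF that]] bspec[OF C that] by (simp add: algebra_simps)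
  then show ?thesis
    by (intro H_self_adjointI[where C = "1 + C"])
      (simp_all add: T0_def opf_in_H0 opf_add opf_scale opf_sym ip_add_left ip_add_right scaleR_add_right)
qed

lemma T0_hessian: "is_hessian_operator t (action V \<omega> t) \<gamma> T0"
  unfolding is_hessian_operator_def
proof (intro conjI T0_self_adjoint exI[of _ "\<lambda>\<xi> \<eta>. H_inner t \<xi> \<eta> - bil \<xi> \<eta>"] second_differential ballI)
  show "H_inner t \<xi> \<xi> - bil \<xi> \<xi> = H_inner t (T0 \<xi>) \<xi>" if "\<xi> \<in> H0 t" for \<xi>
    using that by (simp add: T0_def ip_add_left opf_in_H0 opf_inner)
qed

text \<open>The definition ties the operator to the second differential on the diagonal only.
  Self-adjointness recovers the bilinear form by polarisation, and extensionality settles arguments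
  outside \<open>H0 t\<close>.\<close>

lemma hessian_unique:
  assumes "is_hessian_operator t (action V \<omega> t) \<gamma> T" shows "T = T0"
proof -
  have sa: "H_self_adjoint t T" using assms by (simp add: is_hessian_operator_def)
  have TE: "T \<in> H0 t \<rightarrow>\<^sub>E H0 t" using sa by (simp add: H_self_adjoint_def H_operator_def)
  have TH: "T \<xi> \<in> H0 t" if "\<xi> \<in> H0 t" for \<xi> using TE that by auto
  have Tadd: "T (\<xi> + \<eta>) = T \<xi> + T \<eta>" if "\<xi> \<in> H0 t" "\<eta> \<in> H0 t" for \<xi> \<eta>
    using sa that unfolding H_self_adjoint_def H_operator_def plus_fun_def by auto
  have Tsym: "H_inner t (T \<xi>) \<eta> = H_inner t \<xi> (T \<eta>)" if "\<xi> \<in> H0 t" "\<eta> \<in> H0 t" for \<xi> \<eta>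
    using sa that unfolding H_self_adjoint_def by auto
  obtain b where b: "has_second_differential t (action V \<omega> t) \<gamma> b" "\<forall>\<xi>\<in>H0 t. b \<xi> \<xi> = H_inner t (T \<xi>) \<xi>"
    using assms unfolding is_hessian_operator_def by auto
  have diag: "H_inner t (T \<xi>) \<xi> = H_inner t \<xi> \<xi> - bil \<xi> \<xi>" if "\<xi> \<in> H0 t" for \<xi>
    using second_differential_unique[OF b(1) second_differential that that] b(2) that by simp
  have full: "H_inner t (T \<xi>) \<eta> = H_inner t (\<xi> + opf \<xi>) \<eta>" if "\<xi> \<in> H0 t" "\<eta> \<in> H0 t" for \<xi> \<eta>
  proof -
    have s: "H_inner t (T \<eta>) \<xi> = H_inner t (T \<xi>) \<eta>"
      using Tsym[OF that] ip_sym[OF TH[OF that(2)] that(1)] by simp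
    have "H_inner t (T (\<xi> + \<eta>)) (\<xi> + \<eta>) = H_inner t (\<xi> + \<eta>) (\<xi> + \<eta>) - bil (\<xi> + \<eta>) (\<xi> + \<eta>)"
      using that by (intro diag) auto
    then have "2 * H_inner t (T \<xi>) \<eta> = 2 * (H_inner t \<xi> \<eta> - bil \<xi> \<eta>)"
      using that TH diag[OF that(1)] diag[OF that(2)] s ip_sym[OF that(2,1)] bil_sym[of \<eta> \<xi>]
      by (simp add: Tadd ip_add_left ip_add_right bil_add_left bil_add_right)
    then show ?thesis using that by (simp add: ip_add_left opf_in_H0 opf_inner)
  qed
  show ?thesis
  proof
    fix \<xi> show "T \<xi> = T0 \<xi>"
    proof (cases "\<xi> \<in> H0 t")
      case True
      have "T \<xi> = \<xi> + opf \<xi>"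
        by (rule ip_ext) (use True TH full opf_in_H0 in auto)
      then show ?thesis using True by (simp add: T0_def)
    next
      case False
      then show ?thesis using TE by (auto simp: T0_def PiE_def extensional_def)
    qed
  qed
qed

lemma hessian_operator_eq: "hessian_operator t (action V \<omega> t) \<gamma> = T0"
  unfolding hessian_operator_def by (rule the_equality) (rule T0_hessian, rule hessian_unique)

section \<open>The linearized equation and the determinant\<close>

definition jacobi :: "real^'n \<Rightarrow> 'n path" where
  "jacobi w = (\<lambda>s. if s \<in> {0..t} then sol Hs 1 w s else 0)"

lemma jacobi_solution: "linearized_solution V t \<gamma> w (jacobi w)"
  unfolding linearized_solution_def
proof (intro conjI exI[of _ "sol' Hs 1 w"] ballI allI impI)
  fix s assume s: "s \<in> {0..t}"
  show "(jacobi w has_vector_derivative sol' Hs 1 w s) (at s within {0..t})"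
    by (rule has_vector_derivative_transform[OF s _ has_vector_derivative_at_within[OF sol_deriv]]) (simp add: jacobi_def)
  show "(sol' Hs 1 w has_vector_derivative - (hessian_matrix V (\<gamma> s) *v jacobi w s)) (at s within {0..t})"
    using has_vector_derivative_at_within[OF sol'_deriv[of 1 w s], of "{0..t}"] s by (simp add: jacobi_def Hs_eq)
qed (use t_pos in \<open>auto simp: jacobi_def sol_0 sol'_0\<close>)

lemma jacobi_unique:
  assumes "linearized_solution V t \<gamma> w Y" shows "Y = jacobi w"
proof
  fix s
  obtain Y' where *: "\<forall>s\<in>{0..t}. (Y has_vector_derivative Y' s) (at s within {0..t}) \<and>
      (Y' has_vector_derivative - (hessian_matrix V (\<gamma> s) *v Y s)) (at s within {0..t})"
    and Y0: "Y 0 = 0" "Y' 0 = w" and out: "\<forall>s. s \<notin> {0..t} \<longrightarrow> Y s = 0"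
    using assms unfolding linearized_solution_def by blast
  note Y = bspec[OF *, THEN conjunct1] bspec[OF *, THEN conjunct2]
  show "Y s = jacobi w s"
  proof (cases "s \<in> {0..t}")
    case True
    have "Y s - sol Hs 1 w s = 0"
    proof (rule solution_unique[OF _ _ _ _ True])
      fix r assume r: "r \<in> {0..t}"
      show "((\<lambda>s. Y s - sol Hs 1 w s) has_vector_derivative Y' r - sol' Hs 1 w r) (at r within {0..t})"
        by (rule has_vector_derivative_diff[OF Y(1)[OF r] has_vector_derivative_at_within[OF sol_deriv]])
      have "((\<lambda>s. Y' s - sol' Hs 1 w s) has_vector_derivative - (hessian_matrix V (\<gamma> r) *v Y r) - - (1 *\<^sub>R (Hs r *v sol Hs 1 w r))) (at r within {0..t})"
        by (rule has_vector_derivative_diff[OF Y(2)[OF r] has_vector_derivative_at_within[OF sol'_deriv]])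
      then show "((\<lambda>s. Y' s - sol' Hs 1 w s) has_vector_derivative - (Hs r *v (Y r - sol Hs 1 w r))) (at r within {0..t})"
        using r by (simp add: Hs_eq matrix_vector_mult_diff_distrib)
    qed (simp_all add: Y0 sol_0 sol'_0)
    then show ?thesis using True by (simp add: jacobi_def)
  qed (use out in \<open>auto simp: jacobi_def\<close>)
qed

lemma linearized_map_eq: "linearized_map V t \<gamma> = (\<lambda>w. (1 / t) *\<^sub>R sol Hs 1 w t)"
proof
  fix w
  have "(THE Y. linearized_solution V t \<gamma> w Y) = jacobi w"
    by (rule the_equality) (rule jacobi_solution, rule jacobi_unique)
  then show "linearized_map V t \<gamma> w = (1 / t) *\<^sub>R sol Hs 1 w t"
    using t_pos by (simp add: linearized_map_def jacobi_def inverse_eq_divide)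
qed

text \<open>Existence of a listing comes from the constructed eigenbasis. For an arbitrary listing,
  its own basis satisfies the assumptions of \<open>eigenbasis\<close>, whose conclusions do not
  depend on the basis.\<close>

lemma T0_determinant: "has_determinant t T0 (det (Ymat 1))"
proof -
  let ?f = "restrict opf (H0 t)"
  have f: "(\<lambda>\<xi>\<in>H0 t. (\<lambda>s. T0 \<xi> s - \<xi> s)) = ?f"
    by (auto simp: T0_def fun_eq_iff restrict_def)
  have zero: "(\<lambda>_. 0) = (0 :: 'n path)" by (simp add: zero_fun_def)
  have ex: "\<exists>\<nu>. eigenvalues_with_multiplicity t ?f \<nu>"
  proof -
    obtain e :: "nat \<Rightarrow> 'n path" and \<nu> where e: "\<forall>i. e i \<in> H0 t" "\<forall>i j. H_inner t (e i) (e j) = (if i = j then 1 else 0)"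
      "\<forall>x\<in>H0 t. (\<forall>i. H_inner t x (e i) = 0) \<longrightarrow> x = 0" "\<forall>i. opf (e i) = \<nu> i *\<^sub>R e i"
      using ex_eigenbasis by metis
    have "hilbert_basis t (eigenspace t ?f \<mu>) {i. \<nu> i = \<mu>} e" for \<mu>
      unfolding hilbert_basis_def zero
    proof (intro conjI ballI impI)
      fix i assume i: "i \<in> {i. \<nu> i = \<mu>}"
      show "e i \<in> eigenspace t ?f \<mu>"
        using e(1,4) i by (simp add: eigenspace_def scaleR_fun_def)
      show "H_inner t (e i) (e j) = (if i = j then 1 else 0)" for j using e(2) by simp
    next
      fix \<xi> assume "\<xi> \<in> eigenspace t ?f \<mu>" and orth: "\<forall>i\<in>{i. \<nu> i = \<mu>}. H_inner t \<xi> (e i) = 0"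
      then have \<xi>: "\<xi> \<in> H0 t" "opf \<xi> = \<mu> *\<^sub>R \<xi>" by (auto simp: eigenspace_def scaleR_fun_def)
      \<comment> \<open>Eigenvectors for different eigenvalues are orthogonal, so \<xi> is
        orthogonal to the whole basis and not only to its part in the eigenspace.\<close>
      have "H_inner t \<xi> (e i) = 0" for i
      proof (cases "\<nu> i = \<mu>")
        case False
        have "\<mu> * H_inner t \<xi> (e i) = \<nu> i * H_inner t \<xi> (e i)"
          using opf_sym[of \<xi> "e i"] \<xi> e(1,4) by (simp add: ip_scale_left ip_scale_right)
        then show ?thesis using False by simp
      qed (use orth in simp)
      then show "\<xi> = 0" using e(3) \<xi>(1) by blast
    qed
    moreover have "hilbert_basis t (H0 t) UNIV e"
      using e unfolding hilbert_basis_def zero by simp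
    ultimately show ?thesis unfolding eigenvalues_with_multiplicity_def by blast
  qed
  have all: "summable (\<lambda>i. \<bar>\<nu> i\<bar>) \<and> (\<lambda>i. 1 + \<nu> i) has_prod det (Ymat 1)"
    if \<nu>: "eigenvalues_with_multiplicity t ?f \<nu>" for \<nu>
  proof -
    obtain e where b: "hilbert_basis t (H0 t) UNIV e" and eig: "\<And>\<mu>. hilbert_basis t (eigenspace t ?f \<mu>) {i. \<nu> i = \<mu>} e"
      using \<nu> unfolding eigenvalues_with_multiplicity_def by auto
    have H: "e i \<in> H0 t" for i using b by (simp add: hilbert_basis_def)
    have on: "H_inner t (e i) (e j) = (if i = j then 1 else 0)" for i j using b by (simp add: hilbert_basis_def)
    have tot: "x = 0" if "x \<in> H0 t" "\<And>i. H_inner t x (e i) = 0" for x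
      using b that unfolding hilbert_basis_def zero by simp
    have ev: "opf (e i) = \<nu> i *\<^sub>R e i" for i
    proof -
      have "e i \<in> eigenspace t ?f (\<nu> i)" using eig[of "\<nu> i"] by (simp add: hilbert_basis_def)
      then show ?thesis using H by (simp add: eigenspace_def scaleR_fun_def)
    qed
    interpret eigenbasis t Hs e \<nu>
      by unfold_locales (use H on tot ev in auto)
    show ?thesis using summable_nu det_eq_prod by simp
  qed
  show ?thesis
    unfolding has_determinant_def Let_def f using opf_self_adjoint ex all by blast
qed

end

theorem theorem1p1p3:
  fixes V :: "real^'n \<Rightarrow> real" and \<omega> x y :: "real^'n" and t :: real and \<gamma> :: "real \<Rightarrow> real^'n"
  assumes "Z_periodic V" and "C_k 3 V" and "t > 0"
    and "critical_point V \<omega> t x y \<gamma>"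
  shows "(\<exists>!T. is_hessian_operator t (action V \<omega> t) \<gamma> T) \<and>
    H_self_adjoint t (hessian_operator t (action V \<omega> t) \<gamma>) \<and>
    (\<forall>w. \<exists>!Y. linearized_solution V t \<gamma> w Y) \<and>
    linear (linearized_map V t \<gamma>) \<and>
    has_determinant t (hessian_operator t (action V \<omega> t) \<gamma>)
      (det (matrix (linearized_map V t \<gamma>)))"
  proof -
  have \<gamma>: "\<gamma> \<in> H_space t x y" using assms(4) by (simp add: critical_point_def)
  interpret action_setup V t \<omega> x y \<gamma>
    by unfold_locales (use assms(2,3) \<gamma> in auto)
  have "linear (linearized_map V t \<gamma>)"
    unfolding linearized_map_eq by (intro linear_compose_scale_right linear_sol)
  moreover have "matrix (linearized_map V t \<gamma>) = Ymat 1"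
    by (simp only: Ymat_def linearized_map_eq)
  moreover have "\<exists>!T. is_hessian_operator t (action V \<omega> t) \<gamma> T"
    using T0_hessian hessian_unique by (rule ex1I)
  moreover have "\<forall>w. \<exists>!Y. linearized_solution V t \<gamma> w Y"
    by (intro allI ex1I) (rule jacobi_solution, rule jacobi_unique)
  ultimately show ?thesis
    using T0_self_adjoint T0_determinant by (simp only: hessian_operator_eq simp_thms)
qed


end
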